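(* Let $X$ be an SMD random variable such that $$a_{2m}\big(K_2(X),\dots,K_{2m-1}(X)\big)\neq 0\quad\text{for every integer } m\ge 3.$$ If $Y$ is a symmetric real random variable admitting moments of all orders such that $\mathit{mmse}(Y,s)=\mathit{mmse}(X,s)$ for all $s>0$, then $X$ and $Y$ have the same distribution.
   Context: Let $T_1,T_2,\dots$ be indeterminates. Define linear operators $L,H$ on $\mathbb{Q}[T_1,T_2,\dots]$ on monomials (constants sent to $0$): $L(T_{\alpha_1}\cdots T_{\alpha_r})=\sum_{1\le i<j\le r}T_{\alpha_1}\cdots T_{\alpha_i+1}\cdots T_{\alpha_j+1}\cdots T_{\alpha_r}$ and $H(T_{\alpha_1}\cdots T_{\alpha_r})=-\frac12\sum_{k=1}^{r}\sum_{l=1}^{\alpha_k-1}\binom{\alpha_k}{l}T_{1+l}T_{1+\alpha_k-l}\prod_{i\ne k}T_{\alpha_i}$. For $n\ge2$ let $A_n=-\sum_{k=1}^{n-1}\binom{n}{k}T_{1+k}T_{1+n-k}T_n$; set $R_2=0$ and $R_{n+1}=A_n+L(R_n)+H(R_n)$. For $n\ge3$ write $R_{n+1}=\sum_{j\ge0}P_jT_n^j$ with $P_j$ not involving $T_n$ and set $a_n:=P_1\in\mathbb{Z}[T_2,\dots,T_{n-1}]$. For a real random variable $X$ with moments of all orders, its cumulants are $K_n(X)=(-i)^n(\ln\varphi_X)^{(n)}(0)$, $\varphi_X$ the characteristic function. $X$ is called SMD if $X$ and $-X$ have the same law, $X$ has moments of all orders, and any random variable $Y$ with $\mathbb{E}[Y^p]=\mathbb{E}[X^p]$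 for all $p\ge1$ has the same law as $X$. For $s>0$, $\mathit{mmse}(X,s)=\mathbb{E}[(X-\mathbb{E}[X\mid Y_s])^2]$ where $Y_s=\sqrt{s}X+N$ and $N$ is a standard Gaussian independent of $X$. *)

theory Defs
  imports "HOL-Probability.Probability" "HOL-Library.Poly_Mapping" "HOL-Library.Multiset"
begin

text \<open>A monomial T_{a_1} ... T_{a_r} is the multiset of its indices {#a_1,...,a_r#};
  a polynomial in Q[T_1,T_2,...] is a finitely supported map from monomials to rationals.\<close>

type_synonym tpoly = "nat multiset \<Rightarrow>\<^sub>0 rat"

definition del_at :: "nat \<Rightarrow> 'a list \<Rightarrow> 'a list" where
  "del_at k xs = take k xs @ drop (Suc k) xs"

definition Lop :: "tpoly \<Rightarrow> tpoly" where
  "Lop p = (\<Sum>M\<in>Poly_Mapping.keys p. let xs = sorted_list_of_multiset M in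
      \<Sum>j<length xs. \<Sum>i<j.
        Poly_Mapping.single (mset (xs[i := Suc (xs ! i), j := Suc (xs ! j)])) (Poly_Mapping.lookup p M))"

definition Hop :: "tpoly \<Rightarrow> tpoly" where
  "Hop p = (\<Sum>M\<in>Poly_Mapping.keys p. let xs = sorted_list_of_multiset M in
      \<Sum>k<length xs. \<Sum>l\<in>{1..<xs ! k}.
        Poly_Mapping.single (mset (del_at k xs) + {#1 + l, 1 + (xs ! k - l)#})
          (- (1/2) * of_nat ((xs ! k) choose l) * Poly_Mapping.lookup p M))"

definition Apoly :: "nat \<Rightarrow> tpoly" where
  "Apoly n = (\<Sum>k\<in>{1..<n}. Poly_Mapping.single {#1 + k, 1 + (n - k), n#} (- of_nat (n choose k)))"

primrec Rpoly :: "nat \<Rightarrow> tpoly" where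
  "Rpoly 0 = 0"
| "Rpoly (Suc n) = (if n < 2 then 0 else Apoly n + Lop (Rpoly n) + Hop (Rpoly n))"

definition coeffT :: "nat \<Rightarrow> nat \<Rightarrow> tpoly \<Rightarrow> tpoly" where
  "coeffT n j p = (\<Sum>M\<in>{M\<in>Poly_Mapping.keys p. count M n = j}.
      Poly_Mapping.single (filter_mset (\<lambda>i. i \<noteq> n) M) (Poly_Mapping.lookup p M))"

definition apoly :: "nat \<Rightarrow> tpoly" where
  "apoly n = coeffT n 1 (Rpoly (Suc n))"

definition peval :: "tpoly \<Rightarrow> (nat \<Rightarrow> complex) \<Rightarrow> complex" where
  "peval p x = (\<Sum>M\<in>Poly_Mapping.keys p. of_rat (Poly_Mapping.lookup p M) * (\<Prod>i\<in>#M. x i))"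

definition nth_deriv :: "nat \<Rightarrow> (real \<Rightarrow> complex) \<Rightarrow> real \<Rightarrow> complex" where
  "nth_deriv n f = ((\<lambda>g t. vector_derivative g (at t)) ^^ n) f"

text \<open>Cumulant K_n = (-i)^n (ln phi)^{(n)}(0) of a law mu (ln is the principal
  logarithm, which is the continuous branch with ln phi(0) = 0 near 0).\<close>
definition cumulant :: "real measure \<Rightarrow> nat \<Rightarrow> complex" where
  "cumulant \<mu> n = (- \<i>) ^ n * nth_deriv n (\<lambda>t. Ln (char \<mu> t)) 0"

definition has_all_moments :: "'a measure \<Rightarrow> ('a \<Rightarrow> real) \<Rightarrow> bool" where
  "has_all_moments M X \<longleftrightarrow> (\<forall>p::nat. integrable M (\<lambda>\<omega>. X \<omega> ^ p))"

definition symmetric_rv :: "'a measure \<Rightarrow> ('a \<Rightarrow> real) \<Rightarrow> bool" where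
  "symmetric_rv M X \<longleftrightarrow> distr M borel X = distr M borel (\<lambda>\<omega>. - X \<omega>)"

definition SMD :: "'a measure \<Rightarrow> ('a \<Rightarrow> real) \<Rightarrow> bool" where
  "SMD M X \<longleftrightarrow> symmetric_rv M X \<and> has_all_moments M X \<and>
     (\<forall>\<nu>::real measure. prob_space \<nu> \<and> sets \<nu> = sets borel \<and>
        (\<forall>p::nat\<ge>1. integrable \<nu> (\<lambda>y. y ^ p) \<and>
            (\<integral>y. y ^ p \<partial>\<nu>) = (\<integral>\<omega>. X \<omega> ^ p \<partial>M))
        \<longrightarrow> \<nu> = distr M borel X)"

text \<open>mmse for a random variable with law mu: realised canonically on the product
  space mu x N(0,1), with X = fst, N = snd, Y_s = sqrt s * X + N.\<close>
definition mmse :: "real measure \<Rightarrow> real \<Rightarrow> real" where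
  "mmse \<mu> s = (let P = \<mu> \<Otimes>\<^sub>M std_normal_distribution;
                   Ys = (\<lambda>\<omega>::real \<times> real. sqrt s * fst \<omega> + snd \<omega>);
                   F = vimage_algebra (space P) Ys borel
               in \<integral>\<omega>. (fst \<omega> - real_cond_exp P F fst \<omega>)\<^sup>2 \<partial>P)"

end

theory Submission
  imports Defs "HOL-Computational_Algebra.Formal_Power_Series"
begin

text \<open>
  Put \<open>\<Lambda>(s, u) = ln E[exp (u X - s X^2 / 2)]\<close>. Then \<open>K\<^sub>n(s, u) = \<partial>\<^sub>u^n \<Lambda>(s, u)\<close> is the \<open>n\<close>-th cumulant
  of the conditional law of \<open>X\<close> given \<open>\<surd>s Y\<^sub>s = u\<close>, and \<open>mmse(X, s) = E[K\<^sub>2(s, \<surd>s Y\<^sub>s)]\<close>. From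
  \<open>\<partial>\<^sub>s \<Lambda> = - (\<partial>\<^sub>u^2 \<Lambda> + (\<partial>\<^sub>u \<Lambda>)^2) / 2\<close> and an integration by parts against the density of
  \<open>\<surd>s Y\<^sub>s\<close> one gets \<open>d/ds E[F(K)] = E[(L F + H F)(K)]\<close> for every polynomial \<open>F\<close>, so the
  \<open>(n-1)\<close>-st derivative of the mmse is \<open>- E[K\<^sub>n^2 + R\<^sub>n(K)]\<close>. Letting \<open>s \<rightarrow> 0\<close>, the numbers
  \<open>K\<^sub>n(X)^2 + R\<^sub>n(K\<^sub>2(X), \<dots>, K\<^bsub>n-1\<^esub>(X))\<close> are determined by the mmse.

  For symmetric \<open>X\<close> the odd cumulants vanish. The value for \<open>n = 2m\<close> gives \<open>K\<^bsub>2m\<^esub>\<close> up to sign, and the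
  value for \<open>n = 2m + 1\<close> is a quadratic polynomial in \<open>K\<^bsub>2m\<^esub>\<close> with linear coefficient \<open>a\<^bsub>2m\<^esub>\<close>, which
  fixes the sign if \<open>m \<ge> 3\<close>. For \<open>m = 2\<close> that coefficient is zero, but \<open>n = 6\<close> and \<open>n = 7\<close> together
  determine \<open>K\<^sub>6^2 - 30 K\<^sub>4^3\<close> and \<open>K\<^sub>4^2 K\<^sub>6\<close>, hence \<open>K\<^sub>4\<close>.
\<close>

section \<open>Cumulants of a moment sequence\<close>

text \<open>The obstacle is that \<open>X\<close> has moments but perhaps no exponential moments:
  \<open>\<Lambda>(0, u)\<close> need not be finite for \<open>u \<noteq> 0\<close>, and
  \<open>s = 0\<close> is a boundary point. Cumulants are therefore defined algebraically from
  moment sequences, derivatives in \<open>s\<close> are taken only at \<open>s > 0\<close>, where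
  the factor \<open>exp (- s X^2 / 2)\<close> makes every tilted moment finite, and
  \<open>s = 0\<close> is reached as a limit at \<open>u = 0\<close>. A second difficulty is that
  conditional cumulants have the normalising integral in their denominators. A monomial of weight
  \<open>p\<close> in them is bounded by a multiple of the conditional expectation of
  \<open>(1 + X^2)^p\<close>, whose mean does not depend on \<open>s\<close>. This estimate supplies
  integrability, the decay for the integration by parts, and the dominating function as
  \<open>s\<close> tends to 0. The recursion for \<open>R\<close> is best read as one for
  \<open>T_n^2 + R_n\<close>: the operator \<open>L + H\<close> takes this polynomial to the one for
  \<open>n + 1\<close>.\<close>

text \<open>The recursion is the coefficientwise form of \<open>M' = (ln M)' M\<close> for exponential generating
  functions; \<open>cum m 0\<close> is a junk value.\<close>

fun cum :: "(nat \<Rightarrow> 'a::field) \<Rightarrow> nat \<Rightarrow> 'a" where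
  "cum m 0 = 0"
| "cum m (Suc n) = (m (Suc n) - (\<Sum>k<n. of_nat (n choose k) * cum m (Suc k) * m (n - k))) / m 0"

declare cum.simps(2) [simp del]
lemmas cum_Suc = cum.simps(2)

lemma moment_Suc_eq_cum:
  assumes "m 0 \<noteq> 0"
  shows "m (Suc n) = (\<Sum>k\<le>n. of_nat (n choose k) * (cum m (Suc k) * m (n - k)))"
proof -
  have "{..n} = insert n {..<n}" by auto
  then show ?thesis using assms by (simp add: mult.assoc cum_Suc[of m n])
qed

text \<open>Homogeneity of weight \<open>n\<close>. It removes the powers of \<open>\<i>\<close>
  that differentiating the characteristic function puts in front of the moments.\<close>

lemma cum_scale: "cum (\<lambda>k. a ^ k * m k) n = a ^ n * cum m n"
proof (induction n rule: less_induct)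
  case (less n)
  show ?case
  proof (cases n)
    case (Suc j)
    have "(\<Sum>k<j. of_nat (j choose k) * cum (\<lambda>k. a ^ k * m k) (Suc k) * (a ^ (j - k) * m (j - k)))
       = (\<Sum>k<j. a ^ Suc j * (of_nat (j choose k) * cum m (Suc k) * m (j - k)))"
    proof (rule sum.cong)
      fix k assume k: "k \<in> {..<j}"
      have *: "a ^ Suc j = a ^ Suc k * a ^ (j - k)"
        using k by (simp only: power_add[symmetric]) simp
      have "cum (\<lambda>k. a ^ k * m k) (Suc k) = a ^ Suc k * cum m (Suc k)"
        using less.IH[of "Suc k"] k Suc by simp
      then show "of_nat (j choose k) * cum (\<lambda>k. a ^ k * m k) (Suc k) * (a ^ (j - k) * m (j - k))
         = a ^ Suc j * (of_nat (j choose k) * cum m (Suc k) * m (j - k))"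
        unfolding * by (simp only: mult_ac)
    qed simp
    then show ?thesis
      by (simp add: Suc cum_Suc[of _ j] sum_distrib_left[symmetric] right_diff_distrib[symmetric] del: power_Suc)
  qed simp
qed

lemma of_real_cum: "of_real (cum m n) = (cum (\<lambda>k. of_real (m k)) n :: 'a::real_normed_field)"
proof (induction n rule: less_induct)
  case (less n)
  show ?case
  proof (cases n)
    case (Suc j)
    have "(\<Sum>k<j. of_nat (j choose k) * of_real (cum m (Suc k)) * of_real (m (j - k)))
       = (\<Sum>k<j. of_nat (j choose k) * cum (\<lambda>k. of_real (m k)) (Suc k) * (of_real (m (j - k)) :: 'a))"
      using less.IH Suc by (intro sum.cong refl) auto
    then show ?thesis by (simp add: Suc cum_Suc[of _ j])
  qed simp
qed

lemma cum_determines_moments: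
  assumes "m 0 = 1" "m' 0 = 1" and eq: "\<And>n. cum m (Suc n) = cum m' (Suc n)"
  shows "m n = m' n"
proof (induction n rule: less_induct)
  case (less n)
  show ?case
  proof (cases n)
    case (Suc j)
    have "m (j - k) = m' (j - k)" for k using less.IH Suc by simp
    then show ?thesis
      using moment_Suc_eq_cum[of m j] moment_Suc_eq_cum[of m' j] assms Suc by simp
  qed (use assms in simp)
qed

text \<open>In the recursion for odd \<open>n = Suc j\<close>, the indices \<open>Suc k\<close> and
  \<open>j - k\<close> add up to \<open>n\<close>, so one of them is odd and every summand has a
  vanishing factor.\<close>

lemma cum_odd_eq_0:
  assumes odd: "\<And>k. odd k \<Longrightarrow> m k = 0" and "odd n"
  shows "cum m n = 0"
  using \<open>odd n\<close>
proof (induction n rule: less_induct)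
  case (less n)
  then obtain j where Suc: "n = Suc j" by (cases n) auto
  have "of_nat (j choose k) * cum m (Suc k) * m (j - k) = 0" if "k < j" for k
    using less.IH[of "Suc k"] odd[of "j - k"] less.prems that Suc by (cases "odd (Suc k)") auto
  then have "(\<Sum>k<j. of_nat (j choose k) * cum m (Suc k) * m (j - k)) = 0"
    by (intro sum.neutral) simp
  then show ?case using odd[OF less.prems] Suc by (simp add: cum_Suc[of _ j])
qed

section \<open>Exponential generating functions and derivatives of cumulants in a parameter\<close>

definition egf :: "(nat \<Rightarrow> 'a::field_char_0) \<Rightarrow> 'a fps" where
  "egf a = Abs_fps (\<lambda>k. a k / fact k)"

lemma egf_eqD: "egf a = egf b \<Longrightarrow> a n = b n"
  by (metis divide_cancel_right egf_def fact_nonzero fps_nth_Abs_fps)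

lemma egf_add: "egf a + egf b = egf (\<lambda>n. a n + b n)"
  by (rule fps_ext) (simp add: egf_def add_divide_distrib)

lemma fps_deriv_egf: "fps_deriv (egf a) = egf (\<lambda>k. a (Suc k))"
  by (rule fps_ext) (simp add: egf_def field_simps del: of_nat_Suc)

lemma egf_mult: "egf a * egf b = egf (\<lambda>n. \<Sum>k\<le>n. of_nat (n choose k) * (a k * b (n - k)))"
proof (rule fps_ext)
  fix n
  have "a k / fact k * (b (n - k) / fact (n - k)) = of_nat (n choose k) * (a k * b (n - k)) / fact n"
    if "k \<le> n" for k
    using that by (simp add: binomial_fact field_simps)
  then show "fps_nth (egf a * egf b) n = fps_nth (egf (\<lambda>n. \<Sum>k\<le>n. of_nat (n choose k) * (a k * b (n - k)))) n"
    by (simp add: egf_def fps_mult_nth sum_divide_distrib atLeast0AtMost)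
qed

lemma fps_deriv_egf_eq_cum:
  "m 0 \<noteq> 0 \<Longrightarrow> fps_deriv (egf m) = egf (\<lambda>k. cum m (Suc k)) * egf m"
  by (simp add: fps_deriv_egf egf_mult moment_Suc_eq_cum[symmetric])

text \<open>\<open>e\<close> is a proposed sequence of derivatives, and \<open>id\<close> is the
  moment recursion differentiated with \<open>e\<close> in place of the derivatives of the
  cumulants. Its top summand contains \<open>e n * m 0 t\<close>, so the proposal is forced, and the
  quotient rule confirms it by strong induction. Both evolution laws, in \<open>u\<close> and in
  \<open>s\<close>, are instances.\<close>

lemma has_vector_derivative_cum:
  fixes m :: "nat \<Rightarrow> real \<Rightarrow> 'a::real_normed_field"
  assumes der: "\<And>k. (m k has_vector_derivative m' k) (at t)" and nz: "m 0 t \<noteq> 0"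
    and id: "\<And>n. m' (Suc n) = (\<Sum>k\<le>n. of_nat (n choose k) *
        (e k * m (n - k) t + cum (\<lambda>k. m k t) (Suc k) * m' (n - k)))"
  shows "((\<lambda>t. cum (\<lambda>k. m k t) (Suc n)) has_vector_derivative e n) (at t)"
proof (induction n rule: less_induct)
  case (less n)
  let ?c = "\<lambda>k. cum (\<lambda>k. m k t) (Suc k)"
  define N where "N t = m (Suc n) t - (\<Sum>k<n. of_nat (n choose k) * cum (\<lambda>k. m k t) (Suc k) * m (n - k) t)" for t
  define N' where "N' = m' (Suc n) - (\<Sum>k<n. of_nat (n choose k) * (e k * m (n - k) t + ?c k * m' (n - k)))"
  have "(N has_vector_derivative N') (at t)"
    unfolding N_def N'_def
    by (auto intro!: derivative_eq_intros der less.IH simp: algebra_simps)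
  moreover have "((inverse \<circ> m 0) has_vector_derivative m' 0 * (- (inverse (m 0 t) * inverse (m 0 t)))) (at t)"
    using field_vector_diff_chain_at[OF der DERIV_inverse'[OF DERIV_ident nz]] by simp
  ultimately have "((\<lambda>t. N t * (inverse \<circ> m 0) t) has_vector_derivative
      N t * (m' 0 * (- (inverse (m 0 t) * inverse (m 0 t)))) + N' * (inverse \<circ> m 0) t) (at t)"
    by (rule has_vector_derivative_mult)
  moreover have "N t = ?c n * m 0 t"
    using nz by (simp add: N_def cum_Suc[of _ n])
  moreover have "N' = e n * m 0 t + ?c n * m' 0"
  proof -
    have "{..n} = insert n {..<n}" by auto
    then show ?thesis unfolding N'_def id by simp
  qed
  ultimately have "((\<lambda>t. N t * (inverse \<circ> m 0) t) has_vector_derivative e n) (at t)"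
    using nz by (simp add: field_simps)
  then show ?case by (simp add: N_def[abs_def] divide_inverse cum_Suc[of _ n] del: of_nat_Suc)
qed

text \<open>If differentiation in \<open>t\<close> raises the index of the moments, it acts on their
  generating function \<open>M\<close> as the formal derivative. The required identity is the formal
  derivative of \<open>M' = K M\<close>.\<close>

lemma has_vector_derivative_cum_shift:
  fixes m :: "nat \<Rightarrow> real \<Rightarrow> 'a::{real_normed_field}"
  assumes der: "\<And>k. (m k has_vector_derivative m (Suc k) t) (at t)" and nz: "m 0 t \<noteq> 0"
  shows "((\<lambda>t. cum (\<lambda>k. m k t) (Suc n)) has_vector_derivative cum (\<lambda>k. m k t) (Suc (Suc n))) (at t)"
proof (rule has_vector_derivative_cum[where m'="\<lambda>k. m (Suc k) t"
        and e="\<lambda>n. cum (\<lambda>k. m k t) (Suc (Suc n))", OF der nz])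
  fix n
  let ?M = "egf (\<lambda>k. m k t)" and ?K = "egf (\<lambda>k. cum (\<lambda>k. m k t) (Suc k))"
  have "fps_deriv (fps_deriv ?M) = ?K * fps_deriv ?M + fps_deriv ?K * ?M"
    using fps_deriv_egf_eq_cum[of "\<lambda>k. m k t"] nz by simp
  then have "egf (\<lambda>k. m (Suc (Suc k)) t) = egf (\<lambda>n. \<Sum>k\<le>n. of_nat (n choose k) *
        (cum (\<lambda>k. m k t) (Suc (Suc k)) * m (n - k) t + cum (\<lambda>k. m k t) (Suc k) * m (Suc (n - k)) t))"
    by (simp add: fps_deriv_egf egf_mult egf_add sum.distrib[symmetric] distrib_left
        add.commute)
  then show "m (Suc (Suc n)) t = (\<Sum>k\<le>n. of_nat (n choose k) *
        (cum (\<lambda>k. m k t) (Suc (Suc k)) * m (n - k) t + cum (\<lambda>k. m k t) (Suc k) * m (Suc (n - k)) t))"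
    by (rule egf_eqD)
qed

definition cum_drift :: "(nat \<Rightarrow> 'a::field) \<Rightarrow> nat \<Rightarrow> 'a" where
  "cum_drift K n = - (K (n + 2) + (\<Sum>l\<le>n. of_nat (n choose l) * (K (Suc l) * K (Suc (n - l))))) / 2"

text \<open>Coefficientwise form of the equation \<open>\<partial>\<^sub>s \<Lambda> = - (\<Lambda>'' + \<Lambda>'^2) / 2\<close>
  satisfied by the logarithm of a solution of \<open>\<partial>\<^sub>s Z = - Z'' / 2\<close>.\<close>

lemma has_vector_derivative_cum_heat:
  fixes m :: "nat \<Rightarrow> real \<Rightarrow> 'a::{real_normed_field}"
  assumes der: "\<And>k. (m k has_vector_derivative - m (Suc (Suc k)) t / 2) (at t)" and nz: "m 0 t \<noteq> 0"
  shows "((\<lambda>t. cum (\<lambda>k. m k t) (Suc n)) has_vector_derivative cum_drift (cum (\<lambda>k. m k t)) (Suc n)) (at t)"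
proof (rule has_vector_derivative_cum[where m'="\<lambda>k. - m (Suc (Suc k)) t / 2"
        and e="\<lambda>n. cum_drift (cum (\<lambda>k. m k t)) (Suc n)", OF der nz])
  fix n
  let ?c = "cum (\<lambda>k. m k t)"
  let ?M = "egf (\<lambda>k. m k t)" and ?K = "egf (\<lambda>k. ?c (Suc k))"
  \<comment> \<open>\<open>E\<close> is \<open>M'' / M\<close>, the series of
    \<open>\<Lambda>'' + \<Lambda>'^2\<close>; the drift is \<open>- 1 / 2\<close> times its
    coefficients.\<close>
  define E where "E = egf (\<lambda>n. - 2 * cum_drift ?c n)"
  have E: "E = fps_deriv ?K + ?K * ?K"
    unfolding E_def cum_drift_def by (simp add: fps_deriv_egf egf_mult egf_add add_divide_distrib add.commute)
  have M1: "fps_deriv ?M = ?K * ?M"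
    using fps_deriv_egf_eq_cum[of "\<lambda>k. m k t"] nz by simp
  have M2: "fps_deriv (fps_deriv ?M) = E * ?M"
    unfolding E by (simp add: M1 algebra_simps)
  \<comment> \<open>From \<open>M'' = E M\<close> and \<open>M' = K M\<close> follows
    \<open>M''' = E' M + E K M = E' M + K M''\<close>.\<close>
  have "fps_deriv (fps_deriv (fps_deriv ?M)) = fps_deriv E * ?M + ?K * fps_deriv (fps_deriv ?M)"
    unfolding M2 by (simp add: M1 algebra_simps)
  then have "egf (\<lambda>k. m (Suc (Suc (Suc k))) t) = egf (\<lambda>n. \<Sum>k\<le>n. of_nat (n choose k) *
        (- 2 * cum_drift ?c (Suc k) * m (n - k) t + ?c (Suc k) * m (Suc (Suc (n - k))) t))"
    by (simp add: E_def fps_deriv_egf egf_mult egf_add sum.distrib[symmetric]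
        distrib_left right_diff_distrib)
  then have "m (Suc (Suc (Suc n))) t = (\<Sum>k\<le>n. of_nat (n choose k) *
        (- 2 * cum_drift ?c (Suc k) * m (n - k) t + ?c (Suc k) * m (Suc (Suc (n - k))) t))"
    by (rule egf_eqD)
  then have "- m (Suc (Suc (Suc n))) t / 2 = (\<Sum>k\<le>n. - (of_nat (n choose k) *
        (- 2 * cum_drift ?c (Suc k) * m (n - k) t + ?c (Suc k) * m (Suc (Suc (n - k))) t)) / 2)"
    by (simp add: sum_negf sum_divide_distrib[symmetric])
  then show "- m (Suc (Suc (Suc n))) t / 2 = (\<Sum>k\<le>n. of_nat (n choose k) *
        (cum_drift ?c (Suc k) * m (n - k) t + ?c (Suc k) * (- m (Suc (Suc (n - k))) t / 2)))"
    by (simp add: field_simps)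
qed

section \<open>Differentiation under the integral sign\<close>

lemma has_vector_derivative_iff_quotient:
  fixes f :: "real \<Rightarrow> 'b::real_normed_vector"
  shows "(f has_vector_derivative D) (at x) \<longleftrightarrow> ((\<lambda>h. (1 / h) *\<^sub>R (f (x + h) - f x)) \<longlongrightarrow> D) (at 0)"
proof -
  have "norm ((1 / h) *\<^sub>R (f (x + h) - f x) - D) = norm (f (x + h) - f x - h *\<^sub>R D) / norm h"
    if "h \<noteq> 0" for h
  proof -
    have "(1 / h) *\<^sub>R (f (x + h) - f x) - D = (1 / h) *\<^sub>R (f (x + h) - f x - h *\<^sub>R D)"
      using that by (simp add: algebra_simps)
    then show ?thesis by simp
  qed
  then have "((\<lambda>h. norm ((1 / h) *\<^sub>R (f (x + h) - f x) - D)) \<longlongrightarrow> 0) (at 0) \<longleftrightarrow>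
    ((\<lambda>h. norm (f (x + h) - f x - h *\<^sub>R D) / norm h) \<longlongrightarrow> 0) (at 0)"
    by (intro LIM_cong) auto
  then show ?thesis
    by (simp add: has_vector_derivative_def has_derivative_at tendsto_norm_zero_iff
        LIM_zero_iff bounded_linear_scaleR_left)
qed

text \<open>The mean value inequality bounds the difference quotients by \<open>D\<close>, so
  dominated convergence applies along every sequence of increments.\<close>

lemma has_vector_derivative_integral_dominated:
  fixes f f' :: "real \<Rightarrow> 'a \<Rightarrow> 'b::{banach, second_countable_topology}"
  assumes e: "e > 0"
    and int: "\<And>t. \<bar>t - t0\<bar> < e \<Longrightarrow> integrable M (f t)"
    and meas: "f' t0 \<in> borel_measurable M"
    and der: "\<And>t x. x \<in> space M \<Longrightarrow> \<bar>t - t0\<bar> < e \<Longrightarrow> ((\<lambda>t. f t x) has_vector_derivative f' t x) (at t)"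
    and bound: "\<And>t x. x \<in> space M \<Longrightarrow> \<bar>t - t0\<bar> < e \<Longrightarrow> norm (f' t x) \<le> D x"
    and D: "integrable M D"
  shows "((\<lambda>t. integral\<^sup>L M (f t)) has_vector_derivative integral\<^sup>L M (f' t0)) (at t0)"
proof -
  have "((\<lambda>h. (1 / h) *\<^sub>R (integral\<^sup>L M (f (t0 + h)) - integral\<^sup>L M (f t0))) \<longlongrightarrow> integral\<^sup>L M (f' t0)) (at 0)"
  proof (rule iffD2[OF tendsto_at_iff_sequentially], intro allI impI)
    fix h :: "nat \<Rightarrow> real" assume h0: "\<forall>i. h i \<in> UNIV - {0}" and h: "h \<longlonglongrightarrow> 0"
    obtain N where N: "\<And>n. n \<ge> N \<Longrightarrow> \<bar>h n\<bar> < e"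
      using LIMSEQ_D[OF h e] by auto
    define k where "k n = h (n + N)" for n
    have k: "k \<longlonglongrightarrow> 0" "\<And>n. k n \<noteq> 0" "\<And>n. \<bar>k n\<bar> < e"
      using h h0 N LIMSEQ_ignore_initial_segment[OF h, of N] by (auto simp: k_def[abs_def])
    define g where "g n x = (1 / k n) *\<^sub>R (f (t0 + k n) x - f t0 x)" for n x
    have fm: "f t \<in> borel_measurable M" if "\<bar>t - t0\<bar> < e" for t
      using int[OF that] by simp
    have "(\<lambda>n. integral\<^sup>L M (g n)) \<longlonglongrightarrow> integral\<^sup>L M (f' t0)"
    proof (rule integral_dominated_convergence[where w = D])
      show "g n \<in> borel_measurable M" for n
        unfolding g_def using fm[of "t0 + k n"] fm[of t0] k(3)[of n] e by auto
      show "AE x in M. (\<lambda>n. g n x) \<longlonglongrightarrow> f' t0 x"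
      proof (rule AE_I2)
        fix x assume x: "x \<in> space M"
        have "((\<lambda>t. f t x) has_vector_derivative f' t0 x) (at t0)" using der[OF x] e by simp
        then have "((\<lambda>h. (1 / h) *\<^sub>R (f (t0 + h) x - f t0 x)) \<longlongrightarrow> f' t0 x) (at 0)"
          by (simp add: has_vector_derivative_iff_quotient)
        then show "(\<lambda>n. g n x) \<longlonglongrightarrow> f' t0 x"
          unfolding g_def using k by (auto simp: tendsto_at_iff_sequentially o_def)
      qed
      show "AE x in M. norm (g n x) \<le> D x" for n
      proof (rule AE_I2)
        fix x assume x: "x \<in> space M"
        have "norm (f (t0 + k n) x - f t0 x) \<le> D x * norm (t0 + k n - t0)"
        proof (rule differentiable_bound[where S = "ball t0 e" and f = "\<lambda>t. f t x"
              and f' = "\<lambda>t h. h *\<^sub>R f' t x"])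
          fix t assume t: "t \<in> ball t0 e"
          then have t': "\<bar>t - t0\<bar> < e" by (simp add: dist_real_def abs_minus_commute)
          show "((\<lambda>t. f t x) has_derivative (\<lambda>h. h *\<^sub>R f' t x)) (at t within ball t0 e)"
            using der[OF x t'] has_derivative_at_withinI unfolding has_vector_derivative_def by blast
          show "onorm (\<lambda>h. h *\<^sub>R f' t x) \<le> D x"
            by (rule onorm_le) (use bound[OF x t'] in \<open>simp add: mult.commute[of "D x"] mult_left_mono\<close>)
        qed (use e k(3)[of n] in \<open>auto simp: dist_real_def\<close>)
        then show "norm (g n x) \<le> D x"
          using k(2)[of n] by (simp add: g_def pos_divide_le_eq del: scaleR_right_diff_distrib)
      qed
    qed (use D meas in auto)
    moreover have "integral\<^sup>L M (g n) = (1 / k n) *\<^sub>R (integral\<^sup>L M (f (t0 + k n)) - integral\<^sup>L M (f t0))" for n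
      unfolding g_def using int[of "t0 + k n"] int[of t0] k(3)[of n] e by simp
    ultimately have "(\<lambda>n. (1 / k n) *\<^sub>R (integral\<^sup>L M (f (t0 + k n)) - integral\<^sup>L M (f t0))) \<longlonglongrightarrow> integral\<^sup>L M (f' t0)"
      by simp
    then show "((\<lambda>h. (1 / h) *\<^sub>R (integral\<^sup>L M (f (t0 + h)) - integral\<^sup>L M (f t0))) \<circ> h) \<longlonglongrightarrow> integral\<^sup>L M (f' t0)"
      unfolding k_def o_def by (rule LIMSEQ_offset[where k = N])
  qed
  then show ?thesis
    by (simp add: has_vector_derivative_iff_quotient)
qed


text \<open>The form in which integration by parts is used: the difference of two integrands is the
  derivative of a flux that vanishes at both ends.\<close>

lemma integral_deriv_eq_0:
  fixes F f :: "real \<Rightarrow> real"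
  assumes "\<And>x. (F has_real_derivative f x) (at x)" "continuous_on UNIV f" "integrable lborel f"
    and "(F \<longlongrightarrow> 0) at_top" "(F \<longlongrightarrow> 0) at_bot"
  shows "integral\<^sup>L lborel f = 0"
proof -
  have "(LBINT x=-\<infinity>..\<infinity>. f x) = 0 - 0"
  proof (rule interval_integral_FTC_integrable)
    show "set_integrable lborel (einterval (-\<infinity>) \<infinity>) f"
      using assms(3) by (simp add: set_integrable_def)
  qed (use assms in \<open>auto simp: ereal_tendsto_simps1 continuous_on_eq_continuous_at
      has_real_derivative_iff_has_vector_derivative\<close>)
  then show ?thesis
    by (simp add: interval_lebesgue_integral_def set_lebesgue_integral_def)
qed

section \<open>Elementary inequalities for the decay estimates\<close>

lemma integrable_inverse_one_plus_square: "integrable lborel (\<lambda>u::real. 1 / (1 + u\<^sup>2))"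
  using integrable_inverse_1_plus_square by (simp add: set_integrable_def inverse_eq_divide)

text \<open>Peetre's inequality; the difference of the two sides is 1 plus a sum of squares.\<close>

lemma one_plus_square_add_le: "1 + (a + b)\<^sup>2 \<le> 2 * (1 + a\<^sup>2) * (1 + (b::real)\<^sup>2)"
proof -
  have "2 * (1 + a\<^sup>2) * (1 + b\<^sup>2) - (1 + (a + b)\<^sup>2) = 1 + (a - b)\<^sup>2 + 2 * (a * b)\<^sup>2"
    by (simp add: power2_eq_square algebra_simps)
  then show ?thesis by (smt (verit) zero_le_power2)
qed

text \<open>The square of \<open>1 + t \<le> exp t\<close> at \<open>t = v^2 / (4 b)\<close>; the
  maximum with 1 takes care of the constant summand when \<open>b\<close> is small.\<close>

lemma one_plus_square_exp_le:
  assumes "b > (0::real)"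
  shows "(1 + v\<^sup>2)\<^sup>2 * exp (- v\<^sup>2 / (2 * b)) \<le> (max 1 (4 * b))\<^sup>2"
proof -
  have "1 + v\<^sup>2 \<le> max 1 (4 * b) * (1 + v\<^sup>2 / (4 * b))"
  proof -
    have "max 1 (4 * b) * (v\<^sup>2 / (4 * b)) \<ge> 4 * b * (v\<^sup>2 / (4 * b))"
      using assms by (intro mult_right_mono) auto
    then show ?thesis using assms by (simp add: distrib_left)
  qed
  also have "\<dots> \<le> max 1 (4 * b) * exp (v\<^sup>2 / (4 * b))"
    by (intro mult_left_mono exp_ge_add_one_self) auto
  finally have "(1 + v\<^sup>2) * exp (- v\<^sup>2 / (4 * b)) \<le> max 1 (4 * b)"
    by (simp add: exp_minus field_simps)
  then have "((1 + v\<^sup>2) * exp (- v\<^sup>2 / (4 * b)))\<^sup>2 \<le> (max 1 (4 * b))\<^sup>2"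
    by (intro power_mono) auto
  moreover have "(exp (- v\<^sup>2 / (4 * b)))\<^sup>2 = exp (- v\<^sup>2 / (2 * b))"
    using assms by (simp add: power2_eq_square exp_add[symmetric] field_simps)
  ultimately show ?thesis by (simp add: power_mult_distrib)
qed

section \<open>Monomials in the cumulants\<close>

text \<open>Lists instead of multisets turn Leibniz sums over positions into primitive recursions;
  the value does not depend on the order.\<close>

definition monoval :: "(nat \<Rightarrow> 'a::comm_ring_1) \<Rightarrow> nat list \<Rightarrow> 'a" where
  "monoval K xs = prod_list (map K xs)"

lemma monoval_simps [simp]: "monoval K [] = 1" "monoval K (x # xs) = K x * monoval K xs"
  by (simp_all add: monoval_def)

text \<open>The derivative of the monomial when each \<open>K i\<close> has derivative
  \<open>K (Suc i)\<close>.\<close>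

primrec shift1 :: "(nat \<Rightarrow> 'a::comm_ring_1) \<Rightarrow> nat list \<Rightarrow> 'a" where
  "shift1 K [] = 0"
| "shift1 K (x # xs) = K (Suc x) * monoval K xs + K x * shift1 K xs"

text \<open>The diagonal part of the second derivative under the same rule; the mixed part is
  \<open>2 * Lval\<close>.\<close>

primrec shift2 :: "(nat \<Rightarrow> 'a::comm_ring_1) \<Rightarrow> nat list \<Rightarrow> 'a" where
  "shift2 K [] = 0"
| "shift2 K (x # xs) = K (Suc (Suc x)) * monoval K xs + K x * shift2 K xs"

primrec Lval :: "(nat \<Rightarrow> 'a::comm_ring_1) \<Rightarrow> nat list \<Rightarrow> 'a" where
  "Lval K [] = 0"
| "Lval K (x # xs) = K (Suc x) * shift1 K xs + K x * Lval K xs"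

text \<open>The operator \<open>H\<close> on a single variable; \<open>Hval\<close> extends it as a
  derivation.\<close>

definition splitval :: "(nat \<Rightarrow> 'a::field) \<Rightarrow> nat \<Rightarrow> 'a" where
  "splitval K x = - (\<Sum>l\<in>{1..<x}. of_nat (x choose l) * (K (1 + l) * K (1 + (x - l)))) / 2"

primrec Hval :: "(nat \<Rightarrow> 'a::field) \<Rightarrow> nat list \<Rightarrow> 'a" where
  "Hval K [] = 0"
| "Hval K (x # xs) = splitval K x * monoval K xs + K x * Hval K xs"

text \<open>The end terms \<open>l = 0\<close> and \<open>l = x\<close> give
  \<open>K 1 * K (Suc x)\<close>. They are kept apart from \<open>H\<close> because they cancel in
  the integration by parts, which is why no \<open>K 1\<close> enters the polynomials.\<close>

lemma cum_drift_eq_splitval: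
  fixes K :: "nat \<Rightarrow> 'a::field_char_0"
  assumes "x > 0"
  shows "cum_drift K x = - K (Suc (Suc x)) / 2 - K 1 * K (Suc x) + splitval K x"
proof -
  let ?f = "\<lambda>l. of_nat (x choose l) * (K (Suc l) * K (Suc (x - l)))"
  have "{..x} = insert 0 (insert x {1..<x})" using assms by auto
  then have "(\<Sum>l\<le>x. ?f l) = K 1 * K (Suc x) + (K (Suc x) * K 1 + (\<Sum>l\<in>{1..<x}. ?f l))"
    using assms by simp
  then show ?thesis by (simp add: cum_drift_def splitval_def field_simps)
qed

lemma monoval_has_derivative_shift1:
  fixes K :: "nat \<Rightarrow> real \<Rightarrow> real"
  assumes "\<And>i. i > 0 \<Longrightarrow> (K i has_real_derivative K (Suc i) t) (at t)" "0 \<notin> set xs"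
  shows "((\<lambda>t. monoval (\<lambda>i. K i t) xs) has_real_derivative shift1 (\<lambda>i. K i t) xs) (at t)"
  using assms(2)
proof (induction xs)
  case (Cons x xs)
  then show ?case by (auto intro!: derivative_eq_intros assms)
qed simp

lemma shift1_has_derivative:
  fixes K :: "nat \<Rightarrow> real \<Rightarrow> real"
  assumes "\<And>i. i > 0 \<Longrightarrow> (K i has_real_derivative K (Suc i) t) (at t)" "0 \<notin> set xs"
  shows "((\<lambda>t. shift1 (\<lambda>i. K i t) xs) has_real_derivative
     2 * Lval (\<lambda>i. K i t) xs + shift2 (\<lambda>i. K i t) xs) (at t)"
  using assms(2)
proof (induction xs)
  case (Cons x xs)
  then show ?case
    by (auto intro!: derivative_eq_intros assms monoval_has_derivative_shift1 simp: algebra_simps)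
qed simp

lemma monoval_has_derivative_heat:
  fixes K :: "nat \<Rightarrow> real \<Rightarrow> real"
  assumes "\<And>i. i > 0 \<Longrightarrow> (K i has_real_derivative cum_drift (\<lambda>i. K i t) i) (at t)" "0 \<notin> set xs"
  shows "((\<lambda>t. monoval (\<lambda>i. K i t) xs) has_real_derivative
     - shift2 (\<lambda>i. K i t) xs / 2 - K 1 t * shift1 (\<lambda>i. K i t) xs + Hval (\<lambda>i. K i t) xs) (at t)"
  using assms(2)
proof (induction xs)
  case (Cons x xs)
  then have "x > 0" by simp
  with Cons show ?case
    by (auto intro!: derivative_eq_intros assms simp: cum_drift_eq_splitval field_simps)
qed simp

section \<open>Bounds for cumulants by absolute moments\<close>

text \<open>The intended \<open>A n\<close> is the conditional expectation of
  \<open>(1 + X^2) ^ n\<close>, and \<open>c\<close> is a sequence of constants independent of the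
  law.\<close>

definition dominated :: "(nat \<Rightarrow> real) \<Rightarrow> (nat \<Rightarrow> real) \<Rightarrow> (nat \<Rightarrow> real) \<Rightarrow> bool" where
  "dominated c K A \<longleftrightarrow> A 0 = 1 \<and> (\<forall>n. 0 \<le> A n) \<and> (\<forall>i j. A i * A j \<le> 2 * A (i + j)) \<and> (\<forall>n. \<bar>K n\<bar> \<le> c n * A n)"

text \<open>\<open>bdd c p F\<close>: the function \<open>F\<close> of the cumulants is at most a multiple of the absolute moment
  \<open>A p\<close>, uniformly over all laws. As \<open>A i * A j \<le> 2 * A (i + j)\<close>, this is graded by weight.\<close>

definition bdd :: "(nat \<Rightarrow> real) \<Rightarrow> nat \<Rightarrow> ((nat \<Rightarrow> real) \<Rightarrow> real) \<Rightarrow> bool" where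
  "bdd c p F \<longleftrightarrow> (\<exists>C\<ge>0. \<forall>K A. dominated c K A \<longrightarrow> \<bar>F K\<bar> \<le> C * A p)"

lemma bdd_var: "bdd c n (\<lambda>K. K n)"
  unfolding bdd_def
proof (intro exI[of _ "\<bar>c n\<bar>"] conjI allI impI)
  fix K A assume "dominated c K A"
  then have "\<bar>K n\<bar> \<le> c n * A n" "0 \<le> A n" by (auto simp: dominated_def)
  moreover have "c n * A n \<le> \<bar>c n\<bar> * A n" using \<open>0 \<le> A n\<close> by (intro mult_right_mono) auto
  ultimately show "\<bar>K n\<bar> \<le> \<bar>c n\<bar> * A n" by linarith
qed simp

lemma bdd_zero: "bdd c p (\<lambda>K. 0)"
  unfolding bdd_def by (intro exI[of _ 0]) (auto simp: dominated_def)

lemma bdd_one: "bdd c 0 (\<lambda>K. 1)"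
  unfolding bdd_def by (intro exI[of _ 1]) (auto simp: dominated_def)

lemma bdd_add:
  assumes "bdd c p F" "bdd c p G"
  shows "bdd c p (\<lambda>K. F K + G K)"
proof -
  obtain C D where CD: "C \<ge> 0" "D \<ge> 0" "\<And>K A. dominated c K A \<Longrightarrow> \<bar>F K\<bar> \<le> C * A p" "\<And>K A. dominated c K A \<Longrightarrow> \<bar>G K\<bar> \<le> D * A p"
    using assms by (auto simp: bdd_def)
  have "\<bar>F K + G K\<bar> \<le> (C + D) * A p" if "dominated c K A" for K A
    using CD(3,4)[OF that] by (simp add: distrib_right)
  then show ?thesis unfolding bdd_def using CD(1,2) by (intro exI[of _ "C + D"]) auto
qed

lemma bdd_mult:
  assumes "bdd c p F" "bdd c q G"
  shows "bdd c (p + q) (\<lambda>K. F K * G K)"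
proof -
  obtain C D where CD: "C \<ge> 0" "D \<ge> 0" "\<And>K A. dominated c K A \<Longrightarrow> \<bar>F K\<bar> \<le> C * A p" "\<And>K A. dominated c K A \<Longrightarrow> \<bar>G K\<bar> \<le> D * A q"
    using assms by (auto simp: bdd_def)
  have "\<bar>F K * G K\<bar> \<le> (C * D * 2) * A (p + q)" if a: "dominated c K A" for K A
  proof -
    have A: "A p \<ge> 0" "A q \<ge> 0" "A p * A q \<le> 2 * A (p + q)" using a by (auto simp: dominated_def)
    have "\<bar>F K\<bar> * \<bar>G K\<bar> \<le> (C * A p) * (D * A q)"
      using CD(3,4)[OF a] CD(1) A by (intro mult_mono) auto
    also have "\<dots> = (C * D) * (A p * A q)" by simp
    also have "\<dots> \<le> (C * D) * (2 * A (p + q))" using CD(1,2) A by (intro mult_left_mono) auto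
    finally show ?thesis by (simp add: abs_mult)
  qed
  then show ?thesis unfolding bdd_def using CD(1,2) by (intro exI[of _ "C * D * 2"]) auto
qed

lemma bdd_cmult: "bdd c p F \<Longrightarrow> bdd c p (\<lambda>K. a * F K)"
proof -
  assume "bdd c p F"
  then obtain C where C: "C \<ge> 0" "\<And>K A. dominated c K A \<Longrightarrow> \<bar>F K\<bar> \<le> C * A p" by (auto simp: bdd_def)
  have "\<bar>a * F K\<bar> \<le> (\<bar>a\<bar> * C) * A p" if "dominated c K A" for K A
    using C(2)[OF that] by (simp add: abs_mult mult.assoc mult_left_mono)
  then show ?thesis unfolding bdd_def using C(1) by (intro exI[of _ "\<bar>a\<bar> * C"]) auto
qed

lemma bdd_sum: "(\<And>i. i \<in> I \<Longrightarrow> bdd c p (F i)) \<Longrightarrow> bdd c p (\<lambda>K. \<Sum>i\<in>I. F i K)"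
  by (induction I rule: infinite_finite_induct) (auto intro: bdd_zero bdd_add)

lemma bdd_monoval: "bdd c (sum_list xs) (\<lambda>K. monoval K xs)"
proof (induction xs)
  case (Cons x xs)
  show ?case using bdd_mult[OF bdd_var[of c x] Cons] by simp
qed (simp add: bdd_one)

lemma bdd_shift1: "bdd c (Suc (sum_list xs)) (\<lambda>K. shift1 K xs)"
proof (induction xs)
  case (Cons x xs)
  show ?case
    using bdd_add[OF bdd_mult[OF bdd_var[of c "Suc x"] bdd_monoval[of c xs]]] bdd_mult[OF bdd_var[of c x] Cons]
    by simp
qed (simp add: bdd_zero)

lemma bdd_shift2: "bdd c (Suc (Suc (sum_list xs))) (\<lambda>K. shift2 K xs)"
proof (induction xs)
  case (Cons x xs)
  show ?case
    using bdd_add[OF bdd_mult[OF bdd_var[of c "Suc (Suc x)"] bdd_monoval[of c xs]]] bdd_mult[OF bdd_var[of c x] Cons]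
    by simp
qed (simp add: bdd_zero)

lemma bdd_Lval: "bdd c (Suc (Suc (sum_list xs))) (\<lambda>K. Lval K xs)"
proof (induction xs)
  case (Cons x xs)
  show ?case
    using bdd_add[OF bdd_mult[OF bdd_var[of c "Suc x"] bdd_shift1[of c xs]]] bdd_mult[OF bdd_var[of c x] Cons]
    by simp
qed (simp add: bdd_zero)

lemma bdd_splitval: "bdd c (Suc (Suc x)) (\<lambda>K. splitval K x)"
proof -
  have "bdd c (Suc (Suc x)) (\<lambda>K. of_nat (x choose l) * (K (1 + l) * K (1 + (x - l))))" if "l \<in> {1..<x}" for l
    using bdd_cmult[OF bdd_mult[OF bdd_var[of c "1 + l"] bdd_var[of c "1 + (x - l)"]], of "of_nat (x choose l)"] that
    by simp
  then have "bdd c (Suc (Suc x)) (\<lambda>K. (- 1 / 2) * (\<Sum>l\<in>{1..<x}. of_nat (x choose l) * (K (1 + l) * K (1 + (x - l)))))"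
    by (intro bdd_cmult[of _ _ _ "- 1 / 2"] bdd_sum)
  then show ?thesis by (simp add: splitval_def)
qed

lemma bdd_Hval: "bdd c (Suc (Suc (sum_list xs))) (\<lambda>K. Hval K xs)"
proof (induction xs)
  case (Cons x xs)
  show ?case
    using bdd_add[OF bdd_mult[OF bdd_splitval[of c x] bdd_monoval[of c xs]]] bdd_mult[OF bdd_var[of c x] Cons]
    by simp
qed (simp add: bdd_zero)

text \<open>The cumulant recursion run with absolute values; the 2 comes from the product inequality
  for the weights.\<close>

fun cumC :: "nat \<Rightarrow> real" where
  "cumC 0 = 0"
| "cumC (Suc n) = 1 + (\<Sum>k<n. of_nat (n choose k) * (2 * cumC (Suc k)))"

declare cumC.simps(2) [simp del]

lemma cumC_nonneg: "cumC n \<ge> 0"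
proof (induction n rule: less_induct)
  case (less n)
  show ?case
  proof (cases n)
    case (Suc j)
    have "0 \<le> (\<Sum>k<j. of_nat (j choose k) * (2 * cumC (Suc k)))"
      using less Suc by (intro sum_nonneg) simp
    then show ?thesis by (simp add: Suc cumC.simps(2)[of j])
  qed simp
qed

text \<open>\<open>w\<close> is a weight sequence before normalisation. In the recursion each
  product \<open>w (Suc k) * w (j - k)\<close> is at most \<open>2 * w 0 * w (Suc j)\<close>, so the
  bound is inherited by induction.\<close>

lemma dominated_cum:
  assumes w: "w 0 = m 0" "0 < w 0" "\<And>n. 0 \<le> w n" "\<And>i j. w i * w j \<le> 2 * w 0 * w (i + j)"
    and m: "\<And>n. \<bar>m n\<bar> \<le> w n"
  shows "dominated cumC (cum m) (\<lambda>n. w n / w 0)"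
proof -
  have "\<bar>cum m n\<bar> \<le> cumC n * (w n / w 0)" for n
  proof (induction n rule: less_induct)
    case (less n)
    show ?case
    proof (cases n)
      case (Suc j)
      have "\<bar>\<Sum>k<j. of_nat (j choose k) * cum m (Suc k) * m (j - k)\<bar>
         \<le> (\<Sum>k<j. of_nat (j choose k) * (2 * cumC (Suc k)) * w (Suc j))"
      proof (rule order_trans[OF sum_abs], rule sum_mono)
        fix k assume k: "k \<in> {..<j}"
        then have IH: "\<bar>cum m (Suc k)\<bar> \<le> cumC (Suc k) * (w (Suc k) / w 0)"
          using less.IH[of "Suc k"] Suc by simp
        have c0: "cumC (Suc k) \<ge> 0" by (rule cumC_nonneg)
        have "\<bar>cum m (Suc k)\<bar> * \<bar>m (j - k)\<bar> \<le> (cumC (Suc k) * (w (Suc k) / w 0)) * w (j - k)"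
          using IH m[of "j - k"] w c0 by (intro mult_mono) auto
        also have "\<dots> = cumC (Suc k) * (w (Suc k) * w (j - k)) / w 0" by simp
        also have "\<dots> \<le> cumC (Suc k) * (2 * w 0 * w (Suc k + (j - k))) / w 0"
          using w(2) w(4)[of "Suc k" "j - k"] c0 by (intro divide_right_mono mult_left_mono) auto
        also have "\<dots> = 2 * cumC (Suc k) * w (Suc j)" using k w by simp
        finally have "of_nat (j choose k) * (\<bar>cum m (Suc k)\<bar> * \<bar>m (j - k)\<bar>) \<le> of_nat (j choose k) * (2 * cumC (Suc k) * w (Suc j))"
          by (intro mult_left_mono) auto
        then show "\<bar>of_nat (j choose k) * cum m (Suc k) * m (j - k)\<bar> \<le> of_nat (j choose k) * (2 * cumC (Suc k)) * w (Suc j)"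
          by (simp add: abs_mult mult.assoc)
      qed
      then have "\<bar>m (Suc j) - (\<Sum>k<j. of_nat (j choose k) * cum m (Suc k) * m (j - k))\<bar> \<le> cumC (Suc j) * w (Suc j)"
        using m[of "Suc j"] by (simp add: cumC.simps(2)[of j] distrib_right sum_distrib_right)
      then show ?thesis
        using w by (simp add: Suc cum_Suc[of _ j] abs_divide divide_right_mono)
    qed simp
  qed
  moreover have "w i / w 0 * (w j / w 0) \<le> 2 * (w (i + j) / w 0)" for i j
    using w(2) w(4)[of i j] by (simp add: field_simps)
  ultimately show ?thesis using w by (auto simp: dominated_def)
qed

section \<open>Exponentially tilted moments\<close>

definition tilt :: "real \<Rightarrow> real \<Rightarrow> real \<Rightarrow> real" where
  "tilt s u x = exp (u * x - s * x\<^sup>2 / 2)"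

lemma tilt_pos: "tilt s u x > 0"
  by (simp add: tilt_def)

lemma tilt_0_0 [simp]: "tilt 0 0 x = 1"
  by (simp add: tilt_def)

text \<open>Completing the square. The bound is uniform in \<open>x\<close> and survives the limit
  of vanishing \<open>s\<close> as long as \<open>u^2 / s\<close> stays bounded.\<close>

lemma tilt_le:
  assumes "s > 0"
  shows "tilt s u x \<le> exp (u\<^sup>2 / (2 * s))"
proof -
  have "u * x - s * x\<^sup>2 / 2 = u\<^sup>2 / (2 * s) - (u - s * x)\<^sup>2 / (2 * s)"
    using assms by (simp add: power2_eq_square field_simps)
  also have "\<dots> \<le> u\<^sup>2 / (2 * s)" using assms by simp
  finally show ?thesis by (simp add: tilt_def)
qed

lemma tilt_measurable [measurable]: "tilt s u \<in> borel_measurable borel"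
  unfolding tilt_def by measurable

lemma abs_power_le_one_plus_square: "\<bar>x ^ k\<bar> \<le> (1 + (x::real)\<^sup>2) ^ k"
proof -
  have "\<bar>x\<bar> \<le> 1 + x\<^sup>2"
  proof -
    have "0 \<le> (\<bar>x\<bar> - 1)\<^sup>2 + \<bar>x\<bar>" by simp
    then show ?thesis by (simp add: power2_eq_square algebra_simps)
  qed
  then show ?thesis unfolding power_abs by (intro power_mono) auto
qed

locale all_moments = prob_space \<mu> for \<mu> :: "real measure" +
  assumes sets_mu [measurable_cong, simp]: "sets \<mu> = sets borel"
    and integrable_power: "integrable \<mu> (\<lambda>x. x ^ p)"
begin

lemma space_mu [simp]: "space \<mu> = UNIV"
  using sets_eq_imp_space_eq[OF sets_mu] by simp

lemma integrable_weight: "integrable \<mu> (\<lambda>x. (1 + x\<^sup>2) ^ p)"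
proof -
  have "(1 + x\<^sup>2) ^ p = (\<Sum>k\<le>p. of_nat (p choose k) * x ^ (2 * (p - k)))" for x :: real
    by (simp add: binomial_ring power_mult)
  then show ?thesis by (simp add: integrable_power)
qed

lemma integrable_bounded_by_weight:
  fixes f :: "real \<Rightarrow> 'b::{banach, second_countable_topology}"
  assumes "f \<in> borel_measurable borel" "\<And>x. norm (f x) \<le> C * (1 + x\<^sup>2) ^ p"
  shows "integrable \<mu> f"
proof (rule Bochner_Integration.integrable_bound[where f = "\<lambda>x. C * (1 + x\<^sup>2) ^ p"])
  show "AE x in \<mu>. norm (f x) \<le> norm (C * (1 + x\<^sup>2) ^ p)"
  proof (rule AE_I2)
    show "norm (f x) \<le> norm (C * (1 + x\<^sup>2) ^ p)" for x
      using order_trans[OF assms(2)[of x] abs_ge_self] by simp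
  qed
qed (use assms(1) in \<open>auto intro: integrable_weight\<close>)

lemma integrable_tilt:
  assumes "s > 0" "f \<in> borel_measurable borel" "\<And>x. \<bar>f x\<bar> \<le> C * (1 + x\<^sup>2) ^ p"
  shows "integrable \<mu> (\<lambda>x. f x * tilt s u x)"
proof (rule integrable_bounded_by_weight)
  fix x
  have "\<bar>f x\<bar> * \<bar>tilt s u x\<bar> \<le> (C * (1 + x\<^sup>2) ^ p) * exp (u\<^sup>2 / (2 * s))"
    using assms(3)[of x] tilt_le[OF assms(1), of u x] tilt_pos[of s u x] order_trans[OF _ assms(3)[of x]]
    by (intro mult_mono) auto
  then show "norm (f x * tilt s u x) \<le> (C * exp (u\<^sup>2 / (2 * s))) * (1 + x\<^sup>2) ^ p"
    by (simp add: abs_mult mult_ac)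
qed (use assms in measurable)

definition mom :: "nat \<Rightarrow> real \<Rightarrow> real \<Rightarrow> real" where
  "mom k s u = (\<integral>x. x ^ k * tilt s u x \<partial>\<mu>)"

text \<open>\<open>1 + x^2\<close> replaces the absolute value of \<open>x\<close>: it is at least 1
  and polynomial, so that \<open>wt\<close> is a combination of moments and inherits their
  continuity and limits.\<close>

definition wt :: "nat \<Rightarrow> real \<Rightarrow> real \<Rightarrow> real" where
  "wt p s u = (\<integral>x. (1 + x\<^sup>2) ^ p * tilt s u x \<partial>\<mu>)"

lemma integrable_mom: "s > 0 \<Longrightarrow> integrable \<mu> (\<lambda>x. x ^ k * tilt s u x)"
  by (rule integrable_tilt[where C = 1 and p = k]) (auto simp: abs_power_le_one_plus_square)

lemma integrable_wt: "s > 0 \<Longrightarrow> integrable \<mu> (\<lambda>x. (1 + x\<^sup>2) ^ p * tilt s u x)"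
  by (rule integrable_tilt[where C = 1 and p = p]) auto

lemma wt_eq_mom:
  assumes "s > 0 \<or> s = 0 \<and> u = 0"
  shows "wt p s u = (\<Sum>k\<le>p. of_nat (p choose k) * mom (2 * (p - k)) s u)"
proof -
  have "(1 + x\<^sup>2) ^ p * tilt s u x = (\<Sum>k\<le>p. of_nat (p choose k) * (x ^ (2 * (p - k)) * tilt s u x))" for x :: real
    by (simp add: binomial_ring power_mult sum_distrib_right mult.assoc)
  moreover have "integrable \<mu> (\<lambda>x. x ^ k * tilt s u x)" for k
    using assms integrable_mom integrable_power by auto
  ultimately show ?thesis by (simp add: wt_def mom_def)
qed

lemma mom_has_derivative_u:
  assumes "s > 0"
  shows "((\<lambda>u. mom k s u) has_real_derivative mom (Suc k) s u) (at u)"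
  unfolding mom_def has_real_derivative_iff_has_vector_derivative
proof (rule has_vector_derivative_integral_dominated[where e = 1 and
      D = "\<lambda>x. exp ((\<bar>u\<bar> + 1)\<^sup>2 / (2 * s)) * (1 + x\<^sup>2) ^ Suc k" and f' = "\<lambda>u x. x ^ Suc k * tilt s u x"])
  show "((\<lambda>u. x ^ k * tilt s u x) has_vector_derivative x ^ Suc k * tilt s t x) (at t)" for t x
    unfolding tilt_def has_real_derivative_iff_has_vector_derivative[symmetric]
    by (auto intro!: derivative_eq_intros)
  fix t x assume t: "\<bar>t - u\<bar> < 1"
  then have "\<bar>t\<bar> \<le> \<bar>u\<bar> + 1" by linarith
  then have "t\<^sup>2 \<le> (\<bar>u\<bar> + 1)\<^sup>2" using abs_le_square_iff[of t "\<bar>u\<bar> + 1"] by simp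
  then have "tilt s t x \<le> exp ((\<bar>u\<bar> + 1)\<^sup>2 / (2 * s))"
    using assms order_trans[OF tilt_le[OF assms]] by (simp add: divide_right_mono)
  then have "\<bar>x ^ Suc k\<bar> * \<bar>tilt s t x\<bar> \<le> (1 + x\<^sup>2) ^ Suc k * exp ((\<bar>u\<bar> + 1)\<^sup>2 / (2 * s))"
    using tilt_pos[of s t x] abs_power_le_one_plus_square[of x "Suc k"] by (intro mult_mono) auto
  then show "norm (x ^ Suc k * tilt s t x) \<le> exp ((\<bar>u\<bar> + 1)\<^sup>2 / (2 * s)) * (1 + x\<^sup>2) ^ Suc k"
    by (simp add: abs_mult mult_ac del: power_Suc)
qed (use assms in \<open>auto intro!: integrable_mom integrable_mult_right integrable_weight simp del: power_Suc\<close>)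

text \<open>Differentiating \<open>tilt\<close> in \<open>s\<close> brings down
  \<open>- x^2 / 2\<close>. Since raising the index twice is the second derivative in
  \<open>u\<close>, the moments solve a backward heat equation. The radius \<open>s / 2\<close>
  keeps the parameter at least \<open>s / 2\<close>, whence the factor
  \<open>exp (u^2 / s)\<close>.\<close>

lemma mom_has_derivative_s:
  assumes "s > 0"
  shows "((\<lambda>s. mom k s u) has_real_derivative - mom (Suc (Suc k)) s u / 2) (at s)"
proof -
  have "((\<lambda>s. mom k s u) has_vector_derivative (\<integral>x. - (x ^ Suc (Suc k) * tilt s u x) / 2 \<partial>\<mu>)) (at s)"
    unfolding mom_def
  proof (rule has_vector_derivative_integral_dominated[where e = "s / 2" and
      D = "\<lambda>x. exp (u\<^sup>2 / s) * (1 + x\<^sup>2) ^ Suc (Suc k)" and f' = "\<lambda>s x. - (x ^ Suc (Suc k) * tilt s u x) / 2"])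
    show "((\<lambda>s. x ^ k * tilt s u x) has_vector_derivative - (x ^ Suc (Suc k) * tilt t u x) / 2) (at t)" for t x
      unfolding tilt_def has_real_derivative_iff_has_vector_derivative[symmetric]
      by (auto intro!: derivative_eq_intros simp: power2_eq_square)
    fix t x assume t: "\<bar>t - s\<bar> < s / 2"
    then have "t \<ge> s / 2" unfolding abs_less_iff by (simp add: field_simps)
    then have t0: "t > 0" and "s \<le> 2 * t" using assms by auto
    then have "u\<^sup>2 / (2 * t) \<le> u\<^sup>2 / s" using assms by (intro divide_left_mono) auto
    then have "tilt t u x \<le> exp (u\<^sup>2 / s)"
      using order_trans[OF tilt_le[OF t0]] by simp
    then have "\<bar>x ^ Suc (Suc k)\<bar> * \<bar>tilt t u x\<bar> \<le> (1 + x\<^sup>2) ^ Suc (Suc k) * exp (u\<^sup>2 / s)"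
      using tilt_pos[of t u x] abs_power_le_one_plus_square[of x "Suc (Suc k)"] by (intro mult_mono) auto
    moreover have "\<bar>x ^ Suc (Suc k)\<bar> * \<bar>tilt t u x\<bar> \<ge> 0" by simp
    ultimately show "norm (- (x ^ Suc (Suc k) * tilt t u x) / 2) \<le> exp (u\<^sup>2 / s) * (1 + x\<^sup>2) ^ Suc (Suc k)"
      unfolding norm_divide norm_minus_cancel norm_mult real_norm_def mult.commute[of "exp _"]
      by linarith
  next
    fix t assume "\<bar>t - s\<bar> < s / 2"
    then have "t > 0" using assms unfolding abs_less_iff by (simp add: field_simps)
    then show "integrable \<mu> (\<lambda>x. x ^ k * tilt t u x)" by (rule integrable_mom)
  qed (use assms in \<open>auto intro!: integrable_mult_right integrable_weight simp del: power_Suc\<close>)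
  then show ?thesis
    by (simp add: mom_def has_real_derivative_iff_has_vector_derivative del: power_Suc)
qed

lemma integral_pos_of_pos:
  assumes "integrable \<mu> f" "\<And>x. f x > (0::real)"
  shows "(\<integral>x. f x \<partial>\<mu>) > 0"
proof (rule ccontr)
  assume "\<not> (\<integral>x. f x \<partial>\<mu>) > 0"
  moreover have "(\<integral>x. f x \<partial>\<mu>) \<ge> 0" using assms(2) by (simp add: less_imp_le)
  ultimately have "(\<integral>x. f x \<partial>\<mu>) = 0" by linarith
  then have "AE x in \<mu>. f x = 0"
    using integral_nonneg_eq_0_iff_AE[OF assms(1)] assms(2) by (simp add: less_imp_le)
  then have "AE x in \<mu>. False" using assms(2) by (auto simp: less_le)
  then show False by simp
qed

lemma mom_0_pos: "s > 0 \<Longrightarrow> mom 0 s u > 0"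
  unfolding mom_def by (rule integral_pos_of_pos[OF integrable_mom]) (auto simp: tilt_pos)

lemma wt_0: "wt 0 s u = mom 0 s u"
  by (simp add: wt_def mom_def)

lemma mom_0_0: "mom k 0 0 = (\<integral>x. x ^ k \<partial>\<mu>)" "mom 0 0 0 = 1"
  using prob_space by (simp_all add: mom_def)

lemma wt_nonneg: "wt p s u \<ge> 0"
  unfolding wt_def by (intro Bochner_Integration.integral_nonneg) (simp add: less_imp_le[OF tilt_pos])

lemma abs_mom_le_wt:
  assumes "s > 0"
  shows "\<bar>mom k s u\<bar> \<le> wt k s u"
proof -
  have "\<bar>mom k s u\<bar> \<le> (\<integral>x. \<bar>x ^ k * tilt s u x\<bar> \<partial>\<mu>)"
    unfolding mom_def by (rule integral_abs_bound)
  also have "\<dots> \<le> wt k s u"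
    unfolding wt_def
  proof (rule integral_mono)
    show "\<bar>x ^ k * tilt s u x\<bar> \<le> (1 + x\<^sup>2) ^ k * tilt s u x" for x
      unfolding abs_mult abs_of_pos[OF tilt_pos]
      by (intro mult_right_mono abs_power_le_one_plus_square less_imp_le[OF tilt_pos])
  qed (intro integrable_abs integrable_mom integrable_wt assms)+
  finally show ?thesis .
qed

lemma mom_0_le_wt:
  assumes "s > 0"
  shows "mom 0 s u \<le> wt p s u"
  unfolding mom_def wt_def
proof (rule integral_mono)
  show "x ^ 0 * tilt s u x \<le> (1 + x\<^sup>2) ^ p * tilt s u x" for x
    by (intro mult_right_mono less_imp_le[OF tilt_pos]) simp
qed (intro integrable_mom integrable_wt assms)+

text \<open>For two independent copies, \<open>a ^ i * b ^ j\<close> is at most the power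
  \<open>i + j\<close> of the larger number, hence at most \<open>a ^ (i + j) + b ^ (i + j)\<close>.
  Integrating over both copies gives the factor 2.\<close>

lemma wt_mult_le:
  assumes "s > 0"
  shows "wt i s u * wt j s u \<le> 2 * wt 0 s u * wt (i + j) s u"
proof -
  let ?w = "\<lambda>x::real. 1 + x\<^sup>2"
  have pt: "a ^ i * b ^ j \<le> a ^ (i + j) + b ^ (i + j)" if "a \<ge> 0" "b \<ge> 0" for a b :: real
  proof (cases "a \<le> b")
    case True
    then have "a ^ i * b ^ j \<le> b ^ i * b ^ j" using that by (intro mult_right_mono power_mono) auto
    also have "\<dots> \<le> a ^ (i + j) + b ^ (i + j)" using that by (simp add: power_add)
    finally show ?thesis .
  next
    case False
    then have "a ^ i * b ^ j \<le> a ^ i * a ^ j" using that by (intro mult_left_mono power_mono) auto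
    also have "\<dots> \<le> a ^ (i + j) + b ^ (i + j)" using that by (simp add: power_add)
    finally show ?thesis .
  qed
  have 1: "wt i s u * b ^ j \<le> wt (i + j) s u + b ^ (i + j) * wt 0 s u" if b: "b \<ge> 0" for b
  proof -
    have "(\<integral>x. (?w x ^ i * tilt s u x) * b ^ j \<partial>\<mu>) \<le>
        (\<integral>x. ?w x ^ (i + j) * tilt s u x + b ^ (i + j) * (?w x ^ 0 * tilt s u x) \<partial>\<mu>)"
    proof (rule integral_mono)
      fix x
      have "(?w x ^ i * b ^ j) * tilt s u x \<le> (?w x ^ (i + j) + b ^ (i + j)) * tilt s u x"
        using pt[of "?w x" b] b tilt_pos[of s u x] by (intro mult_right_mono) auto
      then show "(?w x ^ i * tilt s u x) * b ^ j \<le> ?w x ^ (i + j) * tilt s u x + b ^ (i + j) * (?w x ^ 0 * tilt s u x)"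
        by (simp add: algebra_simps)
    qed (intro Bochner_Integration.integrable_add integrable_mult_left integrable_mult_right integrable_wt assms)+
    then show ?thesis
      using integrable_wt[OF assms, of "i + j" u] integrable_wt[OF assms, of 0 u]
      by (simp add: wt_def)
  qed
  have "(\<integral>y. wt i s u * (?w y ^ j * tilt s u y) \<partial>\<mu>) \<le>
      (\<integral>y. wt (i + j) s u * (?w y ^ 0 * tilt s u y) + wt 0 s u * (?w y ^ (i + j) * tilt s u y) \<partial>\<mu>)"
  proof (rule integral_mono)
    fix y
    have "(wt i s u * ?w y ^ j) * tilt s u y \<le> (wt (i + j) s u + ?w y ^ (i + j) * wt 0 s u) * tilt s u y"
      using 1[of "?w y"] tilt_pos[of s u y] by (intro mult_right_mono) auto
    then show "wt i s u * (?w y ^ j * tilt s u y) \<le>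
       wt (i + j) s u * (?w y ^ 0 * tilt s u y) + wt 0 s u * (?w y ^ (i + j) * tilt s u y)"
      by (simp add: algebra_simps)
  qed (intro Bochner_Integration.integrable_add integrable_mult_left integrable_mult_right integrable_wt assms)+
  then show ?thesis
    using integrable_wt[OF assms, of 0 u] integrable_wt[OF assms, of "i + j" u]
    by (simp add: wt_def)
qed

text \<open>The tilted moments are not normalised, but \<open>cum\<close> is unchanged when a moment
  sequence is multiplied by a nonzero constant, so these are the cumulants of the tilted probability
  law. At \<open>s = u = 0\<close> they are those of \<open>\<mu>\<close>.\<close>

definition kap :: "real \<Rightarrow> real \<Rightarrow> nat \<Rightarrow> real" where
  "kap s u = cum (\<lambda>k. mom k s u)"

lemma dominated_kap:
  assumes "s > 0"
  shows "dominated cumC (kap s u) (\<lambda>p. wt p s u / mom 0 s u)"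
  unfolding kap_def wt_0[symmetric]
  by (rule dominated_cum) (use assms mom_0_pos in \<open>auto simp: wt_nonneg abs_mom_le_wt wt_mult_le wt_mult_le[unfolded wt_0] wt_0\<close>)

lemma kap_has_derivative_u:
  assumes "s > 0" "i > 0"
  shows "((\<lambda>u. kap s u i) has_real_derivative kap s u (Suc i)) (at u)"
  using has_vector_derivative_cum_shift[of "\<lambda>k u. mom k s u" u "i - 1"] mom_has_derivative_u[OF assms(1)]
    mom_0_pos[OF assms(1), of u] assms(2)
  by (auto simp: kap_def has_real_derivative_iff_has_vector_derivative)

lemma kap_has_derivative_s:
  assumes "s > 0" "i > 0"
  shows "((\<lambda>s. kap s u i) has_real_derivative cum_drift (kap s u) i) (at s)"
  using has_vector_derivative_cum_heat[of "\<lambda>k s. mom k s u" s "i - 1"] mom_has_derivative_s[OF assms(1)]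
    mom_0_pos[OF assms(1), of u] assms(2)
  by (auto simp: kap_def has_real_derivative_iff_has_vector_derivative)

end

section \<open>The heat flow\<close>

definition gauss :: "real \<Rightarrow> real \<Rightarrow> real" where
  "gauss s u = exp (- u\<^sup>2 / (2 * s)) / sqrt (2 * pi * s)"

lemma gauss_pos: "s > 0 \<Longrightarrow> gauss s u > 0"
  by (simp add: gauss_def)

lemma gauss_has_derivative_u:
  assumes "s > 0"
  shows "((\<lambda>u. gauss s u) has_real_derivative - (u / s) * gauss s u) (at u)"
  unfolding gauss_def using assms
  by (auto intro!: derivative_eq_intros simp: field_simps)

lemma gauss_has_derivative_s:
  assumes "s > 0"
  shows "((\<lambda>s. gauss s u) has_real_derivative (u\<^sup>2 / (2 * s\<^sup>2) - 1 / (2 * s)) * gauss s u) (at s)"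
proof -
  have 1: "((\<lambda>s. exp (- u\<^sup>2 / (2 * s))) has_real_derivative u\<^sup>2 / (2 * s\<^sup>2) * exp (- u\<^sup>2 / (2 * s))) (at s)"
    using assms by (auto intro!: derivative_eq_intros simp: field_simps power2_eq_square)
  have 2: "((\<lambda>s. sqrt (2 * pi * s)) has_real_derivative sqrt (2 * pi * s) / (2 * s)) (at s)"
  proof -
    have "((\<lambda>s. sqrt (2 * pi * s)) has_real_derivative inverse (sqrt (2 * pi * s)) / 2 * (2 * pi)) (at s)"
      using assms by (auto intro!: derivative_eq_intros simp: mult_less_0_iff)
    moreover have "inverse (sqrt (2 * pi * s)) / 2 * (2 * pi) = sqrt (2 * pi * s) / (2 * s)"
    proof -
      have "sqrt (2 * pi * s) * sqrt (2 * pi * s) = 2 * pi * s"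
        using assms by (intro real_sqrt_mult_self[THEN trans]) simp
      then show ?thesis using assms by (simp add: field_simps del: real_sqrt_mult_self)
    qed
    ultimately show ?thesis by simp
  qed
  show ?thesis
    unfolding gauss_def using assms
    by (auto intro!: derivative_eq_intros 1 2 simp: field_simps power2_eq_square mult_less_0_iff)
qed

text \<open>The product is the normal density with mean \<open>s * x\<close> and variance
  \<open>s\<close>, that is, the density of the rescaled observation given
  \<open>X = x\<close>.\<close>

lemma gauss_mult_tilt:
  assumes "s > 0"
  shows "gauss s u * tilt s u x = exp (- (u - s * x)\<^sup>2 / (2 * s)) / sqrt (2 * pi * s)"
  using assms unfolding gauss_def tilt_def
  by (simp add: exp_add[symmetric]) (simp add: power2_eq_square field_simps)

text \<open>With \<open>v = u - s * x\<close>, Peetre's inequality splits \<open>1 + u^2\<close>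
  into a factor in \<open>v\<close>, absorbed by the Gaussian, and one in \<open>x\<close>, absorbed
  by the moments. The square pays once for the \<open>u^2\<close> in the \<open>s\<close>-derivative
  of \<open>gauss\<close> and once for integrability in \<open>u\<close>; uniformity on
  \<open>[a, b]\<close> permits differentiation in \<open>s\<close>.\<close>

lemma gauss_tilt_decay:
  assumes "0 < a" "a \<le> s" "s \<le> b"
  shows "gauss s u * tilt s u x * (1 + u\<^sup>2)\<^sup>2
    \<le> 4 * (max 1 (4 * b))\<^sup>2 * (max 1 (b\<^sup>2))\<^sup>2 / sqrt (2 * pi * a) * (1 + x\<^sup>2)\<^sup>2"
proof -
  have s: "s > 0" "b > 0" using assms by auto
  define v where "v = u - s * x"
  have "1 + u\<^sup>2 = 1 + (v + s * x)\<^sup>2" by (simp add: v_def)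
  also have "\<dots> \<le> 2 * (1 + v\<^sup>2) * (1 + (s * x)\<^sup>2)" by (rule one_plus_square_add_le)
  also have "\<dots> \<le> 2 * (1 + v\<^sup>2) * (max 1 (b\<^sup>2) * (1 + x\<^sup>2))"
  proof (intro mult_left_mono)
    have "(s * x)\<^sup>2 \<le> max 1 (b\<^sup>2) * x\<^sup>2"
      unfolding power_mult_distrib using assms
      by (intro mult_right_mono) (auto intro: order_trans[OF power_mono[of s b 2]])
    then show "1 + (s * x)\<^sup>2 \<le> max 1 (b\<^sup>2) * (1 + x\<^sup>2)" by (simp add: distrib_left)
  qed simp
  finally have "(1 + u\<^sup>2)\<^sup>2 \<le> (2 * (1 + v\<^sup>2) * (max 1 (b\<^sup>2) * (1 + x\<^sup>2)))\<^sup>2"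
    by (intro power_mono) auto
  then have u: "(1 + u\<^sup>2)\<^sup>2 \<le> 4 * (1 + v\<^sup>2)\<^sup>2 * ((max 1 (b\<^sup>2))\<^sup>2 * (1 + x\<^sup>2)\<^sup>2)"
    by (simp only: power_mult_distrib) simp
  have "exp (- v\<^sup>2 / (2 * s)) \<le> exp (- v\<^sup>2 / (2 * b))"
    using assms s by (simp add: frac_le)
  then have "exp (- v\<^sup>2 / (2 * s)) * (1 + u\<^sup>2)\<^sup>2 \<le> exp (- v\<^sup>2 / (2 * b)) * (4 * (1 + v\<^sup>2)\<^sup>2 * ((max 1 (b\<^sup>2))\<^sup>2 * (1 + x\<^sup>2)\<^sup>2))"
    using u by (intro mult_mono) auto
  also have "\<dots> = ((1 + v\<^sup>2)\<^sup>2 * exp (- v\<^sup>2 / (2 * b))) * (4 * (max 1 (b\<^sup>2))\<^sup>2 * (1 + x\<^sup>2)\<^sup>2)" by simp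
  also have "\<dots> \<le> (max 1 (4 * b))\<^sup>2 * (4 * (max 1 (b\<^sup>2))\<^sup>2 * (1 + x\<^sup>2)\<^sup>2)"
    by (intro mult_right_mono one_plus_square_exp_le s) auto
  finally have 1: "exp (- v\<^sup>2 / (2 * s)) * (1 + u\<^sup>2)\<^sup>2 \<le> (max 1 (4 * b))\<^sup>2 * (4 * (max 1 (b\<^sup>2))\<^sup>2 * (1 + x\<^sup>2)\<^sup>2)" .
  have "exp (- v\<^sup>2 / (2 * s)) * (1 + u\<^sup>2)\<^sup>2 / sqrt (2 * pi * s)
     \<le> (max 1 (4 * b))\<^sup>2 * (4 * (max 1 (b\<^sup>2))\<^sup>2 * (1 + x\<^sup>2)\<^sup>2) / sqrt (2 * pi * a)"
    using 1 assms s by (intro frac_le) auto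
  then show ?thesis
    unfolding gauss_mult_tilt[OF s(1)] v_def[symmetric] by (simp add: mult_ac)
qed

lemma continuous_on_monoval:
  fixes K :: "nat \<Rightarrow> 'b::topological_space \<Rightarrow> real"
  assumes "\<And>i. continuous_on S (K i)"
  shows "continuous_on S (\<lambda>u. monoval (\<lambda>i. K i u) xs)" "continuous_on S (\<lambda>u. shift1 (\<lambda>i. K i u) xs)"
    "continuous_on S (\<lambda>u. shift2 (\<lambda>i. K i u) xs)" "continuous_on S (\<lambda>u. Lval (\<lambda>i. K i u) xs)"
    "continuous_on S (\<lambda>u. Hval (\<lambda>i. K i u) xs)"
proof -
  show 1: "continuous_on S (\<lambda>u. monoval (\<lambda>i. K i u) xs)" for xs
    by (induction xs) (auto intro!: continuous_intros assms)
  show 2: "continuous_on S (\<lambda>u. shift1 (\<lambda>i. K i u) xs)" for xs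
    by (induction xs) (auto intro!: continuous_intros assms 1)
  show "continuous_on S (\<lambda>u. shift2 (\<lambda>i. K i u) xs)"
    by (induction xs) (auto intro!: continuous_intros assms 1)
  show "continuous_on S (\<lambda>u. Lval (\<lambda>i. K i u) xs)"
    by (induction xs) (auto intro!: continuous_intros assms 2)
  show "continuous_on S (\<lambda>u. Hval (\<lambda>i. K i u) xs)"
    by (induction xs) (auto simp: splitval_def intro!: continuous_intros assms 1)
qed

section \<open>Density of the rescaled observation and averages against it\<close>

context all_moments
begin

text \<open>The density of \<open>sqrt s * Y_s\<close>, from integrating the conditional normal
  density over \<open>\<mu>\<close>.\<close>

definition dens :: "real \<Rightarrow> real \<Rightarrow> real" where
  "dens s u = gauss s u * mom 0 s u"

text \<open>An integral over \<open>u\<close> rather than over the probability space, so that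
  \<open>s\<close> enters only through smooth functions of \<open>s\<close> and
  \<open>u\<close>.\<close>

definition expect :: "real \<Rightarrow> ((nat \<Rightarrow> real) \<Rightarrow> real) \<Rightarrow> real" where
  "expect s F = (\<integral>u. dens s u * F (kap s u) \<partial>lborel)"

lemma dens_pos: "s > 0 \<Longrightarrow> dens s u > 0"
  by (simp add: dens_def gauss_pos mom_0_pos)

lemma gauss_wt_decay:
  assumes "0 < a"
  obtains C where "C \<ge> 0" "\<And>s u. a \<le> s \<Longrightarrow> s \<le> b \<Longrightarrow> gauss s u * wt p s u * (1 + u\<^sup>2)\<^sup>2 \<le> C"
proof
  define C0 where "C0 = 4 * (max 1 (4 * b))\<^sup>2 * (max 1 (b\<^sup>2))\<^sup>2 / sqrt (2 * pi * a)"
  have C0: "C0 \<ge> 0" using assms by (simp add: C0_def)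
  show "C0 * (\<integral>x. (1 + x\<^sup>2) ^ (p + 2) \<partial>\<mu>) \<ge> 0" using C0 by simp
  fix s u assume s: "a \<le> s" "s \<le> b"
  then have s0: "s > 0" using assms by simp
  have "gauss s u * wt p s u * (1 + u\<^sup>2)\<^sup>2 = (\<integral>x. (gauss s u * (1 + u\<^sup>2)\<^sup>2) * ((1 + x\<^sup>2) ^ p * tilt s u x) \<partial>\<mu>)"
    by (simp add: wt_def)
  also have "\<dots> \<le> (\<integral>x. C0 * (1 + x\<^sup>2) ^ (p + 2) \<partial>\<mu>)"
  proof (rule integral_mono)
    fix x
    have "(gauss s u * tilt s u x * (1 + u\<^sup>2)\<^sup>2) * (1 + x\<^sup>2) ^ p \<le> (C0 * (1 + x\<^sup>2)\<^sup>2) * (1 + x\<^sup>2) ^ p"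
      unfolding C0_def using gauss_tilt_decay[OF assms s, of u x] by (intro mult_right_mono) auto
    then show "(gauss s u * (1 + u\<^sup>2)\<^sup>2) * ((1 + x\<^sup>2) ^ p * tilt s u x) \<le> C0 * (1 + x\<^sup>2) ^ (p + 2)"
      by (simp add: power_add mult_ac del: power2_eq_square power_Suc add_2_eq_Suc')
  qed (intro integrable_mult_right integrable_weight integrable_wt s0)+
  finally show "gauss s u * wt p s u * (1 + u\<^sup>2)\<^sup>2 \<le> C0 * (\<integral>x. (1 + x\<^sup>2) ^ (p + 2) \<partial>\<mu>)" by simp
qed

text \<open>The bound for \<open>F\<close> has \<open>mom 0\<close> in its denominator, which
  cancels against the factor \<open>mom 0\<close> of \<open>dens\<close>. What remains is
  \<open>gauss * wt p\<close>, so the estimate never involves a lower bound for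
  \<open>mom 0\<close>.\<close>

lemma dens_decay:
  assumes "0 < a" "bdd cumC p F"
  obtains C where "C \<ge> 0" "\<And>s u. a \<le> s \<Longrightarrow> s \<le> b \<Longrightarrow> \<bar>dens s u * F (kap s u)\<bar> * (1 + u\<^sup>2)\<^sup>2 \<le> C"
proof -
  obtain B where B: "B \<ge> 0" "\<And>K A. dominated cumC K A \<Longrightarrow> \<bar>F K\<bar> \<le> B * A p"
    using assms(2) by (auto simp: bdd_def)
  obtain C where C: "C \<ge> 0" "\<And>s u. a \<le> s \<Longrightarrow> s \<le> b \<Longrightarrow> gauss s u * wt p s u * (1 + u\<^sup>2)\<^sup>2 \<le> C"
    using gauss_wt_decay[OF assms(1)] by blast
  show ?thesis
  proof (rule that[of "B * C"])
    fix s u assume s: "a \<le> s" "s \<le> b"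
    then have s0: "s > 0" using assms(1) by simp
    have "\<bar>dens s u * F (kap s u)\<bar> * (1 + u\<^sup>2)\<^sup>2 = (dens s u * (1 + u\<^sup>2)\<^sup>2) * \<bar>F (kap s u)\<bar>"
      using dens_pos[OF s0, of u] by (simp add: abs_mult)
    also have "\<dots> \<le> (dens s u * (1 + u\<^sup>2)\<^sup>2) * (B * (wt p s u / mom 0 s u))"
      using dens_pos[OF s0, of u] by (intro mult_left_mono B(2) dominated_kap s0) auto
    also have "\<dots> = B * (gauss s u * wt p s u * (1 + u\<^sup>2)\<^sup>2)"
      using mom_0_pos[OF s0, of u] by (simp add: dens_def)
    also have "\<dots> \<le> B * C" using B(1) C(2)[OF s] by (intro mult_left_mono)
    finally show "\<bar>dens s u * F (kap s u)\<bar> * (1 + u\<^sup>2)\<^sup>2 \<le> B * C" .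
  qed (use B C in simp)
qed

lemma continuous_mom: "s > 0 \<Longrightarrow> continuous_on UNIV (\<lambda>u. mom k s u)"
  by (meson DERIV_continuous_on has_field_derivative_at_within mom_has_derivative_u)

lemma continuous_kap:
  assumes "s > 0"
  shows "continuous_on UNIV (\<lambda>u. kap s u i)"
proof (cases "i = 0")
  case True
  then show ?thesis by (simp add: kap_def)
next
  case False
  show ?thesis
    by (rule DERIV_continuous_on[OF has_field_derivative_at_within[OF kap_has_derivative_u[OF assms]]])
      (use False in simp)
qed

lemma continuous_dens: "s > 0 \<Longrightarrow> continuous_on UNIV (\<lambda>u. dens s u)"
  unfolding dens_def gauss_def by (intro continuous_intros continuous_mom) auto

lemma continuous_wt: "s > 0 \<Longrightarrow> continuous_on UNIV (\<lambda>u. wt p s u)"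
  by (simp add: wt_eq_mom) (intro continuous_intros continuous_mom)

lemma integrable_dens:
  assumes "s > 0" "bdd cumC p F" "continuous_on UNIV (\<lambda>u. F (kap s u))"
  shows "integrable lborel (\<lambda>u. dens s u * F (kap s u))"
proof -
  obtain C where C: "C \<ge> 0" "\<And>t u. s \<le> t \<Longrightarrow> t \<le> s \<Longrightarrow> \<bar>dens t u * F (kap t u)\<bar> * (1 + u\<^sup>2)\<^sup>2 \<le> C"
    using dens_decay[OF assms(1,2), where b = s] by blast
  have "integrable lborel (\<lambda>u::real. C * (1 / (1 + u\<^sup>2)))"
    by (intro integrable_mult_right integrable_inverse_one_plus_square)
  then show ?thesis
  proof (rule Bochner_Integration.integrable_bound)
    have "continuous_on UNIV (\<lambda>u. dens s u * F (kap s u))"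
      by (intro continuous_intros continuous_dens assms)
    then show "(\<lambda>u. dens s u * F (kap s u)) \<in> borel_measurable lborel"
      by (simp add: borel_measurable_continuous_onI)
    show "AE u in lborel. norm (dens s u * F (kap s u)) \<le> norm (C * (1 / (1 + u\<^sup>2)))"
    proof (rule AE_I2)
      fix u
      have "\<bar>dens s u * F (kap s u)\<bar> * (1 + u\<^sup>2) \<le> \<bar>dens s u * F (kap s u)\<bar> * (1 + u\<^sup>2)\<^sup>2"
        by (intro mult_left_mono self_le_power) auto
      then have "\<bar>dens s u * F (kap s u)\<bar> * (1 + u\<^sup>2) \<le> C" using C(2)[of s u] by simp
      moreover have "1 + u\<^sup>2 > 0" by (simp add: add_pos_nonneg)
      ultimately show "norm (dens s u * F (kap s u)) \<le> norm (C * (1 / (1 + u\<^sup>2)))"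
        using C(1) by (simp add: field_simps)
    qed
  qed
qed

lemma mom_1: "s > 0 \<Longrightarrow> mom (Suc 0) s u = kap s u 1 * mom 0 s u"
  using moment_Suc_eq_cum[of "\<lambda>k. mom k s u" 0] mom_0_pos[of s u] by (simp add: kap_def)

lemma mom_2: "s > 0 \<Longrightarrow> mom (Suc (Suc 0)) s u = (kap s u 2 + (kap s u 1)\<^sup>2) * mom 0 s u"
  using moment_Suc_eq_cum[of "\<lambda>k. mom k s u" 1] mom_0_pos[of s u] mom_1[of s u]
  by (simp add: kap_def numeral_2_eq_2 power2_eq_square algebra_simps)

lemma dens_has_derivative_u:
  assumes "s > 0"
  shows "((\<lambda>u. dens s u) has_real_derivative dens s u * (kap s u 1 - u / s)) (at u)"
  unfolding dens_def using assms mom_1[OF assms, of u]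
  by (auto intro!: derivative_eq_intros gauss_has_derivative_u mom_has_derivative_u simp: algebra_simps)

lemma dens_has_derivative_s:
  assumes "s > 0"
  shows "((\<lambda>s. dens s u) has_real_derivative
     dens s u * (u\<^sup>2 / (2 * s\<^sup>2) - 1 / (2 * s) - (kap s u 2 + (kap s u 1)\<^sup>2) / 2)) (at s)"
  unfolding dens_def using assms mom_2[OF assms, of u]
  by (auto intro!: derivative_eq_intros gauss_has_derivative_s mom_has_derivative_s simp: field_simps)

text \<open>Let \<open>g\<close> be \<open>gauss\<close> and \<open>W = mom 0 * P\<close>. Then
  \<open>\<partial>\<^sub>s g = g'' / 2\<close>, while
  \<open>\<partial>\<^sub>s W = - W'' / 2 + mom 0 * (Lval + Hval)\<close>: the \<open>shift2\<close>
  term and all terms with \<open>K 1\<close> are those of \<open>- W'' / 2\<close>, and its mixed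
  second derivatives leave \<open>Lval\<close>. So \<open>\<partial>\<^sub>s (g W)\<close> is
  \<open>dens * (Lval + Hval)\<close> plus a derivative in \<open>u\<close>. Index 0 is excluded
  because \<open>kap s u 0\<close> is a junk value that does not obey the evolution laws.\<close>

lemma expect_has_derivative:
  assumes s: "s > 0" and xs: "0 \<notin> set xs"
  shows "((\<lambda>s. expect s (\<lambda>K. monoval K xs)) has_real_derivative
      expect s (\<lambda>K. Lval K xs + Hval K xs)) (at s)"
proof -
  define p where "p = sum_list xs"
  define P where "P K = monoval K xs" for K :: "nat \<Rightarrow> real"
  define D where "D K = shift1 K xs" for K :: "nat \<Rightarrow> real"
  \<comment> \<open>\<open>G\<close> is \<open>\<partial>\<^sub>s (mom 0 * P) / mom 0\<close>; its
    first summand comes from \<open>mom 0\<close>. The coefficient in \<open>f'\<close> below is the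
    logarithmic derivative of \<open>gauss\<close>.\<close>
  define G where "G K = - (K 2 * P K + K 1 * (K 1 * P K)) / 2 + (- shift2 K xs / 2 - K 1 * D K + Hval K xs)"
    for K :: "nat \<Rightarrow> real"
  define LH where "LH K = Lval K xs + Hval K xs" for K :: "nat \<Rightarrow> real"
  define f' where "f' t u = (u\<^sup>2 / (2 * t\<^sup>2) - 1 / (2 * t)) * (dens t u * P (kap t u)) + dens t u * G (kap t u)" for t u
  have bP: "bdd cumC p P" unfolding P_def[abs_def] p_def by (rule bdd_monoval)
  have bD: "bdd cumC (Suc p) D" unfolding D_def[abs_def] p_def by (rule bdd_shift1)
  have bKP: "bdd cumC (Suc p) (\<lambda>K. K 1 * P K)" using bdd_mult[OF bdd_var[of _ 1] bP] by simp
  have bG: "bdd cumC (Suc (Suc p)) G"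
  proof -
    have "bdd cumC (Suc (Suc p)) (\<lambda>K. (- 1 / 2) * (K 2 * P K + K 1 * (K 1 * P K)) +
       ((- 1 / 2) * shift2 K xs + ((- 1) * (K 1 * D K) + Hval K xs)))"
      using bdd_mult[OF bdd_var[of _ 2] bP] bdd_mult[OF bdd_var[of _ 1] bKP] bdd_mult[OF bdd_var[of _ 1] bD]
      by (intro bdd_add bdd_cmult[of _ _ _ "- 1 / 2"] bdd_cmult[of _ _ _ "- 1"])
        (auto simp: p_def bdd_shift2 bdd_Hval)
    moreover have "G = (\<lambda>K. (- 1 / 2) * (K 2 * P K + K 1 * (K 1 * P K)) +
       ((- 1 / 2) * shift2 K xs + ((- 1) * (K 1 * D K) + Hval K xs)))"
      by (auto simp: G_def fun_eq_iff field_simps)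
    ultimately show ?thesis by simp
  qed
  have bLH: "bdd cumC (Suc (Suc p)) LH"
    unfolding LH_def[abs_def] p_def by (intro bdd_add bdd_Lval bdd_Hval)
  have cP: "continuous_on UNIV (\<lambda>u. P (kap t u))" and cD: "continuous_on UNIV (\<lambda>u. D (kap t u))"
    and cG: "continuous_on UNIV (\<lambda>u. G (kap t u))" and cLH: "continuous_on UNIV (\<lambda>u. LH (kap t u))"
    if "t > 0" for t
    unfolding P_def D_def G_def LH_def
    by (intro continuous_intros continuous_on_monoval[where K = "\<lambda>i u. kap t u i"] continuous_kap that; simp)+
  have cf': "continuous_on UNIV (f' s)"
    unfolding f'_def using s by (intro continuous_intros continuous_dens cP cG) auto
  obtain CP where CP: "CP \<ge> 0" "\<And>t u. s / 2 \<le> t \<Longrightarrow> t \<le> 2 * s \<Longrightarrow> \<bar>dens t u * P (kap t u)\<bar> * (1 + u\<^sup>2)\<^sup>2 \<le> CP"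
    using dens_decay[OF _ bP, where a = "s / 2" and b = "2 * s"] s by auto
  obtain CG where CG: "CG \<ge> 0" "\<And>t u. s / 2 \<le> t \<Longrightarrow> t \<le> 2 * s \<Longrightarrow> \<bar>dens t u * G (kap t u)\<bar> * (1 + u\<^sup>2)\<^sup>2 \<le> CG"
    using dens_decay[OF _ bG, where a = "s / 2" and b = "2 * s"] s by auto
  \<comment> \<open>For \<open>t \<ge> s / 2\<close> the coefficient
    \<open>u^2 / (2 t^2) + 1 / (2 t)\<close> is at most \<open>c * (1 + u^2)\<close>.\<close>
  define c where "c = 2 / s\<^sup>2 + 1 / s"
  have f'_bound: "norm (f' t u) \<le> (c * CP + CG) * (1 / (1 + u\<^sup>2))" if t: "\<bar>t - s\<bar> < s / 2" for t u
  proof -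
    have t': "s / 2 \<le> t" "t \<le> 2 * s" using t s unfolding abs_less_iff by (auto simp: field_simps)
    then have t0: "t > 0" using s by simp
    have u1: "1 + u\<^sup>2 > 0" by (simp add: add_pos_nonneg)
    have "\<bar>u\<^sup>2 / (2 * t\<^sup>2) - 1 / (2 * t)\<bar> \<le> u\<^sup>2 / (2 * t\<^sup>2) + 1 / (2 * t)"
      using t0 by (intro abs_triangle_ineq4[THEN order_trans]) simp
    also have "\<dots> \<le> u\<^sup>2 * (2 / s\<^sup>2) + 1 / s"
    proof (rule add_mono)
      have "(s / 2)\<^sup>2 \<le> t\<^sup>2" using t' s by (intro power_mono) auto
      then have "s\<^sup>2 \<le> 4 * t\<^sup>2" by (simp add: power_divide)
      then have "1 / (2 * t\<^sup>2) \<le> 2 / s\<^sup>2" using s t0 by (simp add: field_simps)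
      from mult_left_mono[OF this, of "u\<^sup>2"] show "u\<^sup>2 / (2 * t\<^sup>2) \<le> u\<^sup>2 * (2 / s\<^sup>2)" by simp
      show "1 / (2 * t) \<le> 1 / s" using t' s by (intro divide_left_mono) auto
    qed
    also have "\<dots> \<le> c * (1 + u\<^sup>2)" using s by (simp add: c_def algebra_simps add_divide_distrib)
    finally have 1: "\<bar>u\<^sup>2 / (2 * t\<^sup>2) - 1 / (2 * t)\<bar> \<le> c * (1 + u\<^sup>2)" .
    have c0: "c \<ge> 0" using s by (simp add: c_def)
    have "norm (f' t u) * (1 + u\<^sup>2) \<le> (\<bar>u\<^sup>2 / (2 * t\<^sup>2) - 1 / (2 * t)\<bar> * \<bar>dens t u * P (kap t u)\<bar> + \<bar>dens t u * G (kap t u)\<bar>) * (1 + u\<^sup>2)"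
      unfolding f'_def real_norm_def using u1
      by (intro mult_right_mono) (auto intro: order_trans[OF abs_triangle_ineq] simp: abs_mult)
    also have "\<dots> \<le> (c * (1 + u\<^sup>2) * \<bar>dens t u * P (kap t u)\<bar> + \<bar>dens t u * G (kap t u)\<bar>) * (1 + u\<^sup>2)"
      using 1 u1 by (intro mult_right_mono add_right_mono) auto
    also have "\<dots> = c * (\<bar>dens t u * P (kap t u)\<bar> * (1 + u\<^sup>2)\<^sup>2) + \<bar>dens t u * G (kap t u)\<bar> * (1 + u\<^sup>2)"
      by (simp add: power2_eq_square algebra_simps)
    also have "\<dots> \<le> c * CP + \<bar>dens t u * G (kap t u)\<bar> * (1 + u\<^sup>2)\<^sup>2"
      using CP(2)[OF t', of u] c0 by (intro add_mono mult_left_mono self_le_power) auto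
    also have "\<dots> \<le> c * CP + CG" using CG(2)[OF t', of u] by simp
    finally show ?thesis using u1 by (simp add: field_simps)
  qed
  have int_inv: "integrable lborel (\<lambda>u::real. (c * CP + CG) * (1 / (1 + u\<^sup>2)))"
    by (intro integrable_mult_right integrable_inverse_one_plus_square)
  have mf': "f' s \<in> borel_measurable lborel"
    using cf' by (simp add: borel_measurable_continuous_onI)
  have int_f': "integrable lborel (f' s)"
  proof (rule Bochner_Integration.integrable_bound[OF int_inv mf'], rule AE_I2)
    show "norm (f' s u) \<le> norm ((c * CP + CG) * (1 / (1 + u\<^sup>2)))" for u
      using order_trans[OF f'_bound[of s u] abs_ge_self] s by simp
  qed
  have "((\<lambda>t. \<integral>u. dens t u * P (kap t u) \<partial>lborel) has_vector_derivative (\<integral>u. f' s u \<partial>lborel)) (at s)"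
  proof (rule has_vector_derivative_integral_dominated[where e = "s / 2" and f' = f'
        and D = "\<lambda>u. (c * CP + CG) * (1 / (1 + u\<^sup>2))"])
    fix t assume "\<bar>t - s\<bar> < s / 2"
    then have t0: "t > 0" using s unfolding abs_less_iff by (auto simp: field_simps)
    show "integrable lborel (\<lambda>u. dens t u * P (kap t u))"
      by (rule integrable_dens[OF t0 bP cP[OF t0]])
    fix u
    have "((\<lambda>t. dens t u * P (kap t u)) has_real_derivative f' t u) (at t)"
      unfolding P_def f'_def G_def D_def
      by (auto intro!: derivative_eq_intros dens_has_derivative_s[OF t0]
          monoval_has_derivative_heat[where K = "\<lambda>i t. kap t u i"] kap_has_derivative_s[OF t0] xs
          simp: power2_eq_square algebra_simps add_divide_distrib diff_divide_distrib)
    then show "((\<lambda>t. dens t u * P (kap t u)) has_vector_derivative f' t u) (at t)"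
      by (simp add: has_real_derivative_iff_has_vector_derivative)
  qed (use s f'_bound int_inv mf' in auto)
  moreover have "(\<integral>u. f' s u \<partial>lborel) = expect s LH"
  proof -
    \<comment> \<open>The flux: \<open>J = (W \<partial>\<^sub>u g - g \<partial>\<^sub>u W) / 2\<close> with \<open>g\<close> the Gaussian density and \<open>W\<close> the rest of the integrand.\<close>
    define J where "J u = dens s u * (- (u / s) * P (kap s u) - kap s u 1 * P (kap s u) - D (kap s u)) / 2" for u
    have int_LH: "integrable lborel (\<lambda>u. dens s u * LH (kap s u))"
      by (rule integrable_dens[OF s bLH cLH[OF s]])
    have "(\<integral>u. f' s u - dens s u * LH (kap s u) \<partial>lborel) = 0"
    proof (rule integral_deriv_eq_0[where F = J])
      show "(J has_real_derivative f' s u - dens s u * LH (kap s u)) (at u)" for u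
      proof -
        let ?k = "kap s u" and ?Q = "\<lambda>u. - (u / s) * P (kap s u) - kap s u 1 * P (kap s u) - D (kap s u)"
        have dP: "((\<lambda>u. P (kap s u)) has_real_derivative D ?k) (at u)"
          unfolding P_def D_def
          by (rule monoval_has_derivative_shift1[where K = "\<lambda>i u. kap s u i", OF kap_has_derivative_u[OF s] xs])
        have dD: "((\<lambda>u. D (kap s u)) has_real_derivative 2 * Lval ?k xs + shift2 ?k xs) (at u)"
          unfolding D_def
          by (rule shift1_has_derivative[where K = "\<lambda>i u. kap s u i", OF kap_has_derivative_u[OF s] xs])
        have dK: "((\<lambda>u. kap s u 1) has_real_derivative ?k 2) (at u)"
          using kap_has_derivative_u[OF s, of 1 u] by (simp add: numeral_2_eq_2)
        have "(?Q has_real_derivative - (1 / s) * P ?k - (u / s) * D ?k - (?k 2 * P ?k + ?k 1 * D ?k)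
            - (2 * Lval ?k xs + shift2 ?k xs)) (at u)"
          using s by (auto intro!: derivative_eq_intros dP dD dK[simplified] simp: field_simps)
        from DERIV_cdivide[OF DERIV_mult[OF dens_has_derivative_u[OF s] this], of 2]
        show ?thesis
          unfolding J_def[abs_def]
        proof (rule DERIV_cong)
          show "(dens s u * (?k 1 - u / s) * ?Q u + (- (1 / s) * P ?k - (u / s) * D ?k - (?k 2 * P ?k + ?k 1 * D ?k)
            - (2 * Lval ?k xs + shift2 ?k xs)) * dens s u) / 2 = f' s u - dens s u * LH ?k"
            unfolding f'_def G_def LH_def
            using s by (simp add: power2_eq_square diff_divide_distrib add_divide_distrib algebra_simps)
        qed
      qed
      show "continuous_on UNIV (\<lambda>u. f' s u - dens s u * LH (kap s u))"
        by (intro continuous_intros cf' continuous_dens cLH s)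
      show "integrable lborel (\<lambda>u. f' s u - dens s u * LH (kap s u))"
        by (intro Bochner_Integration.integrable_diff int_f' int_LH)
      \<comment> \<open>This is the part of the flux without the factor \<open>u / s\<close>; the
        part with it is controlled by \<open>CP\<close>, since the absolute value of
        \<open>u\<close> is at most \<open>1 + u^2\<close>.\<close>
      have bQ: "bdd cumC (Suc p) (\<lambda>K. K 1 * P K + D K)" by (intro bdd_add bKP bD)
      obtain CQ where CQ: "CQ \<ge> 0" "\<And>t u. s / 2 \<le> t \<Longrightarrow> t \<le> 2 * s \<Longrightarrow>
          \<bar>dens t u * (kap t u 1 * P (kap t u) + D (kap t u))\<bar> * (1 + u\<^sup>2)\<^sup>2 \<le> CQ"
        using dens_decay[OF _ bQ, where a = "s / 2" and b = "2 * s"] s by auto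
      have J: "\<bar>J u\<bar> \<le> (CP / s + CQ) * (1 / (1 + u\<^sup>2))" for u
      proof -
        have u1: "1 + u\<^sup>2 > 0" by (simp add: add_pos_nonneg)
        have au: "\<bar>u\<bar> \<le> 1 + u\<^sup>2" using abs_power_le_one_plus_square[of u 1] by simp
        let ?p = "dens s u * P (kap s u)" and ?q = "dens s u * (kap s u 1 * P (kap s u) + D (kap s u))"
        have "\<bar>J u\<bar> = \<bar>- (u / s) * ?p - ?q\<bar> / 2"
          unfolding J_def by (simp add: algebra_simps)
        also have "\<dots> \<le> \<bar>u\<bar> / s * \<bar>?p\<bar> + \<bar>?q\<bar>"
        proof -
          have "\<bar>- (u / s) * ?p - ?q\<bar> \<le> \<bar>u\<bar> / s * \<bar>?p\<bar> + \<bar>?q\<bar>"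
            using abs_triangle_ineq4[of "- (u / s) * ?p" ?q] s by (simp add: abs_mult)
          moreover have "\<bar>z\<bar> \<le> w \<Longrightarrow> \<bar>z\<bar> / 2 \<le> w" for z w :: real by linarith
          ultimately show ?thesis by blast
        qed
        finally have "\<bar>J u\<bar> * (1 + u\<^sup>2) \<le> (\<bar>u\<bar> / s * \<bar>?p\<bar> + \<bar>?q\<bar>) * (1 + u\<^sup>2)"
          using u1 by (intro mult_right_mono) auto
        also have "\<dots> = (\<bar>u\<bar> * (1 + u\<^sup>2) * \<bar>?p\<bar>) / s + \<bar>?q\<bar> * (1 + u\<^sup>2)"
          by (simp add: algebra_simps add_divide_distrib)
        also have "\<dots> \<le> ((1 + u\<^sup>2) * (1 + u\<^sup>2) * \<bar>?p\<bar>) / s + \<bar>?q\<bar> * (1 + u\<^sup>2)\<^sup>2"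
          using au u1 s by (intro add_mono divide_right_mono mult_right_mono mult_left_mono self_le_power) auto
        also have "\<dots> \<le> CP / s + CQ"
          using CP(2)[of s u] CQ(2)[of s u] s
          by (intro add_mono divide_right_mono) (auto simp: power2_eq_square mult_ac)
        finally show ?thesis using u1 by (simp add: field_simps)
      qed
      have lim: "((\<lambda>u::real. (CP / s + CQ) * (1 / (1 + u\<^sup>2))) \<longlongrightarrow> 0) F"
        if "filterlim (\<lambda>u::real. u\<^sup>2) at_top F" for F
      proof -
        have "filterlim (\<lambda>u::real. 1 + u\<^sup>2) at_top F"
          by (rule filterlim_tendsto_add_at_top[OF tendsto_const that])
        then have "((\<lambda>u::real. 1 / (1 + u\<^sup>2)) \<longlongrightarrow> 0) F"
          by (rule tendsto_divide_0[OF tendsto_const filterlim_at_top_imp_at_infinity])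
        from tendsto_mult_right_zero[OF this] show ?thesis .
      qed
      have J': "\<forall>\<^sub>F u in F. norm (J u) \<le> (CP / s + CQ) * (1 / (1 + u\<^sup>2))" for F
        unfolding real_norm_def by (rule always_eventually) (rule allI, rule J)
      show "(J \<longlongrightarrow> 0) at_top"
        by (rule Lim_null_comparison[OF J' lim]) (auto intro!: filterlim_pow_at_top filterlim_ident)
      show "(J \<longlongrightarrow> 0) at_bot"
        by (rule Lim_null_comparison[OF J' lim]) (auto intro!: filterlim_pow_at_bot_even filterlim_ident)
    qed
    then show ?thesis using int_f' int_LH by (simp add: expect_def)
  qed
  ultimately show ?thesis
    by (simp add: expect_def P_def LH_def has_real_derivative_iff_has_vector_derivative)
qed

end

section \<open>The minimum mean square error\<close>

lemma tendsto_cum: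
  fixes m :: "nat \<Rightarrow> nat \<Rightarrow> real"
  assumes "\<And>k. (\<lambda>n. m n k) \<longlonglongrightarrow> l k" "l 0 \<noteq> 0"
  shows "(\<lambda>n. cum (m n) i) \<longlonglongrightarrow> cum l i"
proof (induction i rule: less_induct)
  case (less i)
  show ?case
  proof (cases i)
    case (Suc j)
    have "(\<lambda>n. (m n (Suc j) - (\<Sum>k<j. of_nat (j choose k) * cum (m n) (Suc k) * m n (j - k))) / m n 0)
      \<longlonglongrightarrow> (l (Suc j) - (\<Sum>k<j. of_nat (j choose k) * cum l (Suc k) * l (j - k))) / l 0"
      using less.IH Suc assms by (intro tendsto_intros) auto
    then show ?thesis by (simp add: Suc cum_Suc[of _ j])
  qed simp
qed

lemma tendsto_monoval:
  fixes K :: "'b \<Rightarrow> nat \<Rightarrow> real"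
  assumes "\<And>i. ((\<lambda>n. K n i) \<longlongrightarrow> l i) F"
  shows "((\<lambda>n. monoval (K n) xs) \<longlongrightarrow> monoval l xs) F"
  by (induction xs) (auto intro!: tendsto_intros assms)

text \<open>The substitution \<open>u = s * x + sqrt s * y\<close>, with Jacobian
  \<open>sqrt s\<close>, standardises the normal law of \<open>u\<close> given
  \<open>x\<close>.\<close>

lemma gauss_tilt_affine:
  assumes "s > 0"
  shows "sqrt s * (gauss s (s * x + sqrt s * y) * tilt s (s * x + sqrt s * y) x) = std_normal_density y"
proof -
  have "(s * x + sqrt s * y - s * x)\<^sup>2 / (2 * s) = y\<^sup>2 / 2"
    using assms by (simp add: power_mult_distrib)
  then show ?thesis
    using assms by (simp add: gauss_mult_tilt std_normal_density_def real_sqrt_mult field_simps)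
qed

lemma gauss_tilt_measurable [measurable]:
  "(\<lambda>z. gauss s (snd z) * tilt s (snd z) (fst z)) \<in> borel_measurable (borel \<Otimes>\<^sub>M borel)"
  unfolding gauss_def tilt_def by measurable

section \<open>The joint law of the signal and the observation\<close>

context all_moments
begin

definition joint :: "(real \<times> real) measure" where
  "joint = \<mu> \<Otimes>\<^sub>M std_normal_distribution"

text \<open>This is \<open>sqrt s * Y_s\<close>. For \<open>s > 0\<close> it carries the same
  information as \<open>Y_s\<close>, and its value is the tilting parameter
  \<open>u\<close>.\<close>

definition obs :: "real \<Rightarrow> real \<times> real \<Rightarrow> real" where
  "obs s \<omega> = s * fst \<omega> + sqrt s * snd \<omega>"

lemma sets_joint [measurable_cong, simp]: "sets joint = sets (borel \<Otimes>\<^sub>M borel)"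
  unfolding joint_def by (intro sets_pair_measure_cong) auto

lemma space_joint [simp]: "space joint = UNIV"
  using sets_eq_imp_space_eq[OF sets_joint] by (simp add: space_pair_measure)

lemma obs_measurable [measurable]: "obs s \<in> borel_measurable (borel \<Otimes>\<^sub>M borel)"
  unfolding obs_def[abs_def] by measurable

lemma prob_space_joint: "prob_space joint"
proof -
  interpret sn: prob_space std_normal_distribution
    by (rule prob_space_normal_density) simp
  interpret pair_prob_space \<mu> std_normal_distribution ..
  show ?thesis unfolding joint_def by unfold_locales
qed

lemma
  fixes f :: "real \<Rightarrow> real"
  assumes "integrable \<mu> f"
  shows integrable_joint_fst: "integrable joint (\<lambda>\<omega>. f (fst \<omega>))"
    and integral_joint_fst: "(\<integral>\<omega>. f (fst \<omega>) \<partial>joint) = (\<integral>x. f x \<partial>\<mu>)"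
proof -
  interpret sn: prob_space std_normal_distribution
    by (rule prob_space_normal_density) simp
  have d: "distr joint \<mu> fst = \<mu>" unfolding joint_def by (rule sn.distr_pair_fst)
  have [measurable]: "fst \<in> measurable joint \<mu>" unfolding joint_def by measurable
  have [measurable]: "f \<in> borel_measurable \<mu>" using assms by simp
  show "integrable joint (\<lambda>\<omega>. f (fst \<omega>))"
    using assms integrable_distr[of fst joint \<mu> f] by (simp add: d)
  show "(\<integral>\<omega>. f (fst \<omega>) \<partial>joint) = (\<integral>x. f x \<partial>\<mu>)"
    using integral_distr[of fst joint \<mu> f] by (simp add: d)
qed

text \<open>Bayes' formula: for fixed \<open>x\<close> the noise is replaced by the value
  \<open>u\<close> of the observation, and exchanging the integrals leaves the unnormalised
  conditional law of \<open>X\<close> inside.\<close>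

lemma nn_integral_joint:
  assumes s: "s > 0" and h [measurable]: "h \<in> borel_measurable (borel \<Otimes>\<^sub>M borel)"
  shows "(\<integral>\<^sup>+\<omega>. h (fst \<omega>, obs s \<omega>) \<partial>joint)
    = (\<integral>\<^sup>+u. \<integral>\<^sup>+x. ennreal (gauss s u * tilt s u x) * h (x, u) \<partial>\<mu> \<partial>lborel)"
proof -
  interpret sn: prob_space std_normal_distribution
    by (rule prob_space_normal_density) simp
  interpret L: pair_sigma_finite \<mu> lborel
    by unfold_locales
  have "(\<integral>\<^sup>+\<omega>. h (fst \<omega>, obs s \<omega>) \<partial>joint)
     = (\<integral>\<^sup>+x. \<integral>\<^sup>+y. h (x, obs s (x, y)) \<partial>std_normal_distribution \<partial>\<mu>)"
    unfolding joint_def by (subst sn.nn_integral_fst[symmetric]) (auto simp: obs_def)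
  also have "\<dots> = (\<integral>\<^sup>+x. \<integral>\<^sup>+y. ennreal (std_normal_density y) * h (x, obs s (x, y)) \<partial>lborel \<partial>\<mu>)"
    by (subst nn_integral_density) (auto simp: obs_def)
  also have "\<dots> = (\<integral>\<^sup>+x. \<integral>\<^sup>+u. ennreal (gauss s u * tilt s u x) * h (x, u) \<partial>lborel \<partial>\<mu>)"
  proof (rule nn_integral_cong)
    fix x
    have [measurable]: "(\<lambda>u. gauss s u * tilt s u x) \<in> borel_measurable borel"
      unfolding gauss_def tilt_def by measurable
    have "(\<integral>\<^sup>+u. ennreal (gauss s u * tilt s u x) * h (x, u) \<partial>lborel)
      = ennreal \<bar>sqrt s\<bar> * (\<integral>\<^sup>+y. ennreal (gauss s (s * x + sqrt s * y) * tilt s (s * x + sqrt s * y) x) * h (x, s * x + sqrt s * y) \<partial>lborel)"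
      using s by (intro nn_integral_real_affine) auto
    also have "\<dots> = (\<integral>\<^sup>+y. ennreal (sqrt s) * (ennreal (gauss s (s * x + sqrt s * y) * tilt s (s * x + sqrt s * y) x) * h (x, s * x + sqrt s * y)) \<partial>lborel)"
      using s by (subst nn_integral_cmult) (auto simp: gauss_def tilt_def)
    also have "\<dots> = (\<integral>\<^sup>+y. ennreal (std_normal_density y) * h (x, obs s (x, y)) \<partial>lborel)"
      using s gauss_tilt_affine[OF s, of x]
      by (simp add: obs_def mult.assoc[symmetric] ennreal_mult[symmetric] gauss_pos tilt_pos less_imp_le)
    finally show "(\<integral>\<^sup>+y. ennreal (std_normal_density y) * h (x, obs s (x, y)) \<partial>lborel)
      = (\<integral>\<^sup>+u. ennreal (gauss s u * tilt s u x) * h (x, u) \<partial>lborel)" by simp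
  qed
  also have "\<dots> = (\<integral>\<^sup>+u. \<integral>\<^sup>+x. ennreal (gauss s u * tilt s u x) * h (x, u) \<partial>\<mu> \<partial>lborel)"
    by (rule L.Fubini'[symmetric]) (auto simp: split_beta' gauss_def tilt_def)
  finally show ?thesis .
qed

text \<open>The nonnegative case for indicators identifies the law of signal and observation as a
  measure with density; signed integrands follow by change of measure.\<close>

lemma integral_joint:
  fixes h :: "real \<times> real \<Rightarrow> real"
  assumes s: "s > 0" and h [measurable]: "h \<in> borel_measurable (borel \<Otimes>\<^sub>M borel)"
    and int: "integrable joint (\<lambda>\<omega>. h (fst \<omega>, obs s \<omega>))"
  shows "(\<integral>\<omega>. h (fst \<omega>, obs s \<omega>) \<partial>joint)
    = (\<integral>u. (\<integral>x. gauss s u * tilt s u x * h (x, u) \<partial>\<mu>) \<partial>lborel)"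
proof -
  interpret L: pair_sigma_finite \<mu> lborel
    by unfold_locales
  let ?T = "\<lambda>\<omega>. (fst \<omega>, obs s \<omega>)" and ?B = "borel \<Otimes>\<^sub>M borel :: (real \<times> real) measure"
  let ?w = "\<lambda>z. gauss s (snd z) * tilt s (snd z) (fst z)"
  have sB: "sets (\<mu> \<Otimes>\<^sub>M lborel) = sets ?B" by (intro sets_pair_measure_cong) auto
  have [measurable]: "?w \<in> borel_measurable (\<mu> \<Otimes>\<^sub>M lborel)" "h \<in> borel_measurable (\<mu> \<Otimes>\<^sub>M lborel)"
    using measurable_cong_sets[OF sB refl] h gauss_tilt_measurable by blast+
  have w0: "?w z \<ge> 0" for z using s by (simp add: gauss_pos tilt_pos less_imp_le)
  have T [measurable]: "?T \<in> measurable joint ?B" by measurable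
  have eq: "distr joint ?B ?T = density (\<mu> \<Otimes>\<^sub>M lborel) (\<lambda>z. ennreal (?w z))"
  proof (rule measure_eqI)
    fix A assume "A \<in> sets (distr joint ?B ?T)"
    then have A [measurable]: "A \<in> sets ?B" by simp
    then have A' [measurable]: "A \<in> sets (\<mu> \<Otimes>\<^sub>M lborel)" by (simp add: sB)
    have "emeasure (distr joint ?B ?T) A = (\<integral>\<^sup>+z. indicator A z \<partial>distr joint ?B ?T)" by simp
    also have "\<dots> = (\<integral>\<^sup>+\<omega>. indicator A (fst \<omega>, obs s \<omega>) \<partial>joint)"
      by (rule nn_integral_distr) auto
    also have "\<dots> = (\<integral>\<^sup>+u. \<integral>\<^sup>+x. ennreal (gauss s u * tilt s u x) * indicator A (x, u) \<partial>\<mu> \<partial>lborel)"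
      by (rule nn_integral_joint[OF s]) measurable
    also have "\<dots> = (\<integral>\<^sup>+z. ennreal (?w z) * indicator A z \<partial>(\<mu> \<Otimes>\<^sub>M lborel))"
      by (subst L.nn_integral_snd[symmetric]) auto
    also have "\<dots> = emeasure (density (\<mu> \<Otimes>\<^sub>M lborel) (\<lambda>z. ennreal (?w z))) A"
      by (subst emeasure_density) auto
    finally show "emeasure (distr joint ?B ?T) A = emeasure (density (\<mu> \<Otimes>\<^sub>M lborel) (\<lambda>z. ennreal (?w z))) A" .
  qed (simp add: sB)
  have "integrable (distr joint ?B ?T) h" using int by (simp add: integrable_distr_eq[OF T h])
  then have int2: "integrable (\<mu> \<Otimes>\<^sub>M lborel) (\<lambda>z. ?w z *\<^sub>R h z)"
    unfolding eq using w0 by (subst (asm) integrable_density) auto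
  have "(\<integral>\<omega>. h (fst \<omega>, obs s \<omega>) \<partial>joint) = integral\<^sup>L (distr joint ?B ?T) h"
    by (rule integral_distr[symmetric]) auto
  also have "\<dots> = (\<integral>z. ?w z *\<^sub>R h z \<partial>(\<mu> \<Otimes>\<^sub>M lborel))"
    unfolding eq using w0 by (intro integral_density) auto
  also have "\<dots> = (\<integral>u. (\<integral>x. ?w (x, u) *\<^sub>R h (x, u) \<partial>\<mu>) \<partial>lborel)"
    using L.integral_snd[of "\<lambda>x u. ?w (x, u) *\<^sub>R h (x, u)"] int2 by (simp add: split_beta')
  finally show ?thesis by simp
qed

lemma tower:
  fixes f r :: "real \<Rightarrow> real"
  assumes s: "s > 0" and [measurable]: "f \<in> borel_measurable borel" "r \<in> borel_measurable borel"
    and int: "integrable joint (\<lambda>\<omega>. f (fst \<omega>) * r (obs s \<omega>))"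
  shows "(\<integral>\<omega>. f (fst \<omega>) * r (obs s \<omega>) \<partial>joint)
    = (\<integral>u. gauss s u * r u * (\<integral>x. f x * tilt s u x \<partial>\<mu>) \<partial>lborel)"
proof -
  have "(\<integral>\<omega>. f (fst \<omega>) * r (obs s \<omega>) \<partial>joint)
    = (\<integral>u. (\<integral>x. gauss s u * tilt s u x * (f x * r u) \<partial>\<mu>) \<partial>lborel)"
    using integral_joint[OF s, of "\<lambda>z. f (fst z) * r (snd z)"] int by simp
  also have "\<dots> = (\<integral>u. (\<integral>x. (gauss s u * r u) * (f x * tilt s u x) \<partial>\<mu>) \<partial>lborel)"
    by (simp add: mult_ac)
  finally show ?thesis by simp
qed

lemma integrable_joint_obs:
  fixes r :: "real \<Rightarrow> real"
  assumes s: "s > 0" and [measurable]: "r \<in> borel_measurable borel"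
    and int: "integrable lborel (\<lambda>u. dens s u * r u)"
  shows "integrable joint (\<lambda>\<omega>. r (obs s \<omega>))"
  unfolding integrable_iff_bounded
proof
  show "(\<lambda>\<omega>. r (obs s \<omega>)) \<in> borel_measurable joint" by measurable
  have "(\<integral>\<^sup>+\<omega>. ennreal (norm (r (obs s \<omega>))) \<partial>joint)
     = (\<integral>\<^sup>+u. \<integral>\<^sup>+x. ennreal (gauss s u * tilt s u x) * ennreal (norm (r u)) \<partial>\<mu> \<partial>lborel)"
    using nn_integral_joint[OF s, of "\<lambda>z. ennreal (norm (r (snd z)))"] by simp
  also have "\<dots> = (\<integral>\<^sup>+u. ennreal (norm (dens s u * r u)) \<partial>lborel)"
  proof (rule nn_integral_cong)
    fix u
    have "(\<integral>\<^sup>+x. ennreal (gauss s u * tilt s u x) * ennreal (norm (r u)) \<partial>\<mu>)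
       = (\<integral>\<^sup>+x. ennreal (gauss s u * norm (r u) * (x ^ 0 * tilt s u x)) \<partial>\<mu>)"
      using s by (simp add: ennreal_mult[symmetric] gauss_pos tilt_pos less_imp_le mult_ac)
    also have "\<dots> = ennreal (\<integral>x. gauss s u * norm (r u) * (x ^ 0 * tilt s u x) \<partial>\<mu>)"
      using s by (intro nn_integral_eq_integral integrable_mult_right integrable_mom)
        (auto simp: gauss_pos tilt_pos less_imp_le)
    also have "\<dots> = ennreal (norm (dens s u * r u))"
      using s mom_0_pos[OF s, of u] gauss_pos[OF s, of u] by (simp add: dens_def abs_mult mom_def mult_ac)
    finally show "(\<integral>\<^sup>+x. ennreal (gauss s u * tilt s u x) * ennreal (norm (r u)) \<partial>\<mu>) = ennreal (norm (dens s u * r u))" .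
  qed
  also have "\<dots> < \<infinity>" using int by (simp add: integrable_iff_bounded)
  finally show "(\<integral>\<^sup>+\<omega>. ennreal (norm (r (obs s \<omega>))) \<partial>joint) < \<infinity>" .
qed

lemma kap_measurable [measurable]: "s > 0 \<Longrightarrow> (\<lambda>u. kap s u i) \<in> borel_measurable borel"
  by (simp add: borel_measurable_continuous_onI continuous_kap)

text \<open>The conditional mean is \<open>K 1\<close>, written \<open>k\<close>. After expanding
  the square, the means of \<open>X * k\<close> and of \<open>k^2\<close> are both the integral of
  \<open>dens * k^2\<close>, and that of \<open>X^2\<close> is the integral of
  \<open>dens * (K 2 + k^2)\<close>, so only \<open>K 2\<close> survives.\<close>

lemma mmse_eq_expect:
  assumes s: "s > 0"
  shows "mmse \<mu> s = expect s (\<lambda>K. K 2)"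
proof -
  define Ys where "Ys = (\<lambda>\<omega>::real \<times> real. sqrt s * fst \<omega> + snd \<omega>)"
  define F where "F = vimage_algebra (space joint) Ys borel"
  define k where "k u = kap s u 1" for u
  have [measurable]: "k \<in> borel_measurable borel" unfolding k_def using s by measurable
  have [measurable]: "Ys \<in> borel_measurable (borel \<Otimes>\<^sub>M borel)" unfolding Ys_def by measurable
  have obs: "obs s \<omega> = sqrt s * Ys \<omega>" for \<omega>
    using s by (simp add: obs_def Ys_def distrib_left)
  interpret J: prob_space joint by (rule prob_space_joint)
  have setsF: "sets F = {Ys -` A \<inter> space joint | A. A \<in> sets borel}"
    unfolding F_def by (rule sets_vimage_algebra2) auto
  interpret finite_measure_subalgebra joint F
  proof
    show "subalgebra joint F"
      unfolding subalgebra_def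
    proof
      show "sets F \<subseteq> sets joint"
      proof
        fix A assume "A \<in> sets F"
        then obtain B where B: "A = Ys -` B \<inter> space joint" "B \<in> sets borel" by (auto simp: setsF)
        have "Ys \<in> borel_measurable joint" by measurable
        then show "A \<in> sets joint" using B measurable_sets by blast
      qed
    qed (simp add: F_def)
  qed
  have int_k: "integrable joint (\<lambda>\<omega>. k (obs s \<omega>))"
    unfolding k_def
    by (rule integrable_joint_obs[OF s _ integrable_dens[OF s bdd_var continuous_kap[OF s]]])
      (use s in measurable)
  have int_k2: "integrable joint (\<lambda>\<omega>. (k (obs s \<omega>))\<^sup>2)"
  proof -
    have "bdd cumC (1 + 1) (\<lambda>K. K 1 * K 1)" by (intro bdd_mult bdd_var)
    then have "integrable lborel (\<lambda>u. dens s u * (k u)\<^sup>2)"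
      using integrable_dens[OF s, of 2 "\<lambda>K. K 1 * K 1"] continuous_kap[OF s, of 1]
      by (simp add: k_def power2_eq_square continuous_on_mult numeral_2_eq_2)
    then show ?thesis by (intro integrable_joint_obs s) auto
  qed
  have int_x: "integrable joint (\<lambda>\<omega>. fst \<omega>)" and int_x2: "integrable joint (\<lambda>\<omega>. (fst \<omega>)\<^sup>2)"
    using integrable_joint_fst[OF integrable_power[of 1]] integrable_joint_fst[OF integrable_power[of 2]] by auto
  have int_xk: "integrable joint (\<lambda>\<omega>. fst \<omega> * k (obs s \<omega>))"
  proof (rule Bochner_Integration.integrable_bound[where f = "\<lambda>\<omega>. (fst \<omega>)\<^sup>2 + (k (obs s \<omega>))\<^sup>2"])
    show "AE \<omega> in joint. norm (fst \<omega> * k (obs s \<omega>)) \<le> norm ((fst \<omega>)\<^sup>2 + (k (obs s \<omega>))\<^sup>2)"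
    proof (rule AE_I2)
      have "\<bar>a * b\<bar> \<le> a\<^sup>2 + b\<^sup>2" for a b :: real
      proof -
        have "2 * \<bar>a * b\<bar> \<le> a\<^sup>2 + b\<^sup>2"
          using sum_squares_bound[of "\<bar>a\<bar>" "\<bar>b\<bar>"] by (simp add: abs_mult mult.assoc)
        then show ?thesis using abs_ge_zero[of "a * b"] by linarith
      qed
      then show "norm (fst \<omega> * k (obs s \<omega>)) \<le> norm ((fst \<omega>)\<^sup>2 + (k (obs s \<omega>))\<^sup>2)" for \<omega>
        by (simp add: abs_of_nonneg)
    qed
  qed (use int_x2 int_k2 in \<open>auto intro: Bochner_Integration.integrable_add\<close>)
  have mom1: "(\<integral>x. x * tilt s u x \<partial>\<mu>) = k u * mom 0 s u" for u
    using mom_1[OF s, of u] by (simp add: mom_def k_def)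
  have mom0: "(\<integral>x. tilt s u x \<partial>\<mu>) = mom 0 s u" for u
    by (simp add: mom_def)
  have ce: "AE \<omega> in joint. real_cond_exp joint F fst \<omega> = k (obs s \<omega>)"
  proof (rule real_cond_exp_charact)
    fix A assume "A \<in> sets F"
    then obtain B where B: "A = Ys -` B \<inter> space joint" and [measurable]: "B \<in> sets borel" by (auto simp: setsF)
    \<comment> \<open>An event of \<open>F\<close> is a condition on \<open>Ys\<close>; rescaling by
      \<open>sqrt s\<close> makes it a condition on the observation.\<close>
    define b :: "real \<Rightarrow> real" where "b u = indicator B (u / sqrt s)" for u
    have [measurable]: "b \<in> borel_measurable borel" unfolding b_def by measurable
    have ind: "indicator A \<omega> = b (obs s \<omega>)" for \<omega>
      using s by (simp add: B b_def obs indicator_def)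
    have [measurable]: "A \<in> sets joint"
      using \<open>A \<in> sets F\<close> subalg by (auto simp: subalgebra_def)
    have i1: "integrable joint (\<lambda>\<omega>. fst \<omega> * b (obs s \<omega>))"
      using integrable_mult_indicator[OF \<open>A \<in> sets joint\<close> int_x] by (simp add: ind mult.commute)
    \<comment> \<open>The factor 1 plays the part of the function of \<open>X\<close> in
      \<open>tower\<close>.\<close>
    have i2: "integrable joint (\<lambda>\<omega>. 1 * (b (obs s \<omega>) * k (obs s \<omega>)))"
      using integrable_mult_indicator[OF \<open>A \<in> sets joint\<close> int_k] by (simp add: ind)
    have "(\<integral>\<omega>\<in>A. fst \<omega> \<partial>joint) = (\<integral>\<omega>. fst \<omega> * b (obs s \<omega>) \<partial>joint)"
      by (simp add: set_lebesgue_integral_def ind mult.commute)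
    also have "\<dots> = (\<integral>u. gauss s u * b u * (\<integral>x. x * tilt s u x \<partial>\<mu>) \<partial>lborel)"
      by (rule tower[OF s, of "\<lambda>x. x"]) (use i1 in auto)
    also have "\<dots> = (\<integral>u. gauss s u * (b u * k u) * (\<integral>x. 1 * tilt s u x \<partial>\<mu>) \<partial>lborel)"
      by (simp add: mom1 mom0 mult_ac)
    also have "\<dots> = (\<integral>\<omega>. 1 * (b (obs s \<omega>) * k (obs s \<omega>)) \<partial>joint)"
      by (rule tower[OF s, symmetric]) (use i2 in auto)
    also have "\<dots> = (\<integral>\<omega>\<in>A. k (obs s \<omega>) \<partial>joint)"
      by (simp add: set_lebesgue_integral_def ind)
    finally show "(\<integral>\<omega>\<in>A. fst \<omega> \<partial>joint) = (\<integral>\<omega>\<in>A. k (obs s \<omega>) \<partial>joint)" .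
  next
    have "Ys \<in> measurable F borel" unfolding F_def by (rule measurable_vimage_algebra1) auto
    then show "(\<lambda>\<omega>. k (obs s \<omega>)) \<in> borel_measurable F" unfolding obs by measurable
  qed (use int_x int_k in auto)
  have "mmse \<mu> s = (\<integral>\<omega>. (fst \<omega> - real_cond_exp joint F fst \<omega>)\<^sup>2 \<partial>joint)"
    by (simp add: mmse_def Let_def joint_def F_def Ys_def)
  also have "\<dots> = (\<integral>\<omega>. (fst \<omega> - k (obs s \<omega>))\<^sup>2 \<partial>joint)"
  proof (rule integral_cong_AE)
    have "real_cond_exp joint F fst \<in> borel_measurable joint" by (rule borel_measurable_cond_exp2)
    then show "(\<lambda>\<omega>. (fst \<omega> - real_cond_exp joint F fst \<omega>)\<^sup>2) \<in> borel_measurable joint" by measurable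
    show "(\<lambda>\<omega>. (fst \<omega> - k (obs s \<omega>))\<^sup>2) \<in> borel_measurable joint" by measurable
    show "AE \<omega> in joint. (fst \<omega> - real_cond_exp joint F fst \<omega>)\<^sup>2 = (fst \<omega> - k (obs s \<omega>))\<^sup>2"
      using ce by auto
  qed
  also have "\<dots> = (\<integral>\<omega>. (fst \<omega>)\<^sup>2 - 2 * (fst \<omega> * k (obs s \<omega>)) + (k (obs s \<omega>))\<^sup>2 \<partial>joint)"
    by (simp add: power2_eq_square algebra_simps)
  also have "\<dots> = (\<integral>\<omega>. (fst \<omega>)\<^sup>2 \<partial>joint) - 2 * (\<integral>\<omega>. fst \<omega> * k (obs s \<omega>) \<partial>joint) + (\<integral>\<omega>. (k (obs s \<omega>))\<^sup>2 \<partial>joint)"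
    using int_x2 int_xk int_k2 by simp
  also have "(\<integral>\<omega>. (fst \<omega>)\<^sup>2 \<partial>joint) = (\<integral>u. dens s u * (kap s u 2 + (k u)\<^sup>2) \<partial>lborel)"
  proof -
    have "(\<integral>x. x\<^sup>2 * tilt s u x \<partial>\<mu>) = (kap s u 2 + (k u)\<^sup>2) * mom 0 s u" for u
      using mom_2[OF s, of u] by (simp add: mom_def k_def power2_eq_square)
    then show ?thesis
      using tower[OF s, of "\<lambda>x. x\<^sup>2" "\<lambda>u. 1"] int_x2 by (simp add: dens_def mult_ac)
  qed
  also have "(\<integral>\<omega>. fst \<omega> * k (obs s \<omega>) \<partial>joint) = (\<integral>u. dens s u * (k u)\<^sup>2 \<partial>lborel)"
    using tower[OF s, of "\<lambda>x. x" k] int_xk by (simp add: mom1 dens_def power2_eq_square mult_ac)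
  also have "(\<integral>\<omega>. (k (obs s \<omega>))\<^sup>2 \<partial>joint) = (\<integral>u. dens s u * (k u)\<^sup>2 \<partial>lborel)"
    using tower[OF s, of "\<lambda>x. 1" "\<lambda>u. (k u)\<^sup>2"] int_k2 by (simp add: mom0 dens_def mult_ac)
  also have "(\<integral>u. dens s u * (kap s u 2 + (k u)\<^sup>2) \<partial>lborel) = expect s (\<lambda>K. K 2) + (\<integral>u. dens s u * (k u)\<^sup>2 \<partial>lborel)"
  proof -
    have "integrable lborel (\<lambda>u. dens s u * kap s u 2)"
      by (rule integrable_dens[OF s bdd_var continuous_kap[OF s]])
    moreover have "integrable lborel (\<lambda>u. dens s u * (k u)\<^sup>2)"
      using integrable_dens[OF s, of 2 "\<lambda>K. K 1 * K 1"] bdd_mult[OF bdd_var[of cumC 1] bdd_var[of cumC 1]] continuous_kap[OF s, of 1]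
      by (simp add: k_def power2_eq_square continuous_on_mult numeral_2_eq_2)
    ultimately show ?thesis by (simp add: expect_def distrib_left)
  qed
  finally show ?thesis by simp
qed

section \<open>The limit of vanishing observation\<close>

text \<open>Inside a parabola \<open>u^2 \<le> 2 * B * s\<close> the tilt is at most
  \<open>exp B\<close>, so the plain moments of \<open>\<mu>\<close> dominate.\<close>

lemma mom_tendsto:
  assumes "\<And>n. sq n > 0" "sq \<longlonglongrightarrow> 0" "uq \<longlonglongrightarrow> 0" "\<And>n. (uq n)\<^sup>2 / (2 * sq n) \<le> B"
  shows "(\<lambda>n. mom k (sq n) (uq n)) \<longlonglongrightarrow> mom k 0 0"
  unfolding mom_def
proof (rule integral_dominated_convergence[where w = "\<lambda>x. (1 + x\<^sup>2) ^ k * exp B"])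
  show "AE x in \<mu>. (\<lambda>n. x ^ k * tilt (sq n) (uq n) x) \<longlonglongrightarrow> x ^ k * tilt 0 0 x"
    unfolding tilt_def by (intro AE_I2 tendsto_intros assms(2,3)) simp
  fix n
  show "AE x in \<mu>. norm (x ^ k * tilt (sq n) (uq n) x) \<le> (1 + x\<^sup>2) ^ k * exp B"
  proof (rule AE_I2)
    fix x
    have "tilt (sq n) (uq n) x \<le> exp B"
      using order_trans[OF tilt_le[OF assms(1)[of n], of "uq n" x]] assms(4)[of n] by simp
    then have "\<bar>x ^ k\<bar> * \<bar>tilt (sq n) (uq n) x\<bar> \<le> (1 + x\<^sup>2) ^ k * exp B"
      using tilt_pos[of "sq n" "uq n" x] by (intro mult_mono abs_power_le_one_plus_square) auto
    then show "norm (x ^ k * tilt (sq n) (uq n) x) \<le> (1 + x\<^sup>2) ^ k * exp B"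
      by (simp add: abs_mult)
  qed
qed (auto intro: integrable_weight)

text \<open>The averages are moved to the fixed space \<open>joint\<close>. There, for each outcome,
  the observation tends to 0 inside a parabola, and a multiple of \<open>(1 + X^2) ^ p\<close>
  dominates for all \<open>s\<close>.\<close>

lemma expect_tendsto:
  "(\<lambda>n. expect (1 / real (Suc n)) (\<lambda>K. monoval K xs)) \<longlonglongrightarrow> monoval (kap 0 0) xs"
proof -
  define sq where "sq n = 1 / real (Suc n)" for n
  have s: "sq n > 0" for n by (simp add: sq_def)
  have sq0: "sq \<longlonglongrightarrow> 0" unfolding sq_def[abs_def] by (rule LIMSEQ_Suc) (rule lim_1_over_n)
  define p where "p = sum_list xs"
  \<comment> \<open>Averaging a function of the observation against \<open>wt p / mom 0\<close> is averaging it against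
    \<open>(1 + X^2)^p\<close>; dividing by this weight leaves the bounded function \<open>r\<close>.\<close>
  define r where "r s u = mom 0 s u * monoval (kap s u) xs / wt p s u" for s u
  obtain C where C: "C \<ge> 0" "\<And>K A. dominated cumC K A \<Longrightarrow> \<bar>monoval K xs\<bar> \<le> C * A p"
    using bdd_monoval[of cumC xs] by (auto simp: bdd_def p_def)
  have wpos: "wt p s u > 0" if "s > 0" for s u
    using mom_0_le_wt[OF that, of u p] mom_0_pos[OF that, of u] by simp
  have rb: "\<bar>r s u\<bar> \<le> C" if "s > 0" for s u
  proof -
    have "\<bar>monoval (kap s u) xs\<bar> \<le> C * (wt p s u / mom 0 s u)" by (rule C(2)[OF dominated_kap[OF that]])
    then show ?thesis
      using mom_0_pos[OF that, of u] wpos[OF that, of u] by (simp add: r_def abs_mult field_simps)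
  qed
  have rm [measurable]: "r s \<in> borel_measurable borel" if "s > 0" for s
  proof -
    have "continuous_on UNIV (r s)"
      unfolding r_def using wpos[OF that]
      by (intro continuous_intros continuous_mom continuous_wt that
          continuous_on_monoval[where K = "\<lambda>i u. kap s u i"] continuous_kap) (auto simp: less_le)
    then show ?thesis by (rule borel_measurable_continuous_onI)
  qed
  have wj: "integrable joint (\<lambda>\<omega>. (1 + (fst \<omega>)\<^sup>2) ^ p)"
    by (rule integrable_joint_fst[OF integrable_weight])
  have ex: "expect (sq n) (\<lambda>K. monoval K xs) = (\<integral>\<omega>. (1 + (fst \<omega>)\<^sup>2) ^ p * r (sq n) (obs (sq n) \<omega>) \<partial>joint)" for n
  proof -
    have [measurable]: "r (sq n) \<in> borel_measurable borel" by (rule rm[OF s])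
    have "integrable joint (\<lambda>\<omega>. (1 + (fst \<omega>)\<^sup>2) ^ p * r (sq n) (obs (sq n) \<omega>))"
    proof (rule Bochner_Integration.integrable_bound[where f = "\<lambda>\<omega>. (1 + (fst \<omega>)\<^sup>2) ^ p * C"])
      show "AE \<omega> in joint. norm ((1 + (fst \<omega>)\<^sup>2) ^ p * r (sq n) (obs (sq n) \<omega>)) \<le> norm ((1 + (fst \<omega>)\<^sup>2) ^ p * C)"
        using rb[OF s] C(1) by (auto simp: abs_mult intro!: AE_I2 mult_left_mono)
    qed (use wj in auto)
    then have "(\<integral>\<omega>. (1 + (fst \<omega>)\<^sup>2) ^ p * r (sq n) (obs (sq n) \<omega>) \<partial>joint)
       = (\<integral>u. gauss (sq n) u * r (sq n) u * (\<integral>x. (1 + x\<^sup>2) ^ p * tilt (sq n) u x \<partial>\<mu>) \<partial>lborel)"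
      by (intro tower[where f = "\<lambda>x. (1 + x\<^sup>2) ^ p"] s) auto
    also have "\<dots> = expect (sq n) (\<lambda>K. monoval K xs)"
      unfolding expect_def wt_def[symmetric] r_def dens_def using wpos[OF s[of n]] by (simp add: less_le mult_ac)
    finally show ?thesis by simp
  qed
  have w00: "wt p 0 0 > 0"
    unfolding wt_def by (rule integral_pos_of_pos) (auto intro: integrable_weight simp: add_pos_nonneg)
  have "(\<lambda>n. \<integral>\<omega>. (1 + (fst \<omega>)\<^sup>2) ^ p * r (sq n) (obs (sq n) \<omega>) \<partial>joint)
     \<longlonglongrightarrow> (\<integral>\<omega>. (1 + (fst \<omega>)\<^sup>2) ^ p * r 0 0 \<partial>joint)"
  proof (rule integral_dominated_convergence[where w = "\<lambda>\<omega>. (1 + (fst \<omega>)\<^sup>2) ^ p * C"])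
    show "(\<lambda>\<omega>. (1 + (fst \<omega>)\<^sup>2) ^ p * r (sq n) (obs (sq n) \<omega>)) \<in> borel_measurable joint" for n
      using rm[OF s[of n]] by measurable
    show "AE \<omega> in joint. norm ((1 + (fst \<omega>)\<^sup>2) ^ p * r (sq n) (obs (sq n) \<omega>)) \<le> (1 + (fst \<omega>)\<^sup>2) ^ p * C" for n
      using rb[OF s] C(1) by (auto simp: abs_mult intro!: AE_I2 mult_left_mono)
    show "AE \<omega> in joint. (\<lambda>n. (1 + (fst \<omega>)\<^sup>2) ^ p * r (sq n) (obs (sq n) \<omega>)) \<longlonglongrightarrow> (1 + (fst \<omega>)\<^sup>2) ^ p * r 0 0"
    proof (rule AE_I2)
      fix \<omega> :: "real \<times> real"
      obtain x y where \<omega>: "\<omega> = (x, y)" by (cases \<omega>)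
      define uq where "uq n = obs (sq n) \<omega>" for n
      have u0: "uq \<longlonglongrightarrow> 0"
      proof -
        have "(\<lambda>n. sq n * x + sqrt (sq n) * y) \<longlonglongrightarrow> 0 * x + sqrt 0 * y"
          by (intro tendsto_intros sq0)
        then show ?thesis by (simp add: uq_def[abs_def] obs_def \<omega>)
      qed
      \<comment> \<open>As \<open>obs s\<close> is \<open>sqrt s * (sqrt s * x + y)\<close> and
        \<open>s \<le> 1\<close>, the ratio \<open>u^2 / (2 * s)\<close> is bounded for each
        outcome.\<close>
      have ub: "(uq n)\<^sup>2 / (2 * sq n) \<le> (\<bar>x\<bar> + \<bar>y\<bar>)\<^sup>2 / 2" for n
      proof -
        have "uq n = sqrt (sq n) * (sqrt (sq n) * x + y)"
          using s[of n] by (simp add: uq_def obs_def \<omega> distrib_left)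
        then have "(uq n)\<^sup>2 / (2 * sq n) = (sqrt (sq n) * x + y)\<^sup>2 / 2"
          using s[of n] by (simp add: power_mult_distrib)
        also have "\<dots> \<le> (\<bar>x\<bar> + \<bar>y\<bar>)\<^sup>2 / 2"
        proof -
          have "sqrt (sq n) \<le> 1" by (simp add: sq_def)
          then have "\<bar>sqrt (sq n) * x\<bar> \<le> \<bar>x\<bar>"
            using s[of n] by (simp add: abs_mult mult_left_le_one_le)
          then have "\<bar>sqrt (sq n) * x + y\<bar> \<le> \<bar>\<bar>x\<bar> + \<bar>y\<bar>\<bar>" by linarith
          then have "(sqrt (sq n) * x + y)\<^sup>2 \<le> (\<bar>x\<bar> + \<bar>y\<bar>)\<^sup>2" by (simp only: abs_le_square_iff)
          then show ?thesis by simp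
        qed
        finally show ?thesis .
      qed
      have m: "(\<lambda>n. mom k (sq n) (uq n)) \<longlonglongrightarrow> mom k 0 0" for k
        by (rule mom_tendsto[OF s sq0 u0 ub])
      have K: "(\<lambda>n. kap (sq n) (uq n) i) \<longlonglongrightarrow> kap 0 0 i" for i
        unfolding kap_def by (rule tendsto_cum[OF m]) (simp add: mom_0_0(2))
      have w: "(\<lambda>n. wt p (sq n) (uq n)) \<longlonglongrightarrow> wt p 0 0"
        using s by (simp add: wt_eq_mom) (intro tendsto_intros m)
      have "(\<lambda>n. r (sq n) (uq n)) \<longlonglongrightarrow> r 0 0"
        unfolding r_def using w00 by (intro tendsto_intros m w tendsto_monoval K) simp
      then show "(\<lambda>n. (1 + (fst \<omega>)\<^sup>2) ^ p * r (sq n) (obs (sq n) \<omega>)) \<longlonglongrightarrow> (1 + (fst \<omega>)\<^sup>2) ^ p * r 0 0"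
        unfolding uq_def by (intro tendsto_intros)
    qed
  qed (use wj in auto)
  \<comment> \<open>The weight integrates to \<open>wt p 0 0\<close>, which is the denominator of
    \<open>r 0 0\<close>.\<close>
  moreover have "(\<integral>\<omega>. (1 + (fst \<omega>)\<^sup>2) ^ p * r 0 0 \<partial>joint) = monoval (kap 0 0) xs"
  proof -
    have "(\<integral>\<omega>. (1 + (fst \<omega>)\<^sup>2) ^ p \<partial>joint) = wt p 0 0"
      using integral_joint_fst[OF integrable_weight[of p]] by (simp add: wt_def)
    then show ?thesis using w00 wj by (simp add: r_def mom_0_0(2))
  qed
  ultimately show ?thesis unfolding ex[symmetric] by (simp add: sq_def)
qed

end

section \<open>Evaluation of the polynomials\<close>

text \<open>The linear extension of a function on monomials. Studying the operators through
  \<open>lin g\<close> with arbitrary \<open>g\<close> avoids normal forms of polynomials.\<close>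

definition lin :: "(nat multiset \<Rightarrow> 'a::field_char_0) \<Rightarrow> tpoly \<Rightarrow> 'a" where
  "lin g p = (\<Sum>M\<in>Poly_Mapping.keys p. of_rat (Poly_Mapping.lookup p M) * g M)"

definition reval :: "tpoly \<Rightarrow> (nat \<Rightarrow> 'a::field_char_0) \<Rightarrow> 'a" where
  "reval p K = lin (\<lambda>M. monoval K (sorted_list_of_multiset M)) p"

text \<open>Keys can cancel in a sum of polynomials, so sums over keys are compared on a common
  finite superset.\<close>

lemma sum_keys_superset:
  assumes "finite S" "Poly_Mapping.keys p \<subseteq> S" "\<And>M. f M 0 = 0"
  shows "(\<Sum>M\<in>Poly_Mapping.keys p. f M (Poly_Mapping.lookup p M)) = (\<Sum>M\<in>S. f M (Poly_Mapping.lookup p M))"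
  using assms by (intro sum.mono_neutral_left) (auto simp: in_keys_iff)

lemma sum_keys_add:
  fixes f :: "'k \<Rightarrow> 'c::comm_monoid_add \<Rightarrow> 'd::comm_monoid_add"
  assumes f0: "\<And>M. f M 0 = 0" and fa: "\<And>M a b. f M (a + b) = f M a + f M b"
  shows "(\<Sum>M\<in>Poly_Mapping.keys (p + q). f M (Poly_Mapping.lookup (p + q) M))
    = (\<Sum>M\<in>Poly_Mapping.keys p. f M (Poly_Mapping.lookup p M)) + (\<Sum>M\<in>Poly_Mapping.keys q. f M (Poly_Mapping.lookup q M))"
proof -
  let ?S = "Poly_Mapping.keys p \<union> Poly_Mapping.keys q"
  have "Poly_Mapping.keys (p + q) \<subseteq> ?S" by (rule Poly_Mapping.keys_add)
  then show ?thesis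
    using sum_keys_superset[where S = ?S and f = f and p = "p + q"] sum_keys_superset[where S = ?S and f = f and p = p]
      sum_keys_superset[where S = ?S and f = f and p = q]
    by (simp add: f0 lookup_add fa sum.distrib)
qed

lemma lin_0 [simp]: "lin g 0 = 0"
  by (simp add: lin_def)

lemma lin_add: "lin g (p + q) = lin g p + lin g q"
  unfolding lin_def by (rule sum_keys_add) (simp_all add: of_rat_add distrib_right)

lemma lin_single [simp]: "lin g (Poly_Mapping.single M c) = of_rat c * g M"
  by (simp add: lin_def)

lemma lin_sum: "lin g (sum p I) = (\<Sum>i\<in>I. lin g (p i))"
  by (induction I rule: infinite_finite_induct) (auto simp: lin_add)

lemma lin_cong: "(\<And>M. M \<in> Poly_Mapping.keys p \<Longrightarrow> g M = h M) \<Longrightarrow> lin g p = lin h p"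
  by (simp add: lin_def)

lemma monoval_mset: "mset xs = mset ys \<Longrightarrow> monoval K xs = monoval K ys"
  unfolding monoval_def by (metis mset_map prod_mset_prod_list)

lemma monoval_eq_prod_mset: "monoval K (sorted_list_of_multiset M) = (\<Prod>i\<in>#M. K i)"
  unfolding monoval_def by (metis mset_map mset_sorted_list_of_multiset prod_mset_prod_list)

lemma monoval_sort [simp]: "monoval K (sort xs) = monoval K xs"
  by (rule monoval_mset) simp

lemma monoval_append: "monoval K (xs @ ys) = monoval K xs * monoval K ys"
  by (simp add: monoval_def)

lemma peval_eq_reval: "peval p x = reval p x"
  by (simp add: peval_def reval_def lin_def monoval_eq_prod_mset)

lemma of_real_reval: "of_real (reval p K) = (reval p (\<lambda>i. of_real (K i)) :: complex)"
proof -
  have "of_real (\<Prod>i\<in>#M. K i) = (\<Prod>i\<in>#M. of_real (K i) :: complex)" for M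
    by (induction M) auto
  moreover have "of_real (of_rat c) = (of_rat c :: complex)" for c
    by (cases c) (simp add: of_rat_rat)
  ultimately show ?thesis by (simp add: reval_def lin_def monoval_eq_prod_mset)
qed

lemma reval_0: "reval 0 K = 0"
  by (simp add: reval_def)

lemma reval_add: "reval (p + q) K = reval p K + reval q K"
  by (simp add: reval_def lin_add)

lemma shift1_eq_sum: "shift1 K xs = (\<Sum>j<length xs. monoval K (xs[j := Suc (xs ! j)]))"
  by (induction xs) (simp_all add: sum.lessThan_Suc_shift sum_distrib_left del: sum.lessThan_Suc)

lemma Lval_eq_sum:
  "Lval K xs = (\<Sum>j<length xs. \<Sum>i<j. monoval K (xs[i := Suc (xs ! i), j := Suc (xs ! j)]))"
proof (induction xs)
  case (Cons x xs)
  then show ?case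
    by (simp add: sum.lessThan_Suc_shift sum_distrib_left sum.distrib shift1_eq_sum del: sum.lessThan_Suc)
qed simp

lemma Hval_eq_sum:
  fixes K :: "nat \<Rightarrow> 'a::field_char_0"
  shows "Hval K xs = (\<Sum>k<length xs. \<Sum>l\<in>{1..<xs ! k}. - (1 / 2) * of_nat ((xs ! k) choose l) *
    (monoval K (del_at k xs) * (K (1 + l) * K (1 + (xs ! k - l)))))"
proof (induction xs)
  case (Cons x xs)
  have "splitval K x * monoval K xs = (\<Sum>l\<in>{1..<x}. - (1 / 2) * of_nat (x choose l) *
    (monoval K xs * (K (1 + l) * K (1 + (x - l)))))"
    unfolding splitval_def by (simp add: sum_distrib_left sum_divide_distrib sum_negf[symmetric] mult_ac)
  then show ?case
    using Cons by (simp add: sum.lessThan_Suc_shift sum_distrib_left del_at_def mult_ac del: sum.lessThan_Suc)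
qed simp

lemma of_rat_neg_half: "of_rat (- (1 / 2) * of_nat c * d) = (- (1 / 2) * of_nat c * of_rat d :: 'a::field_char_0)"
  by (simp add: of_rat_mult of_rat_minus of_rat_divide)

text \<open>The operator is transposed: it acts on the function \<open>g\<close> of monomials, and
  the polynomial stays as it is.\<close>

lemma lin_Lop: "lin g (Lop p) = lin (\<lambda>M. let xs = sorted_list_of_multiset M in
    \<Sum>j<length xs. \<Sum>i<j. g (mset (xs[i := Suc (xs ! i), j := Suc (xs ! j)]))) p"
  unfolding Lop_def Let_def lin_sum lin_single by (simp add: lin_def sum_distrib_left)

lemma lin_Hop: "lin g (Hop p) = lin (\<lambda>M. let xs = sorted_list_of_multiset M in
    \<Sum>k<length xs. \<Sum>l\<in>{1..<xs ! k}. - (1 / 2) * of_nat ((xs ! k) choose l) *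
      g (mset (del_at k xs) + {#1 + l, 1 + (xs ! k - l)#})) p"
  unfolding Hop_def Let_def lin_sum lin_single of_rat_neg_half by (simp add: lin_def sum_distrib_left mult_ac)

lemma reval_Lop: "reval (Lop p) K = lin (\<lambda>M. Lval K (sorted_list_of_multiset M)) p"
  by (simp add: reval_def lin_Lop Lval_eq_sum Let_def)

lemma reval_Hop:
  fixes K :: "nat \<Rightarrow> 'a::field_char_0"
  shows "reval (Hop p) K = lin (\<lambda>M. Hval K (sorted_list_of_multiset M)) p"
proof -
  have "monoval K (sorted_list_of_multiset (mset ys + {#a, b#})) = monoval K ys * (K a * K b)" for ys a b
  proof -
    have "mset ys + {#a, b#} = mset (ys @ [a, b])" by simp
    then show ?thesis
      by (simp only: sorted_list_of_multiset_mset monoval_sort) (simp add: monoval_append)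
  qed
  then show ?thesis by (simp add: reval_def lin_Hop Hval_eq_sum Let_def)
qed

lemma reval_Apoly:
  fixes K :: "nat \<Rightarrow> 'a::field_char_0"
  shows "reval (Apoly n) K = 2 * splitval K n * K n"
proof -
  have "monoval K (sorted_list_of_multiset {#a, b, c#}) = K a * K b * K c" for a b c
    unfolding monoval_eq_prod_mset by (simp add: mult_ac)
  then show ?thesis
    unfolding reval_def Apoly_def lin_sum lin_single
    by (simp add: splitval_def of_rat_minus sum_distrib_left sum_negf mult_ac
        del: sorted_list_of_multiset_insert)
qed

text \<open>As \<open>L\<close> takes \<open>T_n^2\<close> to \<open>T_(n+1)^2\<close> and
  \<open>H\<close> takes it to \<open>A_n\<close>, adding \<open>T_n^2\<close> makes the recursion
  for \<open>R\<close> homogeneous: \<open>G_(n+1) = L G_n + H G_n\<close> for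
  \<open>n \<ge> 2\<close>.\<close>

definition Gpoly :: "nat \<Rightarrow> tpoly" where
  "Gpoly n = Poly_Mapping.single {#n, n#} 1 + Rpoly n"

lemma reval_Gpoly: "reval (Gpoly n) K = (K n)\<^sup>2 + reval (Rpoly n) K"
  by (simp add: Gpoly_def reval_add) (simp add: reval_def power2_eq_square)

lemma reval_Gpoly_Suc:
  fixes K :: "nat \<Rightarrow> 'a::field_char_0"
  assumes "n \<ge> 2"
  shows "reval (Lop (Gpoly n) + Hop (Gpoly n)) K = reval (Gpoly (Suc n)) K"
  using assms unfolding reval_Gpoly
  by (simp add: reval_add reval_Lop reval_Hop Gpoly_def lin_add reval_Apoly power2_eq_square algebra_simps)

section \<open>Weight and degree of the polynomials\<close>

definition keys_in :: "nat multiset set \<Rightarrow> tpoly \<Rightarrow> bool" where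
  "keys_in Q p \<longleftrightarrow> Poly_Mapping.keys p \<subseteq> Q"

lemma keys_in_add: "keys_in Q p \<Longrightarrow> keys_in Q q \<Longrightarrow> keys_in Q (p + q)"
  unfolding keys_in_def using Poly_Mapping.keys_add[of p q] by blast

lemma keys_in_sum: "(\<And>i. i \<in> I \<Longrightarrow> keys_in Q (p i)) \<Longrightarrow> keys_in Q (sum p I)"
proof (induction I rule: infinite_finite_induct)
  case (insert i I)
  then show ?case by (simp add: keys_in_add)
qed (simp_all add: keys_in_def)

lemma keys_in_single: "M \<in> Q \<Longrightarrow> keys_in Q (Poly_Mapping.single M c)"
  by (simp add: keys_in_def)

text \<open>\<open>R_n\<close> will be shown to have weight \<open>2 * n\<close> and indices
  strictly between 0 and \<open>n\<close>. The weight limits degrees; the index range limits which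
  cumulants enter.\<close>

definition wtset :: "nat \<Rightarrow> nat \<Rightarrow> nat multiset set" where
  "wtset w n = {M. sum_mset M = w \<and> (\<forall>i\<in>#M. 0 < i \<and> i < n)}"

lemma sum_list_update_Suc: "i < length xs \<Longrightarrow> sum_list (xs[i := Suc (xs ! i)]) = Suc (sum_list xs)"
  by (simp add: sum_list_update)

lemma keys_in_Lop:
  assumes "keys_in (wtset w n) p"
  shows "keys_in (wtset (w + 2) (Suc n)) (Lop p)"
  unfolding Lop_def Let_def
proof (intro keys_in_sum keys_in_single)
  fix M :: "nat multiset" and j i
  let ?xs = "sorted_list_of_multiset M"
  assume M: "M \<in> Poly_Mapping.keys p" and j: "j \<in> {..<length ?xs}" and i: "i \<in> {..<j}"
  then have M': "sum_mset M = w" "\<forall>i\<in>#M. 0 < i \<and> i < n" using assms by (auto simp: keys_in_def wtset_def)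
  then have xs: "sum_list ?xs = w" "\<forall>y\<in>set ?xs. 0 < y \<and> y < n"
    by (simp_all flip: sum_mset_sum_list)
  let ?ys = "?xs[i := Suc (?xs ! i)]"
  \<comment> \<open>As \<open>i < j\<close>, the first update leaves position \<open>j\<close>
    alone, and each update adds one to the sum.\<close>
  have "?ys[j := Suc (?xs ! j)] = ?ys[j := Suc (?ys ! j)]" using i by simp
  also have "sum_list \<dots> = w + 2"
    using i j xs(1) by (simp only: sum_list_update_Suc length_list_update lessThan_iff)
  finally have "sum_list (?xs[i := Suc (?xs ! i), j := Suc (?xs ! j)]) = w + 2" .
  moreover have "0 < y \<and> y < Suc n" if "y \<in> set (?xs[i := Suc (?xs ! i), j := Suc (?xs ! j)])" for y
  proof -
    have "y \<in> insert (Suc (?xs ! j)) (insert (Suc (?xs ! i)) (set ?xs))"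
      using that set_update_subset_insert[of ?ys j "Suc (?xs ! j)"] set_update_subset_insert[of ?xs i "Suc (?xs ! i)"] by blast
    moreover have "?xs ! j \<in> set ?xs" "?xs ! i \<in> set ?xs" using i j by (auto intro!: nth_mem simp del: set_sorted_list_of_multiset)
    ultimately show ?thesis using xs(2) by (auto intro: less_SucI)
  qed
  ultimately show "mset (?xs[i := Suc (?xs ! i), j := Suc (?xs ! j)]) \<in> wtset (w + 2) (Suc n)"
    unfolding wtset_def by (simp add: sum_mset_sum_list)
qed

lemma mset_del_at:
  assumes "k < length xs"
  shows "mset xs = add_mset (xs ! k) (mset (del_at k xs))"
proof -
  have "mset xs = mset (take k xs @ xs ! k # drop (Suc k) xs)"
    by (rule arg_cong[where f = mset, OF id_take_nth_drop[OF assms]])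
  then show ?thesis by (simp only: del_at_def mset_append mset.simps union_mset_add_mset_right)
qed

lemma keys_in_Hop:
  assumes "keys_in (wtset w n) p"
  shows "keys_in (wtset (w + 2) (Suc n)) (Hop p)"
  unfolding Hop_def Let_def
proof (intro keys_in_sum keys_in_single)
  fix M :: "nat multiset" and k l
  let ?xs = "sorted_list_of_multiset M"
  assume M: "M \<in> Poly_Mapping.keys p" and k: "k \<in> {..<length ?xs}" and l: "l \<in> {1..<?xs ! k}"
  then have M': "sum_mset M = w" "\<forall>i\<in>#M. 0 < i \<and> i < n" using assms by (auto simp: keys_in_def wtset_def)
  define a N where "a = ?xs ! k" and "N = mset (del_at k ?xs)"
  have "M = add_mset a N" using mset_del_at[of k ?xs] k by (simp add: a_def N_def)
  with M' have "a + sum_mset N = w" "\<forall>i\<in>#N. 0 < i \<and> i < n" "0 < a \<and> a < n" by auto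
  with l show "mset (del_at k ?xs) + {#1 + l, 1 + (?xs ! k - l)#} \<in> wtset (w + 2) (Suc n)"
    unfolding wtset_def a_def[symmetric] N_def[symmetric] by (auto intro: less_SucI)
qed

lemma keys_in_Apoly: "n \<ge> 2 \<Longrightarrow> keys_in (wtset (2 * Suc n) (Suc n)) (Apoly n)"
  unfolding Apoly_def by (intro keys_in_sum keys_in_single) (auto simp: wtset_def)

lemma keys_in_Rpoly: "keys_in (wtset (2 * n) n) (Rpoly n)"
proof (induction n)
  case 0
  show ?case by (simp add: keys_in_def)
next
  case (Suc n)
  show ?case
    using keys_in_Lop[OF Suc] keys_in_Hop[OF Suc] keys_in_Apoly[of n]
    by (auto intro!: keys_in_add) (simp add: keys_in_def)
qed

lemma reval_Rpoly_cong:
  assumes "\<And>i. 0 < i \<Longrightarrow> i < n \<Longrightarrow> K i = K' i"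
  shows "reval (Rpoly n) K = reval (Rpoly n) K'"
  unfolding reval_def
proof (rule lin_cong)
  fix M assume "M \<in> Poly_Mapping.keys (Rpoly n)"
  then have "\<forall>i\<in>#M. 0 < i \<and> i < n" using keys_in_Rpoly[of n] by (auto simp: keys_in_def wtset_def)
  then show "monoval K (sorted_list_of_multiset M) = monoval K' (sorted_list_of_multiset M)"
    unfolding monoval_def using assms by (intro arg_cong[where f = prod_list] map_cong) auto
qed

lemma reval_coeffT: "reval (coeffT n j p) K
  = (\<Sum>M\<in>{M\<in>Poly_Mapping.keys p. count M n = j}. of_rat (Poly_Mapping.lookup p M) * (\<Prod>i\<in>#filter_mset (\<lambda>i. i \<noteq> n) M. K i))"
  unfolding reval_def coeffT_def lin_sum lin_single monoval_eq_prod_mset ..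

lemma prod_mset_split:
  "(\<Prod>i\<in>#M. K i) = K n ^ count M n * (\<Prod>i\<in>#filter_mset (\<lambda>i. i \<noteq> n) M. (K i :: 'a::comm_ring_1))"
proof -
  have "M = filter_mset (\<lambda>i. i = n) M + filter_mset (\<lambda>i. i \<noteq> n) M" by (rule multiset_partition)
  then have "image_mset K M = image_mset K (filter_mset (\<lambda>i. i = n) M) + image_mset K (filter_mset (\<lambda>i. i \<noteq> n) M)"
    by (metis image_mset_union)
  then show ?thesis by (simp add: filter_eq_replicate_mset)
qed

lemma reval_quadratic:
  assumes "\<And>M. M \<in> Poly_Mapping.keys p \<Longrightarrow> count M n \<le> 2"
  shows "reval p K = reval (coeffT n 0 p) K + reval (coeffT n 1 p) K * K n + reval (coeffT n 2 p) K * (K n)\<^sup>2"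
proof -
  let ?S = "\<lambda>j. {M\<in>Poly_Mapping.keys p. count M n = j}"
  let ?f = "\<lambda>M. of_rat (Poly_Mapping.lookup p M) * (\<Prod>i\<in>#M. K i)"
  have f: "sum ?f (?S j) = reval (coeffT n j p) K * K n ^ j" for j
    unfolding reval_coeffT sum_distrib_right
  proof (rule sum.cong)
    fix M assume "M \<in> ?S j"
    then show "?f M = of_rat (Poly_Mapping.lookup p M) * (\<Prod>i\<in>#filter_mset (\<lambda>i. i \<noteq> n) M. K i) * K n ^ j"
      unfolding prod_mset_split[of K M n] by simp
  qed simp
  have "Poly_Mapping.keys p = ?S 0 \<union> ?S 1 \<union> ?S 2" using assms by (auto simp: le_Suc_eq numeral_2_eq_2)
  then have "reval p K = sum ?f (?S 0 \<union> ?S 1 \<union> ?S 2)"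
    unfolding reval_def lin_def monoval_eq_prod_mset by simp
  also have "\<dots> = sum ?f (?S 0) + sum ?f (?S 1) + sum ?f (?S 2)"
  proof -
    have "sum ?f (?S 0 \<union> ?S 1 \<union> ?S 2) = sum ?f (?S 0 \<union> ?S 1) + sum ?f (?S 2)"
      by (rule sum.union_disjoint) auto
    moreover have "sum ?f (?S 0 \<union> ?S 1) = sum ?f (?S 0) + sum ?f (?S 1)"
      by (rule sum.union_disjoint) auto
    ultimately show ?thesis by simp
  qed
  finally show ?thesis by (simp add: f)
qed

text \<open>\<open>T_n^3\<close> has weight \<open>3 * n\<close>, which exceeds the weight
  \<open>2 * n + 2\<close> of \<open>R_(n+1)\<close> once \<open>n \<ge> 3\<close>.\<close>

lemma count_Rpoly_le:
  assumes "n \<ge> 3" "M \<in> Poly_Mapping.keys (Rpoly (Suc n))"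
  shows "count M n \<le> 2"
proof (rule ccontr)
  assume "\<not> count M n \<le> 2"
  then have "3 \<le> count M n" by simp
  then have "replicate_mset 3 n \<subseteq># M" using count_le_replicate_mset_subset_eq[of 3 M n] by blast
  then obtain N where "M = replicate_mset 3 n + N" by (auto simp: subset_mset.le_iff_add)
  moreover have "sum_mset M = 2 * Suc n" using assms(2) keys_in_Rpoly[of "Suc n"] by (auto simp: keys_in_def wtset_def)
  ultimately show False using assms(1) by (simp add: numeral_3_eq_3)
qed

lemma reval_coeffT_cong:
  assumes "\<And>i. 0 < i \<Longrightarrow> i < n \<Longrightarrow> K i = K' i"
  shows "reval (coeffT n j (Rpoly (Suc n))) K = reval (coeffT n j (Rpoly (Suc n))) K'"
  unfolding reval_coeffT
proof (rule sum.cong)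
  fix M assume "M \<in> {M \<in> Poly_Mapping.keys (Rpoly (Suc n)). count M n = j}"
  then have "\<forall>i\<in>#M. 0 < i \<and> i < Suc n" using keys_in_Rpoly[of "Suc n"] by (auto simp: keys_in_def wtset_def)
  then have "image_mset K (filter_mset (\<lambda>i. i \<noteq> n) M) = image_mset K' (filter_mset (\<lambda>i. i \<noteq> n) M)"
    using assms by (intro image_mset_cong) (auto simp: less_Suc_eq)
  then show "of_rat (Poly_Mapping.lookup (Rpoly (Suc n)) M) * (\<Prod>i\<in>#filter_mset (\<lambda>i. i \<noteq> n) M. K i) =
    of_rat (Poly_Mapping.lookup (Rpoly (Suc n)) M) * (\<Prod>i\<in>#filter_mset (\<lambda>i. i \<noteq> n) M. K' i)"
    by simp
qed simp

text \<open>The equation at \<open>n\<close> gives equal squares, so at \<open>Suc n\<close> the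
  constant and quadratic parts agree and only the linear part is left to compare.\<close>

lemma sign_determined:
  fixes K K' :: "nat \<Rightarrow> 'a::field_char_0"
  assumes "n \<ge> 3" and below: "\<And>i. 0 < i \<Longrightarrow> i < n \<Longrightarrow> K i = K' i" and "K (Suc n) = 0" "K' (Suc n) = 0"
    and eq: "reval (Gpoly n) K = reval (Gpoly n) K'" "reval (Gpoly (Suc n)) K = reval (Gpoly (Suc n)) K'"
    and nz: "reval (apoly n) K \<noteq> 0"
  shows "K n = K' n"
proof -
  have sq: "(K n)\<^sup>2 = (K' n)\<^sup>2"
    using eq(1) reval_Rpoly_cong[of n K K'] below by (simp add: reval_Gpoly)
  have "reval (Rpoly (Suc n)) K = reval (Rpoly (Suc n)) K'"
    using eq(2) assms(3,4) by (simp add: reval_Gpoly del: Rpoly.simps)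
  moreover have "reval (Rpoly (Suc n)) L = reval (coeffT n 0 (Rpoly (Suc n))) L + reval (apoly n) L * L n
      + reval (coeffT n 2 (Rpoly (Suc n))) L * (L n)\<^sup>2" for L :: "nat \<Rightarrow> 'a"
    unfolding apoly_def by (rule reval_quadratic) (rule count_Rpoly_le[OF assms(1)])
  moreover have "reval (coeffT n j (Rpoly (Suc n))) K = reval (coeffT n j (Rpoly (Suc n))) K'" for j
    by (rule reval_coeffT_cong[OF below])
  moreover have "reval (apoly n) K = reval (apoly n) K'"
    unfolding apoly_def by (rule reval_coeffT_cong[OF below])
  ultimately have "reval (apoly n) K * K n = reval (apoly n) K * K' n" by (simp add: sq del: Rpoly.simps)
  then show ?thesis using nz by simp
qed

section \<open>The first polynomials\<close>

lemma sum_lessThan_upt: "(\<Sum>i<n. f i) = sum_list (map f [0..<n])" for f :: "nat \<Rightarrow> 'a::comm_monoid_add"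
  by (simp add: interv_sum_list_conv_sum_set_nat atLeast0LessThan)

lemma sum_atLeastLessThan_upt: "(\<Sum>i\<in>{a..<b}. f i) = sum_list (map f [a..<b])" for f :: "nat \<Rightarrow> 'a::comm_monoid_add"
  by (simp add: interv_sum_list_conv_sum_set_nat)

lemma upt_small: "[0..<2] = [0, 1]" "[0..<3] = [0, 1, 2]" "[0..<4] = [0, 1, 2, 3]"
  "[0..<5] = [0, 1, 2, 3, 4]" "[0..<6] = [0, 1, 2, 3, 4, 5]"
  "[Suc 0..<2] = [1]" "[Suc 0..<3] = [1, 2]" "[Suc 0..<4] = [1, 2, 3]"
  "[Suc 0..<5] = [1, 2, 3, 4]" "[Suc 0..<6] = [1, 2, 3, 4, 5]"
  by (simp_all add: eval_nat_numeral)

lemma lin_Rpoly_Suc: "n \<ge> 2 \<Longrightarrow> lin g (Rpoly (Suc n)) = lin g (Apoly n) + lin g (Lop (Rpoly n)) + lin g (Hop (Rpoly n))"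
  by (simp add: lin_add)

lemma lin_Apoly: "lin g (Apoly n) = (\<Sum>k\<in>{1..<n}. - of_nat (n choose k) * g {#1 + k, 1 + (n - k), n#})"
  unfolding Apoly_def lin_sum lin_single by (simp add: of_rat_minus)

text \<open>With \<open>g\<close> arbitrary, collecting like monomials becomes arithmetic with the
  unknown values of \<open>g\<close>.\<close>

lemma lin_R3: "lin g (Rpoly 3) = - 2 * g {#2, 2, 2#}"
  using lin_Rpoly_Suc[of 2 g]
  by (simp add: lin_Apoly lin_Lop lin_Hop numeral_2_eq_2 numeral_3_eq_3)

lemmas R_simps = lin_Apoly lin_Lop lin_Hop Let_def sum_lessThan_upt sum_atLeastLessThan_upt upt_small
  upt_rec_numeral del_at_def add_mset_commute numeral_2_eq_2[symmetric]

lemma choose_small: "3 choose 2 = 3" "4 choose 2 = 6" "4 choose 3 = 4" "5 choose 2 = 10" "5 choose 3 = 10"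
  "5 choose 4 = 5" "6 choose 2 = 15" "6 choose 3 = 20" "6 choose 4 = 15" "6 choose 5 = 6"
  by (simp_all add: eval_nat_numeral)

lemma lin_R4: "lin g (Rpoly 4) = 6 * g {#2, 2, 2, 2#} - 12 * g {#2, 3, 3#}"
  using lin_Rpoly_Suc[of 3 g] by (simp add: R_simps lin_R3 choose_small)

lemma lin_R5: "lin g (Rpoly 5) = - 24 * g {#2, 2, 2, 2, 2#} + 120 * g {#2, 2, 3, 3#} - 20 * g {#2, 4, 4#} - 30 * g {#3, 3, 4#}"
  using lin_Rpoly_Suc[of 4 g] by (simp add: R_simps lin_R4 choose_small)

lemma lin_R6: "lin g (Rpoly 6) = 120 * g {#2, 2, 2, 2, 2, 2#} - 1200 * g {#2, 2, 2, 3, 3#} + 300 * g {#2, 2, 4, 4#}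
    + 900 * g {#2, 3, 3, 4#} - 30 * g {#2, 5, 5#} + 210 * g {#3, 3, 3, 3#} - 120 * g {#3, 4, 5#} - 30 * g {#4, 4, 4#}"
  using lin_Rpoly_Suc[of 5 g] by (simp add: R_simps lin_R5 choose_small)

lemma reval_R6_even:
  assumes "K 3 = 0" "K 5 = 0"
  shows "reval (Rpoly 6) K = 120 * K 2 ^ 6 + 300 * (K 2)\<^sup>2 * (K 4)\<^sup>2 - 30 * K 4 ^ 3"
  using assms by (simp add: reval_def lin_R6 power_numeral_reduce)

text \<open>Substituting \<open>K 3 = K 5 = 0\<close> into the transposed operators on
  \<open>R_6\<close> spares the full expansion of \<open>R_7\<close>.\<close>

lemma reval_R7_even:
  assumes "K 3 = 0" "K 5 = 0"
  shows "reval (Rpoly 7) K = - 720 * K 2 ^ 7 - 4200 * K 2 ^ 3 * (K 4)\<^sup>2 + 1260 * K 2 * K 4 ^ 3 - 42 * K 2 * (K 6)\<^sup>2 - 140 * (K 4)\<^sup>2 * K 6"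
proof -
  have "reval (Rpoly 7) K = reval (Apoly 6) K + reval (Lop (Rpoly 6)) K + reval (Hop (Rpoly 6)) K"
    using lin_Rpoly_Suc[of 6] by (simp add: reval_def)
  then show ?thesis
    using assms unfolding reval_Apoly reval_Lop reval_Hop lin_R6
    by (simp add: splitval_def sum_atLeastLessThan_upt upt_small upt_rec_numeral choose_small power_numeral_reduce
        numeral_2_eq_2[symmetric] algebra_simps diff_divide_distrib add_divide_distrib)
qed

text \<open>The linear coefficient of \<open>R_5\<close> in \<open>T_4\<close> is
  \<open>- 30 * T_3^2\<close>, which vanishes for symmetric laws, so the sign of \<open>K 4\<close>
  has to come from higher indices.\<close>

lemma fourth_determined:
  fixes K K' :: "nat \<Rightarrow> 'a::field_char_0"
  assumes odd: "\<And>i. odd i \<Longrightarrow> K i = 0" "\<And>i. odd i \<Longrightarrow> K' i = 0" and two: "K 2 = K' 2"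
    and eq: "\<And>n. n \<ge> 2 \<Longrightarrow> reval (Gpoly n) K = reval (Gpoly n) K'"
  shows "K 4 = K' 4"
proof (rule ccontr)
  assume neq: "K 4 \<noteq> K' 4"
  have "K i = K' i" if "0 < i" "i < 4" for i
  proof -
    have "i = 1 \<or> i = 2 \<or> i = 3" using that by auto
    then show ?thesis using odd two by auto
  qed
  then have "reval (Rpoly 4) K = reval (Rpoly 4) K'" by (intro reval_Rpoly_cong)
  then have sq: "(K 4)\<^sup>2 = (K' 4)\<^sup>2" using eq[of 4] by (simp add: reval_Gpoly)
  have c6: "(K 6)\<^sup>2 - 30 * K 4 ^ 3 = (K' 6)\<^sup>2 - 30 * K' 4 ^ 3"
    using eq[of 6] odd two sq by (simp add: reval_Gpoly reval_R6_even)
  \<comment> \<open>As \<open>1260 = 42 * 30\<close>, the terms with the square of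
    \<open>K 6\<close> and the cube of \<open>K 4\<close> combine to \<open>- 42 * K 2\<close> times
    the quantity in \<open>c6\<close>. What is left is the product of the square of
    \<open>K 4\<close> with \<open>K 6\<close>.\<close>
  have "- 42 * K 2 * ((K 6)\<^sup>2 - 30 * K 4 ^ 3) - 140 * (K 4)\<^sup>2 * K 6
      = - 42 * K' 2 * ((K' 6)\<^sup>2 - 30 * K' 4 ^ 3) - 140 * (K' 4)\<^sup>2 * K' 6"
    using eq[of 7] odd two sq by (simp add: reval_Gpoly reval_R7_even algebra_simps)
  then have "(K 4)\<^sup>2 * K 6 = (K 4)\<^sup>2 * K' 6"
    unfolding c6 two sq by simp
  \<comment> \<open>Were \<open>K 4\<close> zero, the equality of squares would make
    \<open>K' 4\<close> zero as well.\<close>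
  moreover have "K 4 \<noteq> 0" using neq sq by auto
  ultimately have "K 6 = K' 6" by simp
  then have "K 4 ^ 3 = K' 4 ^ 3" using c6 by simp
  then have "(K 4)\<^sup>2 * K 4 = (K 4)\<^sup>2 * K' 4" using sq by (simp add: power_numeral_reduce)
  then show False using \<open>K 4 \<noteq> 0\<close> neq by simp
qed

lemma cumulants_determined:
  fixes K K' :: "nat \<Rightarrow> 'a::field_char_0"
  assumes odd: "\<And>i. odd i \<Longrightarrow> K i = 0" "\<And>i. odd i \<Longrightarrow> K' i = 0" and two: "K 2 = K' 2"
    and eq: "\<And>n. n \<ge> 2 \<Longrightarrow> reval (Gpoly n) K = reval (Gpoly n) K'"
    and nz: "\<And>m. m \<ge> 3 \<Longrightarrow> reval (apoly (2 * m)) K \<noteq> 0"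
    and "n > 0"
  shows "K n = K' n"
  using \<open>n > 0\<close>
proof (induction n rule: less_induct)
  case (less n)
  show ?case
  proof (cases "odd n")
    case True
    then show ?thesis using odd by simp
  next
    case False
    then obtain m where m: "n = 2 * m" by (auto elim: evenE)
    consider "m = 1" | "m = 2" | "m \<ge> 3" using less.prems m by linarith
    then show ?thesis
    proof cases
      case 3
      show ?thesis
        by (rule sign_determined) (use 3 m less.IH odd eq nz in auto)
    qed (use m two fourth_determined[OF odd two eq] in simp_all)
  qed
qed

section \<open>Cumulants of the characteristic function\<close>

context all_moments
begin

text \<open>The \<open>k\<close>-th derivative of the characteristic function.\<close>

definition chmom :: "nat \<Rightarrow> real \<Rightarrow> complex" where
  "chmom k t = (\<integral>x. (\<i> * of_real x) ^ k * iexp (t * x) \<partial>\<mu>)"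

lemma norm_chmom_integrand: "norm ((\<i> * of_real x) ^ k * iexp (t * x)) \<le> 1 * (1 + x\<^sup>2) ^ k"
  using abs_power_le_one_plus_square[of x k] by (simp add: norm_mult norm_power power_abs)

lemma integrable_chmom: "integrable \<mu> (\<lambda>x. (\<i> * of_real x) ^ k * iexp (t * x))"
  by (rule integrable_bounded_by_weight[OF _ norm_chmom_integrand]) measurable

lemma chmom_has_vector_derivative: "(chmom k has_vector_derivative chmom (Suc k) t) (at t)"
  unfolding chmom_def[abs_def]
proof (rule has_vector_derivative_integral_dominated[where e = 1 and D = "\<lambda>x. 1 * (1 + x\<^sup>2) ^ Suc k"
      and f' = "\<lambda>t x. (\<i> * of_real x) ^ Suc k * iexp (t * x)"])
  fix t x :: real
  have "((\<lambda>w. (\<i> * of_real x) ^ k * exp (w * (\<i> * of_real x))) has_field_derivative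
      (\<i> * of_real x) ^ Suc k * exp (of_real t * (\<i> * of_real x))) (at (of_real t))"
    by (auto intro!: derivative_eq_intros)
  from has_vector_derivative_real_field[OF this]
  show "((\<lambda>t. (\<i> * of_real x) ^ k * iexp (t * x)) has_vector_derivative (\<i> * of_real x) ^ Suc k * iexp (t * x)) (at t)"
    by (simp add: mult_ac)
  show "norm ((\<i> * of_real x) ^ Suc k * iexp (t * x)) \<le> 1 * (1 + x\<^sup>2) ^ Suc k"
    by (rule norm_chmom_integrand)
qed (use integrable_chmom integrable_weight[of "Suc k"] in auto)

lemma chmom_0: "chmom 0 = char \<mu>"
  by (simp add: fun_eq_iff chmom_def char_def)

text \<open>A positive real part keeps the values off the branch cut of \<open>Ln\<close>. The
  identity is proved on an interval because \<open>nth_deriv\<close> iterates derivatives of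
  functions, and for \<open>Suc n\<close> because \<open>cum\<close> has a junk value at 0.\<close>

lemma nth_deriv_Ln_char:
  assumes re: "\<And>t. \<bar>t\<bar> < e \<Longrightarrow> Re (chmom 0 t) > 0" and "\<bar>t\<bar> < e"
  shows "nth_deriv (Suc n) (\<lambda>t. Ln (char \<mu> t)) t = cum (\<lambda>k. chmom k t) (Suc n)"
  using assms(2)
proof (induction n arbitrary: t)
  case 0
  have "chmom 0 t \<notin> \<real>\<^sub>\<le>\<^sub>0" using re[OF 0] by (auto simp: complex_nonpos_Reals_iff)
  then have "((Ln \<circ> chmom 0) has_vector_derivative (chmom (Suc 0) t * inverse (chmom 0 t))) (at t)"
    by (intro field_vector_diff_chain_at chmom_has_vector_derivative has_field_derivative_Ln)
  then have "((\<lambda>t. Ln (char \<mu> t)) has_vector_derivative (chmom (Suc 0) t / chmom 0 t)) (at t)"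
    by (simp add: chmom_0 o_def divide_inverse)
  then show ?case by (simp add: nth_deriv_def vector_derivative_at cum_Suc[of _ 0])
next
  case (Suc n)
  have nz: "chmom 0 t \<noteq> 0" using re[OF Suc.prems] by auto
  have "((\<lambda>t. cum (\<lambda>k. chmom k t) (Suc n)) has_vector_derivative cum (\<lambda>k. chmom k t) (Suc (Suc n))) (at t)"
    by (rule has_vector_derivative_cum_shift[OF chmom_has_vector_derivative nz])
  then have "(nth_deriv (Suc n) (\<lambda>t. Ln (char \<mu> t)) has_vector_derivative cum (\<lambda>k. chmom k t) (Suc (Suc n))) (at t)"
    by (rule has_vector_derivative_transform_within_open[where S = "{- e<..<e}"])
      (use Suc in \<open>auto simp: abs_less_iff\<close>)
  then show ?case by (simp add: nth_deriv_def vector_derivative_at)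
qed

lemma cumulant_eq_kap:
  assumes "n > 0"
  shows "cumulant \<mu> n = of_real (kap 0 0 n)"
proof -
  have "isCont (chmom 0) 0"
    using has_vector_derivative_continuous[OF chmom_has_vector_derivative] .
  then have "isCont (\<lambda>t. Re (chmom 0 t)) 0" by (rule isCont_Re)
  moreover have "chmom 0 0 = 1" using prob_space by (simp add: chmom_def)
  ultimately have "\<forall>\<^sub>F t in at 0. Re (chmom 0 t) > 0"
    by (intro order_tendstoD(1)[where y = 1]) (auto simp: isCont_def)
  then obtain e where e: "e > 0" "\<And>t. t \<noteq> 0 \<Longrightarrow> \<bar>t\<bar> < e \<Longrightarrow> Re (chmom 0 t) > 0"
    by (auto simp: eventually_at dist_real_def)
  have re: "Re (chmom 0 t) > 0" if "\<bar>t\<bar> < e" for t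
    using e(2)[OF _ that] \<open>chmom 0 0 = 1\<close> by (cases "t = 0") auto
  have c: "chmom k 0 = \<i> ^ k * of_real (mom k 0 0)" for k
  proof -
    have "chmom k 0 = (\<integral>x. \<i> ^ k * of_real (x ^ k) \<partial>\<mu>)"
      by (simp add: chmom_def power_mult_distrib)
    then show ?thesis by (simp add: mom_0_0(1) del: of_real_power)
  qed
  obtain j where j: "n = Suc j" using assms by (cases n) auto
  have "cumulant \<mu> n = (- \<i>) ^ n * cum (\<lambda>k. \<i> ^ k * of_real (mom k 0 0)) n"
    unfolding cumulant_def j using nth_deriv_Ln_char[where t = 0 and n = j, OF re] e(1) by (simp add: c)
  \<comment> \<open>The powers of \<open>\<i>\<close> come out of \<open>cum\<close> and cancel, as
    \<open>(- \<i>) * \<i> = 1\<close>.\<close>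
  also have "\<dots> = ((- \<i>) * \<i>) ^ n * cum (\<lambda>k. of_real (mom k 0 0)) n"
    by (simp only: cum_scale power_mult_distrib mult.assoc)
  also have "\<dots> = of_real (kap 0 0 n)" by (simp add: kap_def of_real_cum)
  finally show ?thesis .
qed

section \<open>Expected values of polynomials in the conditional cumulants\<close>

lemma expect_lin:
  assumes s: "s > 0" and "\<And>M. bdd cumC (p M) (\<lambda>K. F K M)" "\<And>M. continuous_on UNIV (\<lambda>u. F (kap s u) M)"
  shows "expect s (\<lambda>K. lin (F K) q) = lin (\<lambda>M. expect s (\<lambda>K. F K M)) q"
proof -
  have i: "integrable lborel (\<lambda>u. dens s u * F (kap s u) M)" for M
    by (rule integrable_dens[OF s assms(2,3)])
  have "expect s (\<lambda>K. lin (F K) q)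
    = (\<integral>u. (\<Sum>M\<in>Poly_Mapping.keys q. of_rat (Poly_Mapping.lookup q M) * (dens s u * F (kap s u) M)) \<partial>lborel)"
    unfolding expect_def lin_def by (simp add: sum_distrib_left mult_ac)
  also have "\<dots> = (\<Sum>M\<in>Poly_Mapping.keys q. of_rat (Poly_Mapping.lookup q M) * (\<integral>u. dens s u * F (kap s u) M \<partial>lborel))"
    using i by (subst Bochner_Integration.integral_sum) auto
  finally show ?thesis by (simp add: expect_def lin_def)
qed

lemma expect_reval:
  "s > 0 \<Longrightarrow> expect s (reval q) = lin (\<lambda>M. expect s (\<lambda>K. monoval K (sorted_list_of_multiset M))) q"
  unfolding reval_def[abs_def]
  by (rule expect_lin[OF _ bdd_monoval]) (auto intro!: continuous_on_monoval[where K = "\<lambda>i u. kap _ u i"] continuous_kap)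

lemma expect_reval_has_derivative:
  assumes s: "s > 0" and q: "\<And>M. M \<in> Poly_Mapping.keys q \<Longrightarrow> 0 \<notin># M"
  shows "((\<lambda>s. expect s (reval q)) has_real_derivative expect s (reval (Lop q + Hop q))) (at s)"
proof -
  let ?l = sorted_list_of_multiset
  have "expect s (reval (Lop q + Hop q)) = expect s (\<lambda>K. lin (\<lambda>M. Lval K (?l M) + Hval K (?l M)) q)"
    by (simp add: reval_add[abs_def] reval_Lop reval_Hop lin_def sum.distrib distrib_left)
  also have "\<dots> = lin (\<lambda>M. expect s (\<lambda>K. Lval K (?l M) + Hval K (?l M))) q"
    by (rule expect_lin[OF s bdd_add[OF bdd_Lval bdd_Hval]])
      (intro continuous_intros continuous_on_monoval[where K = "\<lambda>i u. kap s u i"] continuous_kap s)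
  finally have eq: "expect s (reval (Lop q + Hop q)) = lin (\<lambda>M. expect s (\<lambda>K. Lval K (?l M) + Hval K (?l M))) q" .
  have "((\<lambda>s. lin (\<lambda>M. expect s (\<lambda>K. monoval K (?l M))) q) has_real_derivative
      lin (\<lambda>M. expect s (\<lambda>K. Lval K (?l M) + Hval K (?l M))) q) (at s)"
    unfolding lin_def using q
    by (intro DERIV_sum DERIV_cmult expect_has_derivative[OF s]) auto
  then have "((\<lambda>s. expect s (reval q)) has_real_derivative
      lin (\<lambda>M. expect s (\<lambda>K. Lval K (?l M) + Hval K (?l M))) q) (at s)"
    by (rule has_field_derivative_transform_within_open[where S = "{0<..}"])
      (use s in \<open>auto simp: expect_reval\<close>)
  then show ?thesis by (simp add: eq)
qed

lemma expect_reval_tendsto: "(\<lambda>n. expect (1 / real (Suc n)) (reval q)) \<longlonglongrightarrow> reval q (kap 0 0)"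
proof -
  have "(\<lambda>n. lin (\<lambda>M. expect (1 / real (Suc n)) (\<lambda>K. monoval K (sorted_list_of_multiset M))) q) \<longlonglongrightarrow> reval q (kap 0 0)"
    unfolding reval_def lin_def by (intro tendsto_intros expect_tendsto)
  then show ?thesis by (simp add: expect_reval)
qed

end

section \<open>The mmse determines the law\<close>

text \<open>Functions that agree for all \<open>s > 0\<close> have equal derivatives there, so
  equality of the means of \<open>G_n\<close> passes on to \<open>G_(n+1)\<close>. Letting
  \<open>s\<close> tend to 0 replaces means by values at the cumulants.\<close>

lemma reval_Gpoly_eq_of_mmse_eq:
  assumes "all_moments \<mu>" "all_moments \<nu>" and mmse: "\<And>s. s > 0 \<Longrightarrow> mmse \<mu> s = mmse \<nu> s"
  shows "all_moments.kap \<mu> 0 0 2 = all_moments.kap \<nu> 0 0 2"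
    and "n \<ge> 2 \<Longrightarrow> reval (Gpoly n) (all_moments.kap \<mu> 0 0) = reval (Gpoly n) (all_moments.kap \<nu> 0 0)"
proof -
  interpret A: all_moments \<mu> by fact
  interpret B: all_moments \<nu> by fact
  have diff: "f' = g'" if "\<And>s. s > 0 \<Longrightarrow> f s = g s" "s > 0" "(f has_real_derivative f') (at s)" "(g has_real_derivative g') (at s)"
    for f g :: "real \<Rightarrow> real" and s f' g'
  proof -
    have "(g has_real_derivative f') (at s)"
      by (rule has_field_derivative_transform_within_open[OF that(3), where S = "{0<..}"]) (use that in auto)
    then show ?thesis using that(4) by (rule DERIV_unique)
  qed
  let ?T = "Poly_Mapping.single {#2#} 1 :: tpoly"
  have T: "reval ?T = (\<lambda>K. K 2 :: real)" by (simp add: reval_def fun_eq_iff)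
  have eT: "A.expect s (reval ?T) = B.expect s (reval ?T)" if "s > 0" for s
    using A.mmse_eq_expect[OF that] B.mmse_eq_expect[OF that] mmse[OF that] by (simp add: T)
  show "A.kap 0 0 2 = B.kap 0 0 2"
  proof -
    have "(\<lambda>n. B.expect (1 / real (Suc n)) (reval ?T)) \<longlonglongrightarrow> reval ?T (A.kap 0 0)"
      using A.expect_reval_tendsto[of ?T] by (simp add: eT)
    from LIMSEQ_unique[OF this B.expect_reval_tendsto] show ?thesis by (simp add: T)
  qed
  have pos: "0 \<notin># M" if "M \<in> Poly_Mapping.keys (Gpoly n)" "n \<ge> 2" for M n
  proof -
    have "M \<in> Poly_Mapping.keys (Poly_Mapping.single {#n, n#} (1 :: rat)) \<or> M \<in> Poly_Mapping.keys (Rpoly n)"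
      using that(1) Poly_Mapping.keys_add[of "Poly_Mapping.single {#n, n#} 1" "Rpoly n"]
      unfolding Gpoly_def by blast
    then have "M = {#n, n#} \<or> M \<in> wtset (2 * n) n"
      using keys_in_Rpoly[of n] by (auto simp: keys_in_def)
    then show ?thesis using that(2) by (auto simp: wtset_def)
  qed
  have eG: "A.expect s (reval (Gpoly n)) = B.expect s (reval (Gpoly n))" if "n \<ge> 2" "s > 0" for n s
    using that
  proof (induction n arbitrary: s rule: dec_induct)
    case base
    have "A.expect s (reval (Lop ?T + Hop ?T)) = B.expect s (reval (Lop ?T + Hop ?T))"
      by (rule diff[OF eT base A.expect_reval_has_derivative B.expect_reval_has_derivative]) (use base in auto)
    \<comment> \<open>\<open>L\<close> kills a single variable and \<open>H\<close> takes
      \<open>T_2\<close> to \<open>- T_2^2\<close>; as \<open>R_2 = 0\<close>, this is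
      \<open>- G_2\<close>, where the recursion starts.\<close>
    moreover have "reval (Lop ?T + Hop ?T) = (\<lambda>K :: nat \<Rightarrow> real. - reval (Gpoly 2) K)"
    proof
      fix K :: "nat \<Rightarrow> real"
      have "{1..<2::nat} = {1}" by auto
      then show "reval (Lop ?T + Hop ?T) K = - reval (Gpoly 2) K"
        by (simp add: reval_add reval_Lop reval_Hop reval_Gpoly reval_0 splitval_def power2_eq_square numeral_2_eq_2)
    qed
    ultimately show ?case by (simp add: A.expect_def B.expect_def)
  next
    case (step n)
    have "A.expect s (reval (Lop (Gpoly n) + Hop (Gpoly n))) = B.expect s (reval (Lop (Gpoly n) + Hop (Gpoly n)))"
      by (rule diff[OF step.IH step.prems A.expect_reval_has_derivative B.expect_reval_has_derivative])
        (use step pos in auto)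
    moreover have "reval (Lop (Gpoly n) + Hop (Gpoly n)) = (reval (Gpoly (Suc n)) :: _ \<Rightarrow> real)"
      by (rule ext) (rule reval_Gpoly_Suc[OF step.hyps(1)])
    ultimately show ?case by simp
  qed
  show "reval (Gpoly n) (A.kap 0 0) = reval (Gpoly n) (B.kap 0 0)" if "n \<ge> 2"
  proof -
    have "(\<lambda>k. B.expect (1 / real (Suc k)) (reval (Gpoly n))) \<longlonglongrightarrow> reval (Gpoly n) (A.kap 0 0)"
      using A.expect_reval_tendsto[of "Gpoly n"] eG[OF that] by simp
    from LIMSEQ_unique[OF this B.expect_reval_tendsto] show ?thesis .
  qed
qed

lemma all_moments_distr:
  assumes "prob_space M" "X \<in> borel_measurable M" "has_all_moments M X"
  shows "all_moments (distr M borel X)"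
proof -
  interpret prob_space M by fact
  interpret d: prob_space "distr M borel X" by (rule prob_space_distr[OF assms(2)])
  show ?thesis
    by unfold_locales (use assms in \<open>auto simp: integrable_distr_eq has_all_moments_def\<close>)
qed

lemma symmetric_odd_moment:
  assumes "X \<in> borel_measurable M" "symmetric_rv M X" "odd k"
  shows "(\<integral>x. x ^ k \<partial>distr M borel X) = 0"
proof -
  have "(\<integral>x. x ^ k \<partial>distr M borel X) = (\<integral>x. x ^ k \<partial>distr M borel (\<lambda>\<omega>. - X \<omega>))"
    using assms(2) by (simp add: symmetric_rv_def)
  also have "\<dots> = - (\<integral>x. x ^ k \<partial>distr M borel X)"
    using assms(1,3) by (simp add: integral_distr)
  finally show ?thesis by simp
qed

theorem theorem2p6:
  fixes M :: "'a measure" and X :: "'a \<Rightarrow> real"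
    and N :: "'b measure" and Y :: "'b \<Rightarrow> real"
  assumes "prob_space M" and "X \<in> borel_measurable M"
    and "SMD M X"
    and "\<forall>m::nat\<ge>3. peval (apoly (2 * m)) (cumulant (distr M borel X)) \<noteq> 0"
    and "prob_space N" and "Y \<in> borel_measurable N"
    and "symmetric_rv N Y" and "has_all_moments N Y"
    and "\<forall>s>0. mmse (distr N borel Y) s = mmse (distr M borel X) s"
  shows "distr N borel Y = distr M borel X"
proof -
  have X: "symmetric_rv M X" "has_all_moments M X" using assms(3) by (auto simp: SMD_def)
  let ?\<mu> = "distr M borel X" and ?\<nu> = "distr N borel Y"
  interpret A: all_moments ?\<mu> by (rule all_moments_distr[OF assms(1,2) X(2)])
  interpret B: all_moments ?\<nu> by (rule all_moments_distr[OF assms(5,6,8)])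
  have odd: "A.kap 0 0 i = 0" "B.kap 0 0 i = 0" if "odd i" for i
    unfolding A.kap_def B.kap_def A.mom_0_0(1) B.mom_0_0(1)
    using that symmetric_odd_moment[OF assms(2) X(1)] symmetric_odd_moment[OF assms(6,7)]
    by (auto intro!: cum_odd_eq_0)
  have mm: "mmse ?\<mu> s = mmse ?\<nu> s" if "s > 0" for s using assms(9) that by simp
  note eq = reval_Gpoly_eq_of_mmse_eq[OF A.all_moments_axioms B.all_moments_axioms mm]
  have nz: "reval (apoly (2 * m)) (A.kap 0 0) \<noteq> 0" if "m \<ge> 3" for m
  proof -
    \<comment> \<open>\<open>peval\<close> receives the entire sequence, so index 0 must match too:
      \<open>Ln 1 = 0\<close> agrees with the junk value of \<open>cum\<close>.\<close>
    have "cumulant ?\<mu> 0 = of_real (A.kap 0 0 0)"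
    proof -
      have "char ?\<mu> 0 = 1" using A.prob_space by (simp add: char_def)
      then show ?thesis by (simp add: cumulant_def nth_deriv_def A.kap_def)
    qed
    then have "cumulant ?\<mu> i = of_real (A.kap 0 0 i)" for i
      by (cases "i = 0") (simp_all add: A.cumulant_eq_kap)
    then have "cumulant ?\<mu> = (\<lambda>i. of_real (A.kap 0 0 i))" by (rule ext)
    then show ?thesis using assms(4) that by (auto simp: peval_eq_reval of_real_reval[symmetric])
  qed
  have kap: "A.kap 0 0 n = B.kap 0 0 n" if "n > 0" for n
    by (rule cumulants_determined[OF odd eq nz that])
  have mom: "A.mom n 0 0 = B.mom n 0 0" for n
    by (rule cum_determines_moments[where m = "\<lambda>n. A.mom n 0 0" and m' = "\<lambda>n. B.mom n 0 0"])
      (simp_all add: A.mom_0_0(2) B.mom_0_0(2) kap[unfolded A.kap_def B.kap_def])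
  have "(\<integral>y. y ^ p \<partial>?\<nu>) = (\<integral>\<omega>. X \<omega> ^ p \<partial>M)" for p
    using mom[of p] assms(2) unfolding A.mom_0_0(1) B.mom_0_0(1) by (simp add: integral_distr)
  \<comment> \<open>The law of \<open>Y\<close> is now a competitor in the determinacy clause of
    \<open>SMD\<close>.\<close>
  then have hyp: "prob_space ?\<nu> \<and> sets ?\<nu> = sets borel \<and>
      (\<forall>p::nat\<ge>1. integrable ?\<nu> (\<lambda>y. y ^ p) \<and> (\<integral>y. y ^ p \<partial>?\<nu>) = (\<integral>\<omega>. X \<omega> ^ p \<partial>M))"
    using B.prob_space_axioms B.integrable_power by simp
  have "\<forall>\<nu>::real measure. prob_space \<nu> \<and> sets \<nu> = sets borel \<and>
      (\<forall>p::nat\<ge>1. integrable \<nu> (\<lambda>y. y ^ p) \<and> (\<integral>y. y ^ p \<partial>\<nu>) = (\<integral>\<omega>. X \<omega> ^ p \<partial>M)) \<longrightarrow> \<nu> = ?\<mu>"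
    using assms(3) by (simp add: SMD_def)
  from mp[OF spec[OF this] hyp] show ?thesis .
qed

end
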